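(* Let $\alpha(t)=(y_1(t),y_2(t))$, $t\in\mathbb{R}$, be a solution of $$\ddot y_1=\frac{\partial\omega}{\partial y_1}+2\dot y_2,\qquad \ddot y_2=\frac{\partial\omega}{\partial y_2}-2\dot y_1$$ with Jacobian integral equal to $C$. Assume that: (i) $\alpha$ is periodic: there is $T>0$ such that $\alpha(t+T)=\alpha(t)$ for all $t\in\mathbb{R}$; (ii) $\alpha$ is regular: $|\dot\alpha(t)|\neq 0$ for all $t\in\mathbb{R}$; (iii) $\alpha$ is simple: $\alpha:[0,T)\to\mathbb{R}^2$ is injective; (iv) the region $\Omega$ enclosed by the curve $\alpha$ contains the point $(-\mu,0)$ and is contained in $U_C\cup\{(-\mu,0)\}$. Let $f=\sqrt{2\omega-C}$. Then: - if $\alpha$ goes clockwise around $\Omega$, then $\displaystyle 2T=\pi+\iint_\Omega \Delta\ln f\,dy_1dy_2$; - if $\alpha$ goes counterclockwise around $\Omega$, then $\displaystyle 2T=-\pi-\iint_\Omega \Delta\ln f\,dy_1dy_2$.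
   Context: Fix a real number $\mu$ with $0<\mu\le \frac12$ (mass parameter of the planar circular restricted three body problem, in rotating coordinates). On $\mathbb{R}^2\setminus\{(-\mu,0),(1-\mu,0)\}$ define $$\omega(y_1,y_2)=\frac12(y_1^2+y_2^2)+\frac{1-\mu}{\sqrt{(y_1+\mu)^2+y_2^2}}+\frac{\mu}{\sqrt{(y_1+\mu-1)^2+y_2^2}}.$$ For every solution of the differential equation the quantity $-\dot y_1^2-\dot y_2^2+2\omega(y_1,y_2)$ is a constant $C$, called its Jacobian integral. For a constant $C$, $U_C=\{(y_1,y_2): 2\omega(y_1,y_2)-C\ge 0\}$, where the two points $(-\mu,0)$ and $(1-\mu,0)$ (at which $\omega$ is undefined) are not considered part of $U_C$. $\Delta=\partial_{y_1}^2+\partial_{y_2}^2$ is the Laplacian; $\ln f$ is not defined at $(-\mu,0)$, and the integral over $\Omega$ is over $\Omega$ minus this point. The region enclosed by a simple closed curve is the bounded component of its complement.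
   Formalization: It is additionally assumed that f does not vanish on Ω minus (-μ,0); condition (iv) alone allows f=0 at a minimum of ω (L4 or L5, when C=3-μ(1-μ)), where ln f is undefined and the integral of Δ ln f does not converge absolutely. *)

theory Defs
  imports "HOL-Complex_Analysis.Complex_Analysis"
begin

definition primary1 :: "real \<Rightarrow> real \<times> real" where
  "primary1 \<mu> = (- \<mu>, 0)"

definition primary2 :: "real \<Rightarrow> real \<times> real" where
  "primary2 \<mu> = (1 - \<mu>, 0)"

(* Takes junk values (because x / 0 = 0) at the two primaries; they are excluded
   explicitly wherever omega is used. *)
definition omega :: "real \<Rightarrow> real \<times> real \<Rightarrow> real" where
  "omega \<mu> = (\<lambda>(y1, y2).
     (y1^2 + y2^2) / 2
     + (1 - \<mu>) / sqrt ((y1 + \<mu>)^2 + y2^2)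
     + \<mu> / sqrt ((y1 + \<mu> - 1)^2 + y2^2))"

definition partial1 :: "(real \<times> real \<Rightarrow> real) \<Rightarrow> real \<times> real \<Rightarrow> real" where
  "partial1 F = (\<lambda>(a, b). deriv (\<lambda>x. F (x, b)) a)"

definition partial2 :: "(real \<times> real \<Rightarrow> real) \<Rightarrow> real \<times> real \<Rightarrow> real" where
  "partial2 F = (\<lambda>(a, b). deriv (\<lambda>y. F (a, y)) b)"

definition laplacian :: "(real \<times> real \<Rightarrow> real) \<Rightarrow> real \<times> real \<Rightarrow> real" where
  "laplacian F p = partial1 (partial1 F) p + partial2 (partial2 F) p"

(* The first two conjuncts after the domain condition make deriv y1 and deriv y2
   genuine derivatives; the last two are the differential equation itself. *)
definition crtbp_solution :: "real \<Rightarrow> (real \<Rightarrow> real) \<Rightarrow> (real \<Rightarrow> real) \<Rightarrow> bool" where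
  "crtbp_solution \<mu> y1 y2 \<longleftrightarrow>
     (\<forall>t. (y1 t, y2 t) \<notin> {primary1 \<mu>, primary2 \<mu>} \<and>
          (y1 has_real_derivative deriv y1 t) (at t) \<and>
          (y2 has_real_derivative deriv y2 t) (at t) \<and>
          (deriv y1 has_real_derivative
             (partial1 (omega \<mu>) (y1 t, y2 t) + 2 * deriv y2 t)) (at t) \<and>
          (deriv y2 has_real_derivative
             (partial2 (omega \<mu>) (y1 t, y2 t) - 2 * deriv y1 t)) (at t))"

definition has_jacobi_integral ::
    "real \<Rightarrow> (real \<Rightarrow> real) \<Rightarrow> (real \<Rightarrow> real) \<Rightarrow> real \<Rightarrow> bool" where
  "has_jacobi_integral \<mu> y1 y2 C \<longleftrightarrow>
     (\<forall>t. - ((deriv y1 t)^2) - (deriv y2 t)^2 + 2 * omega \<mu> (y1 t, y2 t) = C)"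

definition hill_region :: "real \<Rightarrow> real \<Rightarrow> (real \<times> real) set" where
  "hill_region \<mu> C = {p. p \<notin> {primary1 \<mu>, primary2 \<mu>} \<and> 2 * omega \<mu> p - C \<ge> 0}"

(* One period [0,T] of the plane curve, reparametrised to [0,1] and with the plane
   identified with the complex numbers, as the library's winding_number requires. *)
definition period_path :: "(real \<Rightarrow> real) \<Rightarrow> (real \<Rightarrow> real) \<Rightarrow> real \<Rightarrow> real \<Rightarrow> complex" where
  "period_path y1 y2 T = (\<lambda>s. Complex (y1 (T * s)) (y2 (T * s)))"

definition goes_counterclockwise_around ::
    "(real \<Rightarrow> real) \<Rightarrow> (real \<Rightarrow> real) \<Rightarrow> real \<Rightarrow> (real \<times> real) set \<Rightarrow> bool" where
  "goes_counterclockwise_around y1 y2 T \<Omega> \<longleftrightarrow>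
     (\<forall>(a, b)\<in>\<Omega>. winding_number (period_path y1 y2 T) (Complex a b) = 1)"

definition goes_clockwise_around ::
    "(real \<Rightarrow> real) \<Rightarrow> (real \<Rightarrow> real) \<Rightarrow> real \<Rightarrow> (real \<times> real) set \<Rightarrow> bool" where
  "goes_clockwise_around y1 y2 T \<Omega> \<longleftrightarrow>
     (\<forall>(a, b)\<in>\<Omega>. winding_number (period_path y1 y2 T) (Complex a b) = - 1)"

end

theory Submission
  imports Defs
begin

text \<open>
  Along the orbit the velocity \<open>v\<close> satisfies \<open>\<bar>v\<bar>\<^sup>2 = f\<^sup>2 = 2 \<omega> - C\<close>, and the equations of motion say
  \<open>v' = \<nabla>\<omega> - 2 \<i> v\<close>. Hence \<open>v' / v = cnj (\<psi> v) - 2 \<i>\<close> with \<open>\<psi> = 2 \<partial>\<^sub>z ln f\<close>. Integrating over a period,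
  the left side gives \<open>2 \<pi> \<i>\<close> times the rotation number of the velocity, which by Hopf's Umlaufsatz is
  the winding number \<open>\<sigma> = \<plusminus>1\<close> of the curve around its interior. On the right, \<open>\<psi> + 1/(2 (z - p))\<close> is
  bounded near the primary \<open>p\<close> with integrable derivatives, so that Green's theorem turns the contour
  integral of \<open>\<psi>\<close> into \<open>- \<sigma> \<pi> \<i>\<close> plus \<open>\<i> \<sigma>\<close> times the integral of the Laplacian.

  Green's theorem is obtained in the form weighted by winding numbers: integrate the Cauchy-Pompeiu
  formula for a compactly supported function along the curve and exchange the integrals. This needs
  no regularity of the domain. The exchange is legitimate because \<open>1/\<bar>z - p\<bar>\<close> is locally integrable.
\<close>

subsection \<open>Rotation number of a simple closed curve\<close>

text \<open>The pole of \<open>grad_lnf\<close> has weight 1/2 because 2 \<omega> - C grows like 2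
  (1 - \<mu>) / |z - p|, so ln f behaves like -(1/2) ln |z - p|. The number pi in the result is what
  remains of a full turn 2 pi of the velocity after the half turn pi coming from this pole; the term
  2 T is the Coriolis term 2 \<i> integrated over a period. Two obstacles shape the proof. The
  region \<Omega> is given only as \<open>inside\<close> of the curve, with its orientation
  expressed by winding numbers at interior points. Therefore the Umlaufsatz is stated by exhibiting
  an interior point whose winding number equals the rotation number of the velocity. The other
  obstacle is that \<psi> without its pole is still not C1 at p: it contains the factor cnj (z - p)
  / |z - p|, bounded but discontinuous, with gradient of order 1 / |z - p|. Hence a calculus of
  functions with exactly this behaviour at one point. Dropping the pole does not change the area
  integrand, since 1 / (z - p) is holomorphic and \<open>dbar2\<close> annihilates it.\<close>

lemma log_increment_unique:
  fixes p q :: "real \<Rightarrow> complex"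
  assumes ab: "a \<le> b" and p: "continuous_on {a..b} p" and q: "continuous_on {a..b} q"
    and eq: "\<And>t. t \<in> {a..b} \<Longrightarrow> exp (p t) = c * exp (q t)"
  shows "p b - p a = q b - q a"
proof -
  have c: "exp (p t - q t) = c" if "t \<in> {a..b}" for t
    using eq[OF that] by (simp add: exp_diff)
  \<comment> \<open>The difference takes its values among the logarithms of the fixed number
    \<open>c\<close>, which are at least 2 pi apart; a continuous function with such a discrete
    range is constant on an interval.\<close>
  have "(\<lambda>t. p t - q t) constant_on {a..b}"
  proof (rule continuous_discrete_range_constant)
    fix x assume x: "x \<in> {a..b}"
    show "\<exists>e>0. \<forall>y. y \<in> {a..b} \<and> p y - q y \<noteq> p x - q x \<longrightarrow> e \<le> norm ((p y - q y) - (p x - q x))"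
    proof (intro exI[of _ "2*pi"] conjI allI impI)
      fix y assume y: "y \<in> {a..b} \<and> p y - q y \<noteq> p x - q x"
      then have "exp (p y - q y) = exp (p x - q x)" using c x by simp
      then obtain n where n: "p y - q y = (p x - q x) + (of_int (2 * n) * pi) * \<i>"
        using exp_eq by blast
      with y have "n \<noteq> 0" by auto
      then have "\<bar>real_of_int n\<bar> \<ge> 1" by linarith
      moreover have "norm ((p y - q y) - (p x - q x)) = \<bar>real_of_int n\<bar> * (2 * pi)"
        unfolding n by (simp add: norm_mult abs_mult)
      ultimately show "2*pi \<le> norm ((p y - q y) - (p x - q x))"
        by simp
    qed simp
  qed (use p q in \<open>auto intro!: continuous_intros\<close>)
  then have "p b - q b = p a - q a"
    using ab by (auto simp: constant_on_def)
  then show ?thesis by (simp add: algebra_simps)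
qed

text \<open>The two arguments are opposite, so their principal logarithms differ by a half turn
  whose sign is that of Im (\<i> z) = Re z. As functions of z the two logarithms are cut along the
  positive and the negative imaginary axis respectively; half turns are counted below by switching
  from one to the other.\<close>

lemma Ln_quarter_turns:
  assumes "Re z \<noteq> 0"
  shows "Ln (\<i> * z) - Ln (- (\<i> * z)) = of_real (pi * sgn (Re z)) * \<i>"
proof -
  have "\<i> * z \<noteq> 0" using assms by auto
  from Ln_minus[OF this] show ?thesis
    using assms by (auto simp: sgn_if)
qed

lemma in_open_half_plane_not_nonpos_Reals: "0 < Re z \<or> Im z \<noteq> 0 \<Longrightarrow> z \<notin> \<real>\<^sub>\<le>\<^sub>0"
  by (auto simp: complex_nonpos_Reals_iff)

text \<open>The mean of the velocity between s and s + x. It is the difference quotient of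
  \<open>g\<close> for x \<noteq> 0 and the velocity for x = 0; written as a parameter integral it
  is visibly continuous in both variables, also at x = 0.\<close>

definition secant :: "(real \<Rightarrow> complex) \<Rightarrow> (real \<Rightarrow> complex) \<Rightarrow> real \<times> real \<Rightarrow> complex" where
  "secant g g' = (\<lambda>(s, x). integral {0..1} (\<lambda>\<tau>. g' (s + \<tau> * x)))"

text \<open>The period is normalised to 1 and \<open>g\<close> lives on the whole line, so that
  moving the base point is a translation and secants may run past the end of a period.\<close>

locale regular_loop =
  fixes g g' :: "real \<Rightarrow> complex"
  assumes deriv: "\<And>t. (g has_vector_derivative g' t) (at t)"
    and cont': "continuous_on UNIV g'"
    and nz: "\<And>t. g' t \<noteq> 0"
    and per: "\<And>t. g (t + 1) = g t"
    and inj: "inj_on g {0..<1}"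
begin

lemma cont: "continuous_on UNIV g"
  using deriv by (meson continuous_at_imp_continuous_on has_vector_derivative_continuous)

lemma per_int: "g (t + of_int n) = g t"
proof -
  have nat: "g (t + of_nat n) = g t" for t n
  proof (induction n arbitrary: t)
    case (Suc n)
    have "g (t + real (Suc n)) = g ((t + real n) + 1)" by (simp add: algebra_simps)
    then show ?case by (simp only: per Suc)
  qed simp
  show ?thesis
  proof (cases n rule: int_cases2)
    case (nonneg k)
    then show ?thesis using nat by simp
  next
    case (nonpos k)
    then show ?thesis using nat[of "t + of_int n" k] by simp
  qed
qed

lemma per': "g' (t + 1) = g' t"
proof -
  have "((g \<circ> (\<lambda>x. x + 1)) has_vector_derivative 1 *\<^sub>R g' (t + 1)) (at t)"
    by (rule vector_diff_chain_at) (auto intro!: derivative_eq_intros deriv)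
  then have "((\<lambda>x. g (x + 1)) has_vector_derivative g' (t + 1)) (at t)"
    by (simp add: o_def)
  then have "(g has_vector_derivative g' (t + 1)) (at t)" by (simp add: per)
  then show ?thesis using deriv vector_derivative_unique_at by blast
qed

lemma eq_iff: "g s = g t \<longleftrightarrow> (\<exists>n. s = t + of_int n)"
proof
  assume eq: "g s = g t"
  have f: "g x = g (frac x)" for x using per_int[of "frac x" "\<lfloor>x\<rfloor>"] by (simp add: frac_def)
  have "g (frac s) = g (frac t)" using eq f by metis
  then have "frac s = frac t" using inj by (auto simp: inj_on_def frac_ge_0 frac_lt_1)
  then have "s = t + of_int (\<lfloor>s\<rfloor> - \<lfloor>t\<rfloor>)" by (simp add: frac_def)
  then show "\<exists>n. s = t + of_int n" by blast
qed (use per_int in auto)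

lemma secant_mult: "of_real x * secant g g' (s, x) = g (s + x) - g s"
proof -
  have "((\<lambda>\<tau>. x *\<^sub>R g' (s + \<tau> * x)) has_integral g (s + 1 * x) - g (s + 0 * x)) {0..1}"
  proof (rule fundamental_theorem_of_calculus)
    fix \<tau> :: real
    have "((g \<circ> (\<lambda>\<tau>. s + \<tau> * x)) has_vector_derivative x *\<^sub>R g' (s + \<tau> * x)) (at \<tau> within {0..1})"
    proof (rule vector_diff_chain_within)
      show "((\<lambda>\<tau>. s + \<tau> * x) has_vector_derivative x) (at \<tau> within {0..1})"
        by (auto intro!: derivative_eq_intros simp: has_vector_derivative_def)
    qed (rule has_vector_derivative_at_within[OF deriv])
    then show "((\<lambda>\<tau>. g (s + \<tau> * x)) has_vector_derivative x *\<^sub>R g' (s + \<tau> * x)) (at \<tau> within {0..1})"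
      by (simp add: o_def)
  qed simp
  then have "integral {0..1} (\<lambda>\<tau>. x *\<^sub>R g' (s + \<tau> * x)) = g (s + x) - g s"
    by (simp only: mult_1 mult_zero_left add_0_right integral_unique)
  then show ?thesis by (simp add: secant_def scaleR_conv_of_real)
qed

lemma cont_secant: "continuous_on UNIV (secant g g')"
proof -
  have "continuous_on (UNIV \<times> cbox 0 1) (\<lambda>(w, \<tau>). g' (fst w + \<tau> * snd (w::real\<times>real)))"
    unfolding case_prod_unfold
    by (intro continuous_on_compose2[OF cont'] continuous_intros) auto
  from integral_continuous_on_param[OF this]
  show ?thesis by (simp add: secant_def case_prod_unfold)
qed

text \<open>Hopf's secant map, extended continuously to the two edges \<open>u = 0\<close> and \<open>u = 1\<close>,
  where it becomes the velocity and its negative.\<close>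

definition chord :: "real \<times> real \<Rightarrow> complex" where
  "chord = (\<lambda>(s, u). if u \<le> 1/2 then secant g g' (s, u) / of_real (1 - u)
                     else - secant g g' (s, u - 1) / of_real u)"

text \<open>The positive factor u (1 - u) divides out the zeros of g (s + u) - g s at both ends of
  the period and leaves the direction of the secant unchanged.\<close>

lemma chord_eq:
  assumes "0 < u" "u < 1"
  shows "chord (s, u) = (g (s + u) - g s) / of_real (u * (1 - u))"
proof -
  have *: "secant g g' (s, x) = (g (s + x) - g s) / of_real x" if "x \<noteq> 0" for x
    using secant_mult[of x s] that by (simp add: field_simps)
  have "g (s + (u - 1)) = g (s + u)" using per[of "s + (u - 1)"] by (simp add: add.assoc)
  then have "secant g g' (s, u - 1) = (g (s + u) - g s) / of_real (- (1 - u))"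
    using assms by (simp add: * del: of_real_diff)
  then have "secant g g' (s, u - 1) = - ((g (s + u) - g s) / of_real (1 - u))"
    by (simp only: of_real_minus divide_minus_right)
  moreover have "secant g g' (s, u) = (g (s + u) - g s) / of_real u"
    using assms by (simp add: *)
  ultimately show ?thesis
    by (simp add: chord_def mult.commute)
qed

lemma secant_0 [simp]: "secant g g' (s, 0) = g' s"
  by (simp add: secant_def)

lemma chord_0: "chord (s, 0) = g' s" and chord_1: "chord (s, 1) = - g' s"
  by (simp_all add: chord_def)

text \<open>In the interior this is simplicity of the loop, since 0 < u < 1 is not an integer; on
  the two edges it is regularity.\<close>

lemma chord_nonzero:
  assumes "0 \<le> u" "u \<le> 1"
  shows "chord (s, u) \<noteq> 0"
proof -
  consider "u = 0" | "u = 1" | "0 < u" "u < 1" using assms by linarith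
  then show ?thesis
  proof cases
    case 3
    have "g (s + u) \<noteq> g s"
    proof
      assume "g (s + u) = g s"
      then obtain n :: int where "u = of_int n" using eq_iff by auto
      with 3 have "0 < n" "n < 1" by simp_all
      then show False by simp
    qed
    then show ?thesis using 3 by (simp add: chord_eq)
  qed (simp_all add: chord_0 chord_1 nz)
qed

lemma cont_chord: "continuous_on ({0..1} \<times> {0..1}) chord"
proof -
  have "continuous_on ({0..1} \<times> {0..1}) (\<lambda>w. if snd w \<le> 1/2 then secant g g' (fst w, snd w) / of_real (1 - snd w)
                     else - secant g g' (fst w, snd w - 1) / of_real (snd w))"
  proof (rule continuous_on_cases_le[where h = snd and a = "1/2"])
    fix w :: "real \<times> real" assume w: "snd w = 1/2"
    \<comment> \<open>On the seam u = 1/2 the two branches use the secants from s to s + 1/2 and to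
      s - 1/2, which by periodicity end in the same point.\<close>
    have "g (fst w - 1/2) = g (fst w + 1/2)" using per[of "fst w - 1/2"] by (simp add: algebra_simps)
    moreover have "secant g g' (fst w, 1/2) = 2 * (g (fst w + 1/2) - g (fst w))"
      "secant g g' (fst w, -1/2) = - 2 * (g (fst w - 1/2) - g (fst w))"
      using secant_mult[of "1/2" "fst w"] secant_mult[of "-1/2" "fst w"] 
      by (simp_all add: field_simps)
    ultimately show "secant g g' (fst w, snd w) / of_real (1 - snd w)
        = - secant g g' (fst w, snd w - 1) / of_real (snd w)"
      by (simp add: w)
  next
    show "continuous_on {x \<in> {0..1} \<times> {0..1}. snd x \<le> 1 / 2} (\<lambda>w. secant g g' (fst w, snd w) / complex_of_real (1 - snd w))"
      by (intro continuous_intros continuous_on_compose2[OF cont_secant]) auto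
    show "continuous_on {x \<in> {0..1} \<times> {0..1}. 1 / 2 \<le> snd x} (\<lambda>w. - secant g g' (fst w, snd w - 1) / of_real (snd w))"
      by (intro continuous_intros continuous_on_compose2[OF cont_secant]) auto
  qed (intro continuous_intros)
  then show ?thesis by (simp add: chord_def case_prod_unfold)
qed


lemma path_image_eq_range: "path_image g = range g"
proof -
  have "g t \<in> g ` {0..1}" for t
    using per_int[of "frac t" "\<lfloor>t\<rfloor>"] frac_ge_0[of t] frac_lt_1[of t]
    by (intro image_eqI[of _ _ "frac t"]) (auto simp: frac_def)
  then show ?thesis by (auto simp: path_image_def)
qed

lemma path_loop: "path g" "path g'" "g 1 = g 0" "g' 1 = g' 0"
  using cont cont' per[of 0] per'[of 0] by (auto simp: path_def intro: continuous_on_subset)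

lemma Im_velocity_at_lowest:
  assumes low: "\<And>t. Im (g 0) \<le> Im (g t)"
  shows "Im (g' 0) = 0"
proof (rule DERIV_local_min)
  show "((\<lambda>t. Im (g t)) has_real_derivative Im (g' 0)) (at 0)"
    using deriv[of 0] has_vector_derivative_complex_iff by blast
  show "(0::real) < 1" by simp
qed (use low in auto)

text \<open>Hopf's argument. The secant map has a continuous logarithm \<open>L\<close> on the
  contractible square of pairs (s, u), so its increment along the bottom edge, where the map is the
  velocity, equals the increment up the left edge and then down the antidiagonal to (1, 0). Seen
  from a lowest point these two legs are half turns in the same direction.\<close>

lemma rotation_from_lowest:
  assumes low: "\<And>t. Im (g 0) \<le> Im (g t)"
  shows "winding_number g' 0 = of_real (sgn (Re (g' 0)))"
proof -
  obtain L where L: "continuous_on ({0..1} \<times> {0..1}) L"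
     and expL: "\<And>w. w \<in> {0..1} \<times> {0..1} \<Longrightarrow> chord w = exp (L w)"
  proof (rule continuous_logarithm_on_contractible[OF cont_chord])
    show "contractible ({0..1} \<times> {0..1} :: (real \<times> real) set)"
      by (intro convex_imp_contractible convex_Times convex_real_interval)
  qed (use chord_nonzero in auto)
  note contL = continuous_on_compose2[OF L]
  \<comment> \<open>Bottom edge: \<open>L\<close> restricted to u = 0 is a logarithm of the
    velocity, and so has the increment that defines its winding number around 0.\<close>
  have 1: "2 * of_real pi * \<i> * winding_number g' 0 = L (1, 0) - L (0, 0)"
  proof -
    obtain q where q: "path q" "pathfinish q - pathstart q = 2 * of_real pi * \<i> * winding_number g' 0"
         "\<And>t. t \<in> {0..1} \<Longrightarrow> g' t = 0 + exp (q t)"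
      by (rule winding_number_as_continuous_log[of g' 0])
        (use path_loop nz in \<open>auto simp: path_image_def\<close>)
    have "q 1 - q 0 = L (1, 0) - L (0, 0)"
    proof (rule log_increment_unique[where c = 1])
      show "continuous_on {0..1} (\<lambda>s. L (s, 0))"
        by (intro contL continuous_intros) auto
      fix t :: real assume t: "t \<in> {0..1}"
      show "exp (q t) = 1 * exp (L (t, 0))"
        using expL[of "(t, 0)"] chord_0[of t] q(3)[OF t] t by (simp del: exp_not_eq_zero)
    qed (use q in \<open>auto simp: path_def\<close>)
    with q show ?thesis by (simp add: pathfinish_def pathstart_def)
  qed
  \<comment> \<open>Antidiagonal: the secant from g r to g 1 = g 0 is the reverse of the secant from
    g 0 to g r, so both legs have the same increment.\<close>
  have "(\<lambda>r. L (r, 1 - r)) 1 - (\<lambda>r. L (r, 1 - r)) 0 = L (0, 1) - L (0, 0)"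
  proof (rule log_increment_unique[where c = "-1"])
    show "continuous_on {0..1} (\<lambda>r. L (r, 1 - r))" "continuous_on {0..1} (\<lambda>u. L (0, u))"
      by (intro contL continuous_intros; auto)+
    fix r :: real assume r: "r \<in> {0..1}"
    have "chord (r, 1 - r) = - chord (0, r)"
    proof -
      consider "r = 0" | "r = 1" | "0 < r" "r < 1" using r by force
      then show ?thesis
      proof cases
        case 3
        have "chord (r, 1 - r) = (g 1 - g r) / of_real ((1 - r) * r)"
          using 3 by (subst chord_eq) auto
        also have "\<dots> = - ((g r - g 0) / of_real (r * (1 - r)))"
          unfolding path_loop(3) mult.commute[of r "1 - r"] minus_divide_left minus_diff_eq ..
        also have "\<dots> = - chord (0, r)"
          using 3 by (subst chord_eq) auto
        finally show ?thesis .
      qed (simp_all add: chord_0 chord_1 path_loop)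
    qed
    then show "exp (L (r, 1 - r)) = -1 * exp (L (0, r))"
      using expL[of "(r, 1 - r)"] expL[of "(0, r)"] r by simp
  qed simp
  then have 2: "L (1, 0) - L (0, 1) = L (0, 1) - L (0, 0)" by simp
  \<comment> \<open>Left edge: all secants from the lowest point lie in the closed upper half plane.
    Multiplication by -\<i> turns it into the right half plane, which meets the cut of
    \<open>Ln\<close> only in 0, so the increment can be read off at the end points g' 0 and - g'
    0.\<close>
  have "L (0, 1) - L (0, 0) = Ln (- (\<i> * chord (0, 1))) - Ln (- (\<i> * chord (0, 0)))"
  proof (rule log_increment_unique[where c = "\<i>"])
    show "continuous_on {0..1} (\<lambda>u. L (0, u))"
      by (intro contL continuous_intros) auto
    have upper: "0 \<le> Im (chord (0, u))" if u: "u \<in> {0..1}" for u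
    proof -
      consider "u = 0" | "u = 1" | "0 < u" "u < 1" using u by force
      then show ?thesis
      proof cases
        case 3
        have "Im (chord (0, u)) = (Im (g u) - Im (g 0)) / (u * (1 - u))"
          by (simp only: chord_eq[OF 3] Im_divide_of_real add_0 minus_complex.sel)
        then show ?thesis using low[of u] 3 by simp
      qed (simp_all add: chord_0 chord_1 Im_velocity_at_lowest[OF low])
    qed
    have *: "- (\<i> * chord (0, u)) \<notin> \<real>\<^sub>\<le>\<^sub>0" if u: "u \<in> {0..1}" for u
      using upper[OF u] chord_nonzero[of u 0] u
      by (intro in_open_half_plane_not_nonpos_Reals) (auto simp: complex_eq_iff)
    show "continuous_on {0..1} (\<lambda>u. Ln (- (\<i> * chord (0, u))))"
      by (intro continuous_intros continuous_on_compose2[OF cont_chord] *) auto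
    fix u :: real assume u: "u \<in> {0..1}"
    then show "exp (L (0, u)) = \<i> * exp (Ln (- (\<i> * chord (0, u))))"
      using expL[of "(0, u)"] chord_nonzero[of u 0] by simp
  qed simp
  also have "\<dots> = of_real (pi * sgn (Re (g' 0))) * \<i>"
  proof -
    have "Re (g' 0) \<noteq> 0" using nz[of 0] Im_velocity_at_lowest[OF low] by (auto simp: complex_eq_iff)
    then show ?thesis using Ln_quarter_turns[of "g' 0"] by (simp add: chord_0 chord_1)
  qed
  finally show ?thesis using 1 2 by (simp add: algebra_simps)
qed

text \<open>The point is taken slightly above the lowest point. As seen from it, the curve starts
  straight below, leaves to the side given by the sign of Re (g' 0), returns from the other side,
  and in the meantime crosses the vertical line only above it. This is one full turn in the
  direction of motion at the lowest point.\<close>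

lemma winding_near_lowest:
  assumes low: "\<And>t. Im (g 0) \<le> Im (g t)"
  obtains z where "z \<notin> path_image g" "winding_number g z = of_real (sgn (Re (g' 0)))"
proof -
  define v where "v = Re (g' 0)"
  have v: "v \<noteq> 0" using nz[of 0] Im_velocity_at_lowest[OF low] by (auto simp: v_def complex_eq_iff)
  \<comment> \<open>Multiplying by \<open>v\<close> treats both directions of motion at once: the
    derivative is v * v > 0 in either case.\<close>
  have D: "((\<lambda>t. v * Re (g t)) has_real_derivative v * v) (at 0)"
    using deriv[of 0] by (auto simp: v_def has_vector_derivative_complex_iff intro!: derivative_eq_intros)
  have vv: "v * v > 0" using v by (auto simp: zero_less_mult_iff)
  obtain d1 where d1: "d1 > 0" "\<And>h. 0 < h \<Longrightarrow> h < d1 \<Longrightarrow> v * Re (g 0) < v * Re (g (0 + h))"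
    using DERIV_pos_inc_right[OF D vv] by auto
  obtain d2 where d2: "d2 > 0" "\<And>h. 0 < h \<Longrightarrow> h < d2 \<Longrightarrow> v * Re (g (0 - h)) < v * Re (g 0)"
    using DERIV_pos_inc_left[OF D vv] by auto
  define \<eta> where "\<eta> = min (1/4) (min (d1/2) (d2/2))"
  have \<eta>: "0 < \<eta>" "\<eta> < d1" "\<eta> < d2" "\<eta> \<le> 1/4" using d1(1) d2(1) by (auto simp: \<eta>_def)
  have near0: "v * Re (g t - g 0) > 0" if "0 < t" "t \<le> \<eta>" for t
    using d1(2)[of t] that \<eta> by (simp add: algebra_simps)
  have near1: "v * Re (g t - g 0) < 0" if "1 - \<eta> \<le> t" "t < 1" for t
    using d2(2)[of "1 - t"] that \<eta> per[of "t - 1"] by (simp add: algebra_simps)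
  \<comment> \<open>Away from the base parameter the curve keeps a positive distance
    \<open>d\<close> from the lowest point, by injectivity and compactness; lifting the point by
    less than \<open>d\<close> keeps it below every such crossing of the vertical line.\<close>
  obtain d where d: "d > 0" "\<And>t. t \<in> {\<eta>..1-\<eta>} \<Longrightarrow> d \<le> norm (g t - g 0)"
  proof -
    have "continuous_on {\<eta>..1-\<eta>} (\<lambda>t. norm (g t - g 0))"
      by (intro continuous_intros continuous_on_subset[OF cont]) auto
    then have "\<exists>x\<in>{\<eta>..1-\<eta>}. \<forall>y\<in>{\<eta>..1-\<eta>}. norm (g x - g 0) \<le> norm (g y - g 0)"
      using \<eta> by (intro continuous_attains_inf) auto
    then obtain t0 where t0: "t0 \<in> {\<eta>..1-\<eta>}"
        "\<And>t. t \<in> {\<eta>..1-\<eta>} \<Longrightarrow> norm (g t0 - g 0) \<le> norm (g t - g 0)"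
      by blast
    have "g t0 \<noteq> g 0" using inj_onD[OF inj, of t0 0] t0(1) \<eta> by auto
    then show ?thesis using that[of "norm (g t0 - g 0)"] t0 by auto
  qed
  define \<delta> where "\<delta> = d / 2"
  have \<delta>: "0 < \<delta>" "\<delta> < d" using d by (auto simp: \<delta>_def)
  define z where "z = g 0 + of_real \<delta> * \<i>"
  define K where "K = (\<lambda>t. g t - z)"
  have K0: "K 0 = - (of_real \<delta> * \<i>)" and K1: "K 1 = K 0"
    by (simp_all add: K_def z_def path_loop)
  have ReK: "Re (K t) = Re (g t - g 0)" and ImK: "Im (K t) = Im (g t - g 0) - \<delta>" for t
    by (simp_all add: K_def z_def)
  have contK: "continuous_on S K" for S
    unfolding K_def by (intro continuous_intros continuous_on_subset[OF cont]) auto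
  \<comment> \<open>The middle part avoids the downward ray from \<open>z\<close>: a point of it
    straight above g 0 is at least \<open>d\<close> > \<delta> higher.\<close>
  have mid: "- (\<i> * K t) \<notin> \<real>\<^sub>\<le>\<^sub>0" if t: "t \<in> {\<eta>..1-\<eta>}" for t
  proof (rule in_open_half_plane_not_nonpos_Reals)
    show "0 < Re (- (\<i> * K t)) \<or> Im (- (\<i> * K t)) \<noteq> 0"
    proof (cases "Re (g t - g 0) = 0")
      case True
      then have "norm (g t - g 0) = \<bar>Im (g t - g 0)\<bar>" by (simp add: cmod_def)
      then show ?thesis using d(2)[OF t] low[of t] \<delta> by (simp add: ImK)
    qed (simp add: ReK)
  qed
  have start: "\<i> * K t \<notin> \<real>\<^sub>\<le>\<^sub>0" if t: "t \<in> {0..\<eta>}" for t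
    using t near0[of t] K0 \<delta> ReK[of t]
    by (cases "t = 0"; intro in_open_half_plane_not_nonpos_Reals) auto
  have stop: "\<i> * K t \<notin> \<real>\<^sub>\<le>\<^sub>0" if t: "t \<in> {1-\<eta>..1}" for t
    using t near1[of t] K0 K1 \<delta> ReK[of t]
    by (cases "t = 1"; intro in_open_half_plane_not_nonpos_Reals) auto
  have Knz: "K t \<noteq> 0" if "t \<in> {0..1}" for t
  proof
    assume "K t = 0"
    then have "\<i> * K t \<in> \<real>\<^sub>\<le>\<^sub>0" "- (\<i> * K t) \<in> \<real>\<^sub>\<le>\<^sub>0" by simp_all
    moreover have "t \<in> {0..\<eta>} \<or> t \<in> {\<eta>..1-\<eta>} \<or> t \<in> {1-\<eta>..1}" using that by auto
    ultimately show False using mid start stop by blast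
  qed
  have z: "z \<notin> path_image g"
  proof
    assume "z \<in> path_image g"
    then obtain t where "t \<in> {0..1}" "z = g t" by (auto simp: path_image_def)
    then show False using Knz[of t] by (simp add: K_def)
  qed
  obtain q where q: "path q" "pathfinish q - pathstart q = 2 * of_real pi * \<i> * winding_number g z"
       "\<And>t. t \<in> {0..1} \<Longrightarrow> g t = z + exp (q t)"
    using winding_number_as_continuous_log[OF path_loop(1) z, where thesis = thesis] by blast
  have expq: "exp (q t) = K t" if "t \<in> {0..1}" for t
    using q(3)[OF that] by (simp add: K_def)
  have contq: "continuous_on S q" if "S \<subseteq> {0..1}" for S
    using q(1) that by (auto simp: path_def intro: continuous_on_subset)
  have 1: "q \<eta> - q 0 = Ln (\<i> * K \<eta>) - Ln (\<i> * K 0)"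
  proof (rule log_increment_unique[where c = "-\<i>"])
    show "continuous_on {0..\<eta>} (\<lambda>t. Ln (\<i> * K t))"
      by (intro continuous_intros contK start)
    show "exp (q t) = - \<i> * exp (Ln (\<i> * K t))" if "t \<in> {0..\<eta>}" for t
      using expq[of t] Knz[of t] that \<eta> by simp
  qed (use \<eta> contq in auto)
  have 2: "q 1 - q (1-\<eta>) = Ln (\<i> * K 1) - Ln (\<i> * K (1-\<eta>))"
  proof (rule log_increment_unique[where c = "-\<i>"])
    show "continuous_on {1-\<eta>..1} (\<lambda>t. Ln (\<i> * K t))"
      by (intro continuous_intros contK stop)
    show "exp (q t) = - \<i> * exp (Ln (\<i> * K t))" if "t \<in> {1-\<eta>..1}" for t
      using expq[of t] Knz[of t] that \<eta> by simp
  qed (use \<eta> contq in auto)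
  have 3: "q (1-\<eta>) - q \<eta> = Ln (- (\<i> * K (1-\<eta>))) - Ln (- (\<i> * K \<eta>))"
  proof (rule log_increment_unique[where c = "\<i>"])
    show "continuous_on {\<eta>..1-\<eta>} (\<lambda>t. Ln (- (\<i> * K t)))"
      by (intro continuous_intros contK mid)
    show "exp (q t) = \<i> * exp (Ln (- (\<i> * K t)))" if "t \<in> {\<eta>..1-\<eta>}" for t
      using expq[of t] Knz[of t] that \<eta> by simp
  qed (use \<eta> contq in auto)
  have 4: "Ln (\<i> * K \<eta>) - Ln (- (\<i> * K \<eta>)) = of_real (pi * sgn v) * \<i>"
  proof -
    have "v * Re (K \<eta>) > 0" using near0[of \<eta>] \<eta> by (simp add: ReK)
    then have "sgn (Re (K \<eta>)) = sgn v" "Re (K \<eta>) \<noteq> 0" by (auto simp: zero_less_mult_iff sgn_if)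
    then show ?thesis using Ln_quarter_turns[of "K \<eta>"] by simp
  qed
  have 5: "Ln (\<i> * K (1-\<eta>)) - Ln (- (\<i> * K (1-\<eta>))) = - of_real (pi * sgn v) * \<i>"
  proof -
    have "v * Re (K (1-\<eta>)) < 0" using near1[of "1-\<eta>"] \<eta> by (simp add: ReK)
    then have "sgn (Re (K (1-\<eta>))) = - sgn v" "Re (K (1-\<eta>)) \<noteq> 0" by (auto simp: mult_less_0_iff sgn_if)
    then show ?thesis using Ln_quarter_turns[of "K (1-\<eta>)"] by simp
  qed
  \<comment> \<open>The logarithms at K 0 = K 1 cancel. What is left at \<eta> and at 1 - \<eta> is
    the jump between the two rotated logarithms, a half turn of sign sgn v each time.\<close>
  have "q 1 - q 0 = (q \<eta> - q 0) + (q (1-\<eta>) - q \<eta>) + (q 1 - q (1-\<eta>))" by simp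
  also have "\<dots> = (Ln (\<i> * K \<eta>) - Ln (- (\<i> * K \<eta>)))
      - (Ln (\<i> * K (1-\<eta>)) - Ln (- (\<i> * K (1-\<eta>))))"
    unfolding 1 2 3 K1 by simp
  also have "\<dots> = 2 * of_real pi * \<i> * of_real (sgn v)"
    unfolding 4 5 by (simp add: algebra_simps)
  finally have "q 1 - q 0 = 2 * of_real pi * \<i> * of_real (sgn v)" .
  with q(2) have "winding_number g z = of_real (sgn v)"
    by (simp add: pathfinish_def pathstart_def)
  with z that show ?thesis by (simp add: v_def)
qed

lemma shift: "regular_loop (\<lambda>t. g (t + a)) (\<lambda>t. g' (t + a))"
proof
  fix t
  have "((g \<circ> (\<lambda>x. x + a)) has_vector_derivative 1 *\<^sub>R g' (t + a)) (at t)"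
    by (rule vector_diff_chain_at) (auto intro!: derivative_eq_intros deriv)
  then show "((\<lambda>t. g (t + a)) has_vector_derivative g' (t + a)) (at t)"
    by (simp add: o_def)
  show "g (t + 1 + a) = g (t + a)" using per[of "t + a"] by (simp add: algebra_simps)
next
  show "inj_on (\<lambda>t. g (t + a)) {0..<1}"
  proof (rule inj_onI)
    fix s t :: real assume st: "s \<in> {0..<1}" "t \<in> {0..<1}" "g (s + a) = g (t + a)"
    then obtain n :: int where n: "s = t + of_int n" using eq_iff by auto
    with st have "n < 1" "-1 < n" by auto
    with n show "s = t" by simp
  qed
qed (auto simp: nz intro!: continuous_intros continuous_on_compose2[OF cont'])

text \<open>After the base point is moved to a lowest point, both winding numbers equal the sign of
  the horizontal velocity there. That \<open>z\<close> lies inside is a consequence: its winding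
  number is nonzero, whereas it vanishes on the outside.\<close>

lemma umlaufsatz:
  obtains z where "z \<in> inside (path_image g)" "winding_number g z = winding_number g' 0"
proof -
  obtain a where a: "a \<in> {0..1}" "\<And>t. t \<in> {0..1} \<Longrightarrow> Im (g a) \<le> Im (g t)"
  proof -
    have "continuous_on {0..1} (\<lambda>t. Im (g t))"
      by (intro continuous_intros continuous_on_subset[OF cont]) auto
    then have "\<exists>x\<in>{0..1}. \<forall>y\<in>{0..1}. Im (g x) \<le> Im (g y)"
      by (intro continuous_attains_inf) auto
    then show ?thesis using that by blast
  qed
  have low: "Im (g a) \<le> Im (g t)" for t
  proof -
    have "g t \<in> path_image g" by (simp add: path_image_eq_range)
    then show ?thesis using a by (auto simp: path_image_def)
  qed
  interpret sh: regular_loop "\<lambda>t. g (t + a)" "\<lambda>t. g' (t + a)" by (rule shift)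
  \<comment> \<open>\<open>shiftpath\<close> wraps around at the end of the parameter interval; for
    a periodic function this is plain translation.\<close>
  have shiftpath: "shiftpath a g = (\<lambda>t. g (t + a))" "shiftpath a g' = (\<lambda>t. g' (t + a))"
    using per[of "_ + a - 1"] per'[of "_ + a - 1"] by (auto simp: shiftpath_def fun_eq_iff algebra_simps)
  have image: "path_image (\<lambda>t. g (t + a)) = path_image g"
    unfolding shiftpath(1)[symmetric]
    by (rule path_image_shiftpath) (use a path_loop in \<open>auto simp: pathfinish_def pathstart_def\<close>)
  obtain z where z: "z \<notin> path_image (\<lambda>t. g (t + a))"
      "winding_number (\<lambda>t. g (t + a)) z = of_real (sgn (Re (g' (0 + a))))"
    using sh.winding_near_lowest low by auto
  have "winding_number (\<lambda>t. g' (t + a)) 0 = of_real (sgn (Re (g' (0 + a))))"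
    using sh.rotation_from_lowest low by auto
  moreover have "winding_number (\<lambda>t. g' (t + a)) 0 = winding_number g' 0"
  proof -
    have "0 \<notin> path_image g'" using nz by (force simp: path_image_def)
    then show ?thesis
      using winding_number_shiftpath[of g' 0 a] a path_loop
      by (simp add: shiftpath pathfinish_def pathstart_def)
  qed
  moreover have "winding_number (\<lambda>t. g (t + a)) z = winding_number g z"
    using winding_number_shiftpath[of g z a] a path_loop z(1)
    by (auto simp: shiftpath image pathfinish_def pathstart_def)
  ultimately have eq: "winding_number g z = winding_number g' 0" using z by simp
  have "winding_number g z \<noteq> 0"
  proof -
    have "Re (g' (0 + a)) \<noteq> 0"
      using nz[of a] sh.Im_velocity_at_lowest low by (auto simp: complex_eq_iff)
    then show ?thesis using z(2) \<open>winding_number (\<lambda>t. g (t + a)) z = winding_number g z\<close>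
      by (simp add: sgn_if)
  qed
  then have "z \<notin> outside (path_image g)"
    using winding_number_zero_in_outside[of g z] path_loop by (auto simp: pathfinish_def pathstart_def)
  then have "z \<in> inside (path_image g)"
    using z(1) by (simp add: image inside_outside)
  with eq that show ?thesis by blast
qed

end

section \<open>Identification of the real plane with the complex numbers\<close>

definition to_complex :: "real \<times> real \<Rightarrow> complex" where
  "to_complex w = Complex (fst w) (snd w)"

lemma to_complex_eq: "to_complex w = of_real (fst w) + \<i> * of_real (snd w)"
  by (simp add: to_complex_def Complex_eq)

lemma to_complex_simps [simp]:
  "Re (to_complex w) = fst w" "Im (to_complex w) = snd w"
  "to_complex (v - w) = to_complex v - to_complex w" "to_complex 0 = 0"
  "to_complex v = to_complex w \<longleftrightarrow> v = w" "to_complex w = 0 \<longleftrightarrow> w = 0"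
  by (auto simp: to_complex_def complex_eq_iff prod_eq_iff)

lemma norm_to_complex [simp]: "norm (to_complex w) = norm w"
  by (simp add: to_complex_def complex_norm norm_prod_def)

lemma continuous_on_to_complex [continuous_intros]:
  "continuous_on S f \<Longrightarrow> continuous_on S (\<lambda>x. to_complex (f x))"
  unfolding to_complex_eq by (intro continuous_intros)

lemma measurable_to_complex [measurable]: "to_complex \<in> borel_measurable borel"
  by (intro borel_measurable_continuous_onI continuous_intros)

subsection \<open>Partial derivatives in the plane\<close>

text \<open>This is the total derivative with its two components named: the product and quotient
  rules come from \<open>has_derivative\<close>, and restriction to horizontal and vertical lines
  gives the partial derivatives.\<close>

definition has_partials ::
    "(real \<times> real \<Rightarrow> complex) \<Rightarrow> complex \<Rightarrow> complex \<Rightarrow> real \<times> real \<Rightarrow> bool" where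
  "has_partials A ax ay w \<longleftrightarrow>
     (A has_derivative (\<lambda>h. of_real (fst h) * ax + of_real (snd h) * ay)) (at w)"

lemma has_partials_const: "has_partials (\<lambda>_. c) 0 0 w"
  by (simp add: has_partials_def)

lemma has_partials_fst: "has_partials (\<lambda>w. of_real (fst w)) 1 0 w"
  by (auto simp: has_partials_def intro!: derivative_eq_intros)

lemma has_partials_snd: "has_partials (\<lambda>w. of_real (snd w)) 0 1 w"
  by (auto simp: has_partials_def intro!: derivative_eq_intros)

lemma has_partials_add:
  "has_partials A ax ay w \<Longrightarrow> has_partials B bx by w \<Longrightarrow> has_partials (\<lambda>w. A w + B w) (ax + bx) (ay + by) w"
  unfolding has_partials_def
  by (erule (1) derivative_eq_intros) (auto simp: algebra_simps)

lemma has_partials_mult: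
  "has_partials A ax ay w \<Longrightarrow> has_partials B bx by w \<Longrightarrow>
   has_partials (\<lambda>w. A w * B w) (ax * B w + A w * bx) (ay * B w + A w * by) w"
  unfolding has_partials_def
  by (erule (1) derivative_eq_intros) (auto simp: algebra_simps)

lemma has_partials_diff:
  "has_partials A ax ay w \<Longrightarrow> has_partials B bx by w \<Longrightarrow> has_partials (\<lambda>w. A w - B w) (ax - bx) (ay - by) w"
  unfolding has_partials_def
  by (erule (1) derivative_eq_intros) (auto simp: algebra_simps)

lemma has_partials_inverse:
  "has_partials A ax ay w \<Longrightarrow> A w \<noteq> 0 \<Longrightarrow>
   has_partials (\<lambda>w. inverse (A w)) (- (ax * (inverse (A w))\<^sup>2)) (- (ay * (inverse (A w))\<^sup>2)) w"
  unfolding has_partials_def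
  by (erule (1) derivative_eq_intros) (auto simp: algebra_simps power2_eq_square)

lemma has_partials_x:
  assumes "has_partials A ax ay (x, y)"
  shows "((\<lambda>x. A (x, y)) has_vector_derivative ax) (at x)"
proof -
  have "(A has_derivative (\<lambda>h. of_real (fst h) * ax + of_real (snd h) * ay)) (at (x, y))"
    using assms by (simp add: has_partials_def)
  then have "((\<lambda>x. A (x, y)) has_derivative (\<lambda>t. of_real (fst (t, 0::real)) * ax + of_real (snd (t, 0::real)) * ay)) (at x)"
    by (rule has_derivative_compose[rotated]) (auto intro!: derivative_eq_intros)
  then show ?thesis by (simp add: has_vector_derivative_def scaleR_conv_of_real)
qed

lemma has_partials_y:
  assumes "has_partials A ax ay (x, y)"
  shows "((\<lambda>y. A (x, y)) has_vector_derivative ay) (at y)"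
proof -
  have "(A has_derivative (\<lambda>h. of_real (fst h) * ax + of_real (snd h) * ay)) (at (x, y))"
    using assms by (simp add: has_partials_def)
  then have "((\<lambda>y. A (x, y)) has_derivative (\<lambda>t. of_real (fst (0::real, t)) * ax + of_real (snd (0::real, t)) * ay)) (at y)"
    by (rule has_derivative_compose[rotated]) (auto intro!: derivative_eq_intros)
  then show ?thesis by (simp add: has_vector_derivative_def scaleR_conv_of_real)
qed

lemma has_partials_isCont: "has_partials A ax ay w \<Longrightarrow> isCont A w"
  unfolding has_partials_def by (rule has_derivative_continuous)

lemma has_partials_transform:
  assumes "has_partials A ax ay w" "open S" "w \<in> S" "\<And>v. v \<in> S \<Longrightarrow> A v = B v"
  shows "has_partials B ax ay w"
  using assms unfolding has_partials_def by (rule has_derivative_transform_within_open)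

lemma has_partials_unique:
  assumes "has_partials A ax ay w" "has_partials A bx by w"
  shows "ax = bx" "ay = by"
  using has_partials_x[of A _ _ "fst w" "snd w"] has_partials_y[of A _ _ "fst w" "snd w"] assms
    vector_derivative_unique_at by (metis prod.collapse)+

subsection \<open>Lebesgue integrals over the plane\<close>

text \<open>The Jacobian of scaling by \<open>c\<close> in dimension two is the square of
  \<open>c\<close>. The lemma rescales the smoothing kernel around a point to unit width.\<close>

lemma integral_lborel_plane_affine:
  fixes f :: "real \<times> real \<Rightarrow> complex"
  assumes f: "f \<in> borel_measurable borel" and c: "c \<noteq> 0"
  shows "(\<integral>w. f w \<partial>lborel) = (\<integral>u. of_real (c\<^sup>2) * f (t + c *\<^sub>R u) \<partial>lborel)"
proof -
  have "(\<integral>w. f w \<partial>lborel)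
      = (\<integral>w. f w \<partial>density (distr lborel borel (\<lambda>x. t + c *\<^sub>R x)) (\<lambda>_. ennreal (c\<^sup>2)))"
  proof (rule arg_cong[where f = "\<lambda>M. integral\<^sup>L M f"])
    show "(lborel :: (real\<times>real) measure)
        = density (distr lborel borel (\<lambda>x. t + c *\<^sub>R x)) (\<lambda>_. ennreal (c\<^sup>2))"
      using lborel_affine[OF c, of t] by (simp only: DIM_prod DIM_real one_add_one power2_abs)
  qed
  also have "\<dots> = (\<integral>w. c\<^sup>2 *\<^sub>R f w \<partial>distr lborel borel (\<lambda>x. t + c *\<^sub>R x))"
    using f by (subst integral_density) auto
  also have "\<dots> = (\<integral>u. c\<^sup>2 *\<^sub>R f (t + c *\<^sub>R u) \<partial>lborel)"
    using f by (subst integral_distr) auto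
  finally show ?thesis by (simp add: scaleR_conv_of_real)
qed

lemma integrable_abs_powr_neg_half:
  "integrable lborel (\<lambda>x::real. indicator {-1..1} x * \<bar>x\<bar> powr (-1/2))"
proof -
  have "((\<lambda>x::real. x powr (-1/2)) has_integral 1 powr (-1/2 + 1) / (-1/2 + 1)) {0..1}"
    by (rule has_integral_powr_from_0) auto
  then have "(\<lambda>x::real. x powr (-1/2)) absolutely_integrable_on {0..1}"
    by (intro nonnegative_absolutely_integrable_1) (auto simp: integrable_on_def)
  then have int: "integrable lborel (\<lambda>x::real. indicator {0..1} x * x powr (-1/2))"
    by (simp add: set_integrable_def integrable_completion)
  from lborel_integrable_real_affine[OF this, of "-1" 0]
  have "integrable lborel (\<lambda>x::real. indicator {0..1} (-x) * (-x) powr (-1/2))" by simp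
  with int have "integrable lborel (\<lambda>x::real. indicator {0..1} x * x powr (-1/2)
      + indicator {0..1} (-x) * (-x) powr (-1/2))"
    by (rule Bochner_Integration.integrable_add)
  then show ?thesis
    by (rule Bochner_Integration.integrable_cong[THEN iffD1, rotated -1])
      (auto simp: indicator_def)
qed

lemma integrable_product_plane:
  fixes f g :: "real \<Rightarrow> real"
  assumes f: "integrable lborel f" and g: "integrable lborel g"
  shows "integrable lborel (\<lambda>w::real\<times>real. f (fst w) * g (snd w))"
proof -
  have "integrable (lborel \<Otimes>\<^sub>M lborel) (\<lambda>w::real\<times>real. f (fst w) * g (snd w))"
  proof (rule lborel_pair.Fubini_integrable)
    have "integrable lborel (\<lambda>x. \<bar>f x\<bar> * (\<integral>y. \<bar>g y\<bar> \<partial>lborel))"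
      using f by (intro integrable_mult_left integrable_abs)
    then show "integrable lborel (\<lambda>x. \<integral>y. norm (f (fst (x, y)) * g (snd (x, y))) \<partial>lborel)"
      by (simp add: abs_mult)
  qed (use f g in \<open>auto intro!: borel_measurable_times\<close>)
  then show ?thesis by (simp add: lborel_prod)
qed

lemma AE_plane_coordinates_nonzero: "AE w in (lborel :: (real\<times>real) measure). fst w \<noteq> 0 \<and> snd w \<noteq> 0"
proof -
  have "emeasure (lborel \<Otimes>\<^sub>M lborel) ({0::real} \<times> (UNIV::real set)) = 0"
    by (subst lborel.emeasure_pair_measure_Times) auto
  moreover have "emeasure (lborel \<Otimes>\<^sub>M lborel) ((UNIV::real set) \<times> {0::real}) = 0"
    by (subst lborel.emeasure_pair_measure_Times) auto
  ultimately have "AE w in lborel. w \<notin> {0::real} \<times> (UNIV::real set)" "AE w in lborel. w \<notin> (UNIV::real set) \<times> {0::real}"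
    by (auto intro!: AE_not_in null_setsI simp: lborel_prod borel_Times)
  then show ?thesis by eventually_elim auto
qed

text \<open>Since \<open>\<bar>w\<bar>\<^sup>2 \<ge> \<bar>x\<bar> \<bar>y\<bar>\<close>, the kernel is dominated by a product of one-dimensional
  integrable singularities; this avoids polar coordinates.\<close>

lemma integrable_inverse_norm_unit_box:
  "integrable lborel (\<lambda>w::real\<times>real. indicator ({-1..1} \<times> {-1..1}) w / norm w)"
proof (rule Bochner_Integration.integrable_bound)
  let ?g = "\<lambda>x::real. indicator {-1..1} x * \<bar>x\<bar> powr (-1/2)"
  show "integrable lborel (\<lambda>w::real\<times>real. ?g (fst w) * ?g (snd w))"
    by (intro integrable_product_plane integrable_abs_powr_neg_half)
  show "AE w in lborel. norm (indicator ({-1..1} \<times> {-1..1}) w / norm w) \<le> norm (?g (fst w) * ?g (snd w))"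
    using AE_plane_coordinates_nonzero
  proof eventually_elim
    case (elim w)
    have "(sqrt \<bar>fst w\<bar> * sqrt \<bar>snd w\<bar>) \<le> norm w"
    proof -
      have "\<bar>fst w\<bar> * \<bar>snd w\<bar> \<le> (fst w)\<^sup>2 + (snd w)\<^sup>2"
        using sum_squares_bound[of "\<bar>fst w\<bar>" "\<bar>snd w\<bar>"]
          mult_nonneg_nonneg[OF abs_ge_zero[of "fst w"] abs_ge_zero[of "snd w"]]
        unfolding power2_abs by linarith
      then show ?thesis by (simp add: norm_prod_def real_sqrt_mult[symmetric] real_sqrt_le_iff)
    qed
    moreover have "0 < sqrt \<bar>fst w\<bar> * sqrt \<bar>snd w\<bar>" using elim by simp
    ultimately have "inverse (norm w) \<le> inverse (sqrt \<bar>fst w\<bar> * sqrt \<bar>snd w\<bar>)"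
      by (rule le_imp_inverse_le)
    then have "1 / norm w \<le> 1 / (sqrt \<bar>fst w\<bar> * sqrt \<bar>snd w\<bar>)"
      by (simp only: inverse_eq_divide)
    also have "\<dots> = \<bar>fst w\<bar> powr (-1/2) * \<bar>snd w\<bar> powr (-1/2)"
      using elim by (simp add: powr_minus powr_half_sqrt field_simps)
    finally show ?case by (auto simp: indicator_def abs_mult)
  qed
qed (auto intro!: borel_measurable_divide borel_measurable_indicator borel_Times)

text \<open>In the unit box around \<open>q\<close> the translated singularity dominates, and
  elsewhere the distance is at least 1. The bound on the integral is independent of
  \<open>q\<close>; this uniformity is what later permits \<open>q\<close> to run along the
  curve.\<close>

lemma integrable_inverse_dist:
  fixes K :: "(real\<times>real) set"
  assumes K: "compact K"
  shows "integrable lborel (\<lambda>w. indicator K w / norm (w - q))"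
    and "(\<integral>w. indicator K w / norm (w - q) \<partial>lborel)
       \<le> measure lborel K + (\<integral>w. indicator ({-1..1} \<times> {-1..1}) w / norm w \<partial>(lborel :: (real\<times>real) measure))"
proof -
  let ?J = "\<lambda>w::real\<times>real. indicator ({-1..1} \<times> {-1..1}) w / norm w"
  have Jm [measurable]: "?J \<in> borel_measurable borel"
    using borel_measurable_integrable[OF integrable_inverse_norm_unit_box] by simp
  have J: "integrable lborel (\<lambda>w. ?J (w - q))"
    "(\<integral>w. ?J (w - q) \<partial>lborel) = (\<integral>w. ?J w \<partial>lborel)"
  proof -
    have eq: "(lborel :: (real\<times>real) measure) = distr lborel borel ((+) (-q))"
      by (simp add: lborel_distr_plus)
    have 1: "integrable (distr lborel borel ((+) (-q))) ?J"
      using integrable_inverse_norm_unit_box eq by simp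
    then show "integrable lborel (\<lambda>w. ?J (w - q))"
      by (subst (asm) integrable_distr_eq) (auto simp: algebra_simps)
    have "(\<integral>w. ?J w \<partial>lborel) = (\<integral>w. ?J w \<partial>distr lborel borel ((+) (-q)))"
      using eq by simp
    also have "\<dots> = (\<integral>w. ?J (w - q) \<partial>lborel)"
      by (subst integral_distr) (auto simp: algebra_simps)
    finally show "(\<integral>w. ?J (w - q) \<partial>lborel) = (\<integral>w. ?J w \<partial>lborel)" by simp
  qed
  have Kf: "integrable lborel (indicator K :: _ \<Rightarrow> real)"
    using K emeasure_compact_finite[OF K] by (simp add: integrable_indicator_iff borel_compact less_top)
  have bd: "indicator K w / norm (w - q) \<le> indicator K w + ?J (w - q)" for w
  proof (cases "w - q \<in> {-1..1} \<times> {-1..1}")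
    case False
    then have "1 < \<bar>fst (w - q)\<bar> \<or> 1 < \<bar>snd (w - q)\<bar>" by (cases "w - q") auto
    moreover have "\<bar>fst (w - q)\<bar> \<le> norm (w - q)" "\<bar>snd (w - q)\<bar> \<le> norm (w - q)"
      by (metis norm_fst_le norm_snd_le prod.collapse real_norm_def)+
    ultimately have "1 \<le> norm (w - q)" by linarith
    then have "1 / norm (w - q) \<le> 1" by (simp add: divide_le_eq_1)
    then show ?thesis by (auto simp: indicator_def)
  qed (auto simp: indicator_def)
  have int2: "integrable lborel (\<lambda>w. indicator K w + ?J (w - q))"
    using Kf J by simp
  show int: "integrable lborel (\<lambda>w. indicator K w / norm (w - q))"
  proof (rule Bochner_Integration.integrable_bound[OF int2])
    show "AE w in lborel. norm (indicator K w / norm (w - q)) \<le> norm (indicator K w + ?J (w - q))"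
      using bd by (intro AE_I2) (auto simp: abs_of_nonneg)
  qed (use K borel_compact in measurable)
  have "(\<integral>w. indicator K w / norm (w - q) \<partial>lborel) \<le> (\<integral>w. indicator K w + ?J (w - q) \<partial>lborel)"
    by (intro integral_mono int int2 bd)
  also have "\<dots> = measure lborel K + (\<integral>w. ?J w \<partial>lborel)"
    using Kf J by simp
  finally show "(\<integral>w. indicator K w / norm (w - q) \<partial>lborel) \<le> measure lborel K + (\<integral>w. ?J w \<partial>lborel)" .
qed

section \<open>Total mass of the smoothing kernel\<close>

lemma integral_real_line_FTC:
  fixes f F :: "real \<Rightarrow> real"
  assumes F: "\<And>x. (F has_real_derivative f x) (at x)" and f: "\<And>x. isCont f x" "\<And>x. 0 \<le> f x"
    and A: "(F \<longlongrightarrow> A) at_bot" and B: "(F \<longlongrightarrow> B) at_top"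
  shows "integrable lborel f" "(\<integral>x. f x \<partial>lborel) = B - A"
proof -
  have "((F \<circ> real_of_ereal) \<longlongrightarrow> A) (at_right (-\<infinity>))" "((F \<circ> real_of_ereal) \<longlongrightarrow> B) (at_left \<infinity>)"
    using A B by (simp_all add: ereal_tendsto_simps)
  then have "set_integrable lborel (einterval (-\<infinity>) \<infinity>) f" "(LBINT x=-\<infinity>..\<infinity>. f x) = B - A"
    using interval_integral_FTC_nonneg[of "-\<infinity>" \<infinity> F f A B] F f by auto
  then show "integrable lborel f" "(\<integral>x. f x \<partial>lborel) = B - A"
    by (simp_all add: set_integrable_def interval_lebesgue_integral_def set_lebesgue_integral_def)
qed

lemma integral_cauchy_square:
  fixes a :: real assumes a: "a > 0"
  shows "integrable lborel (\<lambda>y. 1 / (a\<^sup>2 + y\<^sup>2)\<^sup>2)"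
    "(\<integral>y. 1 / (a\<^sup>2 + y\<^sup>2)\<^sup>2 \<partial>lborel) = pi / (2 * a ^ 3)"
proof -
  \<comment> \<open>The antiderivative given by the usual reduction formula for powers of a sum of
    squares; only its arctan term contributes at infinity.\<close>
  define F where "F = (\<lambda>y. 1 / (2 * a\<^sup>2) * (y / (a\<^sup>2 + y\<^sup>2)) + 1 / (2 * a ^ 3) * arctan (y / a))"
  have pos: "0 < a\<^sup>2 + y\<^sup>2" for y using a by (simp add: add_pos_nonneg)
  have D: "(F has_real_derivative 1 / (a\<^sup>2 + y\<^sup>2)\<^sup>2) (at y)" for y
  proof -
    have *: "1 + (y / a)\<^sup>2 = (a\<^sup>2 + y\<^sup>2) / a\<^sup>2" using a by (simp add: field_simps)
    define d where "d = a\<^sup>2 + y\<^sup>2"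
    have "0 < d" using pos[of y] unfolding d_def .
    then have d: "d \<noteq> 0" "y\<^sup>2 = d - a\<^sup>2" by simp (simp add: d_def)
    have "((\<lambda>y. y / (a\<^sup>2 + y\<^sup>2)) has_real_derivative (d - y * (2 * y)) / (d * d)) (at y)"
      unfolding d_def using pos[of y] a by (auto intro!: derivative_eq_intros)
    moreover have "((\<lambda>y. arctan (y / a)) has_real_derivative inverse (d / a\<^sup>2) * (1 / a)) (at y)"
      unfolding d_def *[symmetric] using a by (auto intro!: derivative_eq_intros)
    ultimately have "(F has_real_derivative 1 / (2 * a\<^sup>2) * ((d - y * (2 * y)) / (d * d))
         + 1 / (2 * a ^ 3) * (inverse (d / a\<^sup>2) * (1 / a))) (at y)"
      unfolding F_def by (intro DERIV_add DERIV_cmult)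
    also have "1 / (2 * a\<^sup>2) * ((d - y * (2 * y)) / (d * d)) + 1 / (2 * a ^ 3) * (inverse (d / a\<^sup>2) * (1 / a)) = 1 / d\<^sup>2"
    proof -
      have "d - y * (2 * y) = 2 * a\<^sup>2 - d" using d(2) by (simp add: power2_eq_square)
      show ?thesis unfolding \<open>d - y * (2 * y) = 2 * a\<^sup>2 - d\<close>
        using a d(1) by (simp add: field_simps power2_eq_square power3_eq_cube)
    qed
    finally show ?thesis by (simp add: d_def)
  qed
  have lim0: "((\<lambda>y. y / (a\<^sup>2 + y\<^sup>2)) \<longlongrightarrow> 0) G" if "((\<lambda>y. inverse y) \<longlongrightarrow> 0) G" for G
  proof (rule Lim_null_comparison[OF _ tendsto_norm_zero[OF that]])
    show "\<forall>\<^sub>F y in G. norm (y / (a\<^sup>2 + y\<^sup>2)) \<le> norm (inverse y)"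
    proof (rule always_eventually, rule allI)
      fix y
      show "norm (y / (a\<^sup>2 + y\<^sup>2)) \<le> norm (inverse y)"
      proof (cases "y = 0")
        case False
        have "\<bar>y\<bar> * \<bar>y\<bar> \<le> a\<^sup>2 + y\<^sup>2" by (simp add: power2_eq_square flip: abs_mult)
        then show ?thesis using False pos[of y] by (simp add: field_simps abs_divide)
      qed simp
    qed
  qed
  have top: "filterlim (\<lambda>y. y / a) at_top at_top" "filterlim (\<lambda>y. y / a) at_bot at_bot"
    using a filterlim_tendsto_pos_mult_at_top[OF tendsto_const[of "inverse a"] _ filterlim_ident[of at_top]]
     filterlim_tendsto_pos_mult_at_bot[OF tendsto_const[of "inverse a"] _ filterlim_ident[of at_bot]]
    by (simp_all add: field_simps)
  have lims: "(F \<longlongrightarrow> 1 / (2 * a\<^sup>2) * 0 + 1 / (2 * a ^ 3) * (pi/2)) at_top"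
    "(F \<longlongrightarrow> 1 / (2 * a\<^sup>2) * 0 + 1 / (2 * a ^ 3) * (-(pi/2))) at_bot"
    unfolding F_def
    by (intro tendsto_add tendsto_mult tendsto_const lim0
        tendsto_mono[OF at_top_le_at_infinity tendsto_inverse_0]
        tendsto_mono[OF at_bot_le_at_infinity tendsto_inverse_0]
        filterlim_compose[OF tendsto_arctan_at_top top(1)]
        filterlim_compose[OF tendsto_arctan_at_bot top(2)])+
  have cont: "isCont (\<lambda>y. 1 / (a\<^sup>2 + y\<^sup>2)\<^sup>2) y" for y
    using a by (intro continuous_intros) auto
  show "integrable lborel (\<lambda>y. 1 / (a\<^sup>2 + y\<^sup>2)\<^sup>2)"
    using integral_real_line_FTC(1)[OF D cont _ lims(2,1)] by simp
  show "(\<integral>y. 1 / (a\<^sup>2 + y\<^sup>2)\<^sup>2 \<partial>lborel) = pi / (2 * a ^ 3)"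
    using integral_real_line_FTC(2)[OF D cont _ lims(2,1)] by (simp add: field_simps)
qed

text \<open>The antiderivative is sin (arctan x), that is x / sqrt (1 + x^2), with limits 1 and -1
  at the two ends.\<close>

lemma integral_inverse_cube:
  "integrable lborel (\<lambda>x. 1 / (sqrt (1 + x\<^sup>2)) ^ 3)"
  "(\<integral>x. 1 / (sqrt (1 + x\<^sup>2)) ^ 3 \<partial>lborel) = 2"
proof -
  have pos: "0 < 1 + x\<^sup>2" for x :: real by (simp add: add_pos_nonneg)
  have D: "((\<lambda>x. sin (arctan x)) has_real_derivative 1 / (sqrt (1 + x\<^sup>2)) ^ 3) (at x)" for x
    using pos[of x]
    by (auto intro!: derivative_eq_intros simp: cos_arctan power3_eq_cube field_simps)
  have lims: "((\<lambda>x. sin (arctan x)) \<longlongrightarrow> sin (pi/2)) at_top" "((\<lambda>x. sin (arctan x)) \<longlongrightarrow> sin (-(pi/2))) at_bot"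
    by (intro tendsto_sin tendsto_arctan_at_top tendsto_arctan_at_bot)+
  have cont: "isCont (\<lambda>x. 1 / (sqrt (1 + x\<^sup>2)) ^ 3) x" for x :: real
    using pos[of x] by (intro continuous_intros) auto
  show "integrable lborel (\<lambda>x. 1 / (sqrt (1 + x\<^sup>2)) ^ 3)"
    "(\<integral>x. 1 / (sqrt (1 + x\<^sup>2)) ^ 3 \<partial>lborel) = 2"
    using integral_real_line_FTC[OF D cont _ lims(2,1)] pos by (auto simp: less_imp_le)
qed

text \<open>Iterated integration in Cartesian coordinates: for fixed x the inner integral is the
  preceding one-dimensional one with a = sqrt (1 + x^2), and what remains is pi/2 times the integral
  of a^(-3).\<close>

lemma integral_poisson_kernel:
  "integrable lborel (\<lambda>u::real\<times>real. 1 / (1 + (norm u)\<^sup>2)\<^sup>2)"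
  "(\<integral>u. 1 / (1 + (norm u)\<^sup>2)\<^sup>2 \<partial>(lborel :: (real\<times>real) measure)) = pi"
proof -
  have eq: "1 / (1 + (norm (x, y))\<^sup>2)\<^sup>2 = 1 / ((sqrt (1 + x\<^sup>2))\<^sup>2 + y\<^sup>2)\<^sup>2" for x y :: real
    by (simp add: norm_prod_def algebra_simps)
  have pos: "0 < sqrt (1 + x\<^sup>2)" for x :: real by (simp add: add_pos_nonneg)
  have inner: "(\<integral>y. 1 / (1 + (norm (x, y))\<^sup>2)\<^sup>2 \<partial>(lborel :: real measure)) = pi / 2 * (1 / (sqrt (1 + x\<^sup>2)) ^ 3)" for x :: real
    unfolding eq using integral_cauchy_square(2)[OF pos[of x]] by simp
  have int: "integrable (lborel \<Otimes>\<^sub>M lborel) (\<lambda>u::real\<times>real. 1 / (1 + (norm u)\<^sup>2)\<^sup>2)"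
  proof (rule lborel_pair.Fubini_integrable)
    have "norm (1 / (1 + (norm (x, y))\<^sup>2)\<^sup>2) = 1 / (1 + (norm (x, y))\<^sup>2)\<^sup>2" for x y :: real
      by simp
    then show "integrable lborel (\<lambda>x::real. \<integral>y. norm (1 / (1 + (norm (x, y))\<^sup>2)\<^sup>2) \<partial>(lborel :: real measure))"
      using integrable_mult_right[OF integral_inverse_cube(1), of "pi/2"]
      by (simp only: inner)
    show "AE x::real in lborel. integrable lborel (\<lambda>y::real. 1 / (1 + (norm (x, y))\<^sup>2)\<^sup>2)"
      unfolding eq using integral_cauchy_square(1)[OF pos] by (intro AE_I2)
  qed (simp add: lborel_prod)
  then show "integrable lborel (\<lambda>u::real\<times>real. 1 / (1 + (norm u)\<^sup>2)\<^sup>2)" by (simp add: lborel_prod)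
  have "(\<integral>u. 1 / (1 + (norm u)\<^sup>2)\<^sup>2 \<partial>(lborel :: (real\<times>real) measure))
      = (\<integral>x. \<integral>y. 1 / (1 + (norm (x, y))\<^sup>2)\<^sup>2 \<partial>(lborel :: real measure) \<partial>(lborel :: real measure))"
    using lborel_pair.integral_fst'[OF int] by (simp add: lborel_prod)
  also have "\<dots> = (\<integral>x. pi / 2 * (1 / (sqrt (1 + x\<^sup>2)) ^ 3) \<partial>lborel)"
    by (simp only: inner)
  also have "\<dots> = pi / 2 * 2"
    by (subst integral_mult_right_zero) (simp only: integral_inverse_cube(2))
  finally show "(\<integral>u. 1 / (1 + (norm u)\<^sup>2)\<^sup>2 \<partial>(lborel :: (real\<times>real) measure)) = pi" by simp
qed

subsection \<open>The Cauchy-Pompeiu formula and Green's theorem\<close>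

text \<open>On almost every horizontal line the fundamental theorem applies, and the boundary values
  vanish by compact support. Only the line y = c, which will pass through the singular point, is
  left out, and it is null.\<close>

lemma integral_partial_x_eq_0:
  fixes H Hx :: "real \<times> real \<Rightarrow> complex"
  assumes D: "\<And>x y. y \<noteq> c \<Longrightarrow> ((\<lambda>x. H (x, y)) has_vector_derivative Hx (x, y)) (at x)"
    and R: "\<And>w. R < norm w \<Longrightarrow> H w = 0 \<and> Hx w = 0"
    and int: "integrable lborel Hx"
  shows "(\<integral>w. Hx w \<partial>lborel) = 0"
proof -
  have int': "integrable (lborel \<Otimes>\<^sub>M lborel) (\<lambda>(x, y). Hx (x, y))"
    using int by (simp add: lborel_prod)
  have "(\<integral>w. Hx w \<partial>lborel) = (\<integral>y. \<integral>x. Hx (x, y) \<partial>lborel \<partial>lborel)"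
    using lborel_pair.integral_snd[OF int'] by (simp add: lborel_prod)
  also have "\<dots> = (\<integral>y. 0 \<partial>(lborel :: real measure))"
  proof (rule integral_cong_AE)
    have "AE y in (lborel :: real measure). y \<noteq> c"
      by (rule AE_lborel_singleton)
    moreover have "AE y in lborel. integrable lborel (\<lambda>x. Hx (x, y))"
      using lborel_pair.AE_integrable_snd[OF int'] .
    ultimately show "AE y in lborel. (\<integral>x. Hx (x, y) \<partial>lborel) = 0"
    proof eventually_elim
      case (elim y)
      define M where "M = max 0 R + 1"
      have M: "R < norm (x, y)" if "M \<le> \<bar>x\<bar>" for x
        using norm_fst_le[of x y] that by (simp add: M_def)
      have "((\<lambda>x. Hx (x, y)) has_integral H (M, y) - H (- M, y)) {-M..M}"
        using D[OF elim(1)] by (intro fundamental_theorem_of_calculus)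
          (auto simp: M_def intro: has_vector_derivative_at_within)
      moreover have "H (M, y) = 0" "H (- M, y) = 0" using R M by (auto simp: M_def)
      ultimately have "((\<lambda>x. Hx (x, y)) has_integral 0) {-M..M}" by simp
      then have "((\<lambda>x. Hx (x, y)) has_integral 0) UNIV"
      proof (rule has_integral_on_superset)
        fix x assume "x \<notin> {-M..M}"
        then have "M \<le> \<bar>x\<bar>" by auto
        then show "Hx (x, y) = 0" using R M by blast
      qed auto
      then have "integral UNIV (\<lambda>x. Hx (x, y)) = 0" by (rule integral_unique)
      then show ?case using integral_lborel[OF elim(2)] by simp
    qed
  qed (use int' in \<open>auto intro!: lborel.borel_measurable_lebesgue_integral simp: lborel_prod
      dest: borel_measurable_integrable\<close>)
  finally show ?thesis by simp
qed

lemma integral_partial_y_eq_0: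
  fixes H Hy :: "real \<times> real \<Rightarrow> complex"
  assumes D: "\<And>x y. x \<noteq> c \<Longrightarrow> ((\<lambda>y. H (x, y)) has_vector_derivative Hy (x, y)) (at y)"
    and R: "\<And>w. R < norm w \<Longrightarrow> H w = 0 \<and> Hy w = 0"
    and int: "integrable lborel Hy"
  shows "(\<integral>w. Hy w \<partial>lborel) = 0"
proof -
  have int': "integrable (lborel \<Otimes>\<^sub>M lborel) Hy"
    using int by (simp add: lborel_prod)
  have swap: "integrable lborel (\<lambda>(x, y). Hy (y, x))"
    using lborel_pair.integrable_product_swap[OF int'] by (simp add: lborel_prod)
  have "(\<integral>w. (\<lambda>(x, y). Hy (y, x)) w \<partial>lborel) = 0"
  proof (rule integral_partial_x_eq_0[OF _ _ swap])
    show "((\<lambda>x. (\<lambda>(x, y). H (y, x)) (x, y)) has_vector_derivative (\<lambda>(x, y). Hy (y, x)) (x, y)) (at x)"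
      if "y \<noteq> c" for x y using D[OF that] by simp
    have "norm (y, x) = norm (x, y)" for x y :: real by (simp add: norm_prod_def add.commute)
    then show "(\<lambda>(x, y). H (y, x)) w = 0 \<and> (\<lambda>(x, y). Hy (y, x)) w = 0" if "R < norm w" for w
      using R[of "(snd w, fst w)"] that by (cases w) auto
  qed
  then show ?thesis
    using lborel_pair.integral_product_swap[of Hy] int' by (auto simp: lborel_prod dest: borel_measurable_integrable)
qed

lemma has_integral_winding_number:
  fixes g g' :: "real \<Rightarrow> complex"
  assumes deriv: "\<And>t. (g has_vector_derivative g' t) (at t)" and cont': "continuous_on UNIV g'"
    and z: "z \<notin> path_image g"
  shows "((\<lambda>t. g' t / (g t - z)) has_integral 2 * of_real pi * \<i> * winding_number g z) {0..1}"
proof -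
  have "valid_path g"
    unfolding valid_path_def
  proof (rule C1_differentiable_imp_piecewise)
    show "g C1_differentiable_on {0..1}"
      unfolding C1_differentiable_on_def using deriv cont' continuous_on_subset by blast
  qed
  then have "((\<lambda>w. 1 / (w - z)) has_contour_integral 2 * of_real pi * \<i> * winding_number g z) g"
    using has_contour_integral_winding_number[OF _ z] by (simp add: mult_ac)
  then show ?thesis
    using vector_derivative_at[OF deriv] by (simp add: has_contour_integral)
qed

lemma has_integral_lborel_continuous:
  fixes f :: "real \<Rightarrow> complex"
  assumes "continuous_on {a..b} f"
  shows "(f has_integral (\<integral>t. indicator {a..b} t *\<^sub>R f t \<partial>lborel)) {a..b}"
  using set_borel_integral_eq_integral[OF borel_integrable_atLeastAtMost'[OF assms]]
  by (simp add: set_lebesgue_integral_def integrable_integral)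

text \<open>At \<open>p\<close> itself the bounds read \<open>B / 0 = 0\<close>, so \<open>Fx\<close> and \<open>Fy\<close> vanish there.\<close>

locale punctured_test_function =
  fixes F Fx Fy :: "real \<times> real \<Rightarrow> complex" and p :: "real \<times> real" and K :: "(real \<times> real) set"
    and B :: real
  assumes partials: "\<And>w. w \<noteq> p \<Longrightarrow> has_partials F (Fx w) (Fy w) w"
    and support: "\<And>w. w \<notin> K \<Longrightarrow> F w = 0 \<and> Fx w = 0 \<and> Fy w = 0"
    and K: "compact K"
    and cont: "continuous_on (- {p}) Fx" "continuous_on (- {p}) Fy"
    and bound: "\<And>w. norm (F w) \<le> B" "\<And>w. norm (Fx w) \<le> B / norm (w - p)"
      "\<And>w. norm (Fy w) \<le> B / norm (w - p)"
begin

text \<open>Twice the Wirtinger derivative with respect to the conjugate variable. With this factor,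
  applying it to u_x - \<i> u_y gives exactly the Laplacian of u, and the Cauchy-Pompeiu constant
  becomes 2 pi.\<close>

definition dbar2 :: "real \<times> real \<Rightarrow> complex" where
  "dbar2 w = Fx w + \<i> * Fy w"

lemma measurable_partials [measurable]:
  "F \<in> borel_measurable borel" "Fx \<in> borel_measurable borel" "Fy \<in> borel_measurable borel"
  "dbar2 \<in> borel_measurable borel"
proof -
  have "continuous_on (- {p}) F"
    using has_partials_isCont[OF partials] by (intro continuous_at_imp_continuous_on) auto
  then show F: "F \<in> borel_measurable borel"
    by (rule borel_measurable_continuous_countable_exceptions[rotated]) simp
  show [measurable]: "Fx \<in> borel_measurable borel" "Fy \<in> borel_measurable borel"
    using cont by (auto intro!: borel_measurable_continuous_countable_exceptions[of "{p}"])
  show "dbar2 \<in> borel_measurable borel"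
    unfolding dbar2_def[abs_def] by measurable
qed

lemma B_nonneg: "0 \<le> B" using bound(1)[of p] norm_ge_zero order_trans by blast

lemma bound_indicator: "norm (Fx w) \<le> B * (indicator K w / norm (w - p))"
  "norm (Fy w) \<le> B * (indicator K w / norm (w - p))"
  "norm (dbar2 w) \<le> 2 * B * (indicator K w / norm (w - p))"
proof -
  show 1: "norm (Fx w) \<le> B * (indicator K w / norm (w - p))"
    using bound(2)[of w] support[of w] by (cases "w \<in> K") auto
  show 2: "norm (Fy w) \<le> B * (indicator K w / norm (w - p))"
    using bound(3)[of w] support[of w] by (cases "w \<in> K") auto
  have "norm (dbar2 w) \<le> norm (Fx w) + norm (Fy w)"
    unfolding dbar2_def by (rule order_trans[OF norm_triangle_ineq]) (simp add: norm_mult)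
  with 1 2 show "norm (dbar2 w) \<le> 2 * B * (indicator K w / norm (w - p))" by linarith
qed

lemma integrable_partials: "integrable lborel Fx" "integrable lborel Fy" "integrable lborel dbar2"
proof -
  have gen: "integrable lborel G"
    if [measurable]: "G \<in> borel_measurable borel"
      and G: "\<And>w. norm (G w) \<le> 2 * B * (indicator K w / norm (w - p))"
    for G :: "real\<times>real \<Rightarrow> complex"
  proof (rule Bochner_Integration.integrable_bound)
    show "integrable lborel (\<lambda>w. 2 * B * (indicator K w / norm (w - p)))"
      by (intro integrable_mult_right integrable_inverse_dist K)
    show "AE w in lborel. norm (G w) \<le> norm (2 * B * (indicator K w / norm (w - p)))"
    proof (intro AE_I2)
      fix w show "norm (G w) \<le> norm (2 * B * (indicator K w / norm (w - p)))"
        using order_trans[OF G[of w] abs_ge_self] by (simp only: real_norm_def)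
    qed
  qed simp
  have nn: "0 \<le> B * (indicator K w / norm (w - p))" for w using B_nonneg by simp
  have "norm (Fx w) \<le> 2 * B * (indicator K w / norm (w - p))"
    "norm (Fy w) \<le> 2 * B * (indicator K w / norm (w - p))" for w
    using bound_indicator(1,2)[of w] nn[of w] by linarith+
  then show "integrable lborel Fx" "integrable lborel Fy" "integrable lborel dbar2"
    by (intro gen measurable_partials bound_indicator; simp)+
qed

lemma outside_ball: obtains R where "\<And>w. R < norm w \<Longrightarrow> w \<notin> K"
proof -
  obtain R where "\<And>w. w \<in> K \<Longrightarrow> norm w \<le> R"
    using compact_imp_bounded[OF K] unfolding bounded_iff by blast
  then show ?thesis using that[of R] by force
qed

end

text \<open>With \<zeta> = w - q as a complex number, the function is cnj \<zeta> / (|\<zeta>|^2 +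
  \<delta>^2), a smooth substitute for 1 / \<zeta>. Its \<open>dbar2\<close> is no longer
  concentrated at \<open>q\<close> but is the kernel 2 \<delta>^2 / (|\<zeta>|^2 + \<delta>^2)^2, an
  approximate identity of mass 2 pi.\<close>

lemma smoothed_cauchy_partials:
  fixes q :: "real \<times> real" and \<delta> :: real
  assumes "\<delta> > 0"
  defines "X \<equiv> \<lambda>w::real\<times>real. complex_of_real (fst w - fst q)"
    and "Y \<equiv> \<lambda>w::real\<times>real. complex_of_real (snd w - snd q)"
  defines "D \<equiv> \<lambda>w. inverse (X w * X w + Y w * Y w + of_real (\<delta>\<^sup>2))"
  shows "has_partials (\<lambda>w. (X w - \<i> * Y w) * D w)
      (D w - (X w - \<i> * Y w) * (2 * X w * (D w)\<^sup>2)) (- \<i> * D w - (X w - \<i> * Y w) * (2 * Y w * (D w)\<^sup>2)) w"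
    and "D w = of_real (1 / ((norm (w - q))\<^sup>2 + \<delta>\<^sup>2))"
    and "(D w - (X w - \<i> * Y w) * (2 * X w * (D w)\<^sup>2)) + \<i> * (- \<i> * D w - (X w - \<i> * Y w) * (2 * Y w * (D w)\<^sup>2))
       = of_real (2 * \<delta>\<^sup>2 / ((norm (w - q))\<^sup>2 + \<delta>\<^sup>2)\<^sup>2)"
    and "X w - \<i> * Y w = cnj (to_complex (w - q))"
proof -
  have X: "has_partials X 1 0 w" and Y: "has_partials Y 0 1 w"
    unfolding X_def Y_def of_real_diff
    using has_partials_diff[OF has_partials_fst has_partials_const] has_partials_diff[OF has_partials_snd has_partials_const]
    by fastforce+
  define N where "N = (norm (w - q))\<^sup>2 + \<delta>\<^sup>2"
  have N: "X w * X w + Y w * Y w + of_real (\<delta>\<^sup>2) = of_real N"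
    by (simp add: X_def Y_def N_def norm_prod_def power2_eq_square)
  have Npos: "N > 0" unfolding N_def using \<open>\<delta> > 0\<close> by (simp add: add_nonneg_pos)
  have DN: "D w = inverse (of_real N)" unfolding D_def N ..
  have 1: "has_partials (\<lambda>w. X w * X w + Y w * Y w + of_real (\<delta>\<^sup>2)) (2 * X w) (2 * Y w) w"
    using has_partials_add[OF has_partials_add[OF has_partials_mult[OF X X] has_partials_mult[OF Y Y]] has_partials_const[of "of_real (\<delta>\<^sup>2)"]]
    by simp
  have D: "has_partials D (- (2 * X w * (D w)\<^sup>2)) (- (2 * Y w * (D w)\<^sup>2)) w"
    unfolding D_def by (rule has_partials_inverse[OF 1]) (use N Npos in simp)
  have Z: "has_partials (\<lambda>w. X w - \<i> * Y w) 1 (-\<i>) w"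
    using has_partials_diff[OF X has_partials_mult[OF has_partials_const[of \<i>] Y]] by simp
  show "has_partials (\<lambda>w. (X w - \<i> * Y w) * D w)
      (D w - (X w - \<i> * Y w) * (2 * X w * (D w)\<^sup>2)) (- \<i> * D w - (X w - \<i> * Y w) * (2 * Y w * (D w)\<^sup>2)) w"
    using has_partials_mult[OF Z D] by simp
  show "D w = of_real (1 / ((norm (w - q))\<^sup>2 + \<delta>\<^sup>2))"
    unfolding DN N_def by (simp add: inverse_eq_divide)
  have nz: "complex_of_real N \<noteq> 0" using Npos by simp
  have XY: "(X w - \<i> * Y w) * (X w + \<i> * Y w) = of_real (N - \<delta>\<^sup>2)"
    using N by (simp add: algebra_simps)
  have "(D w - (X w - \<i> * Y w) * (2 * X w * (D w)\<^sup>2)) + \<i> * (- \<i> * D w - (X w - \<i> * Y w) * (2 * Y w * (D w)\<^sup>2))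
     = 2 * D w - 2 * ((X w - \<i> * Y w) * (X w + \<i> * Y w)) * (D w)\<^sup>2"
    by (simp add: algebra_simps power2_eq_square)
  also have "\<dots> = of_real (2 * \<delta>\<^sup>2 / N\<^sup>2)"
    unfolding XY DN using nz by (simp add: field_simps power2_eq_square)
  finally show "(D w - (X w - \<i> * Y w) * (2 * X w * (D w)\<^sup>2)) + \<i> * (- \<i> * D w - (X w - \<i> * Y w) * (2 * Y w * (D w)\<^sup>2))
       = of_real (2 * \<delta>\<^sup>2 / ((norm (w - q))\<^sup>2 + \<delta>\<^sup>2)\<^sup>2)"
    by (simp add: N_def)
  show "X w - \<i> * Y w = cnj (to_complex (w - q))"
    by (simp add: X_def Y_def complex_eq_iff)
qed

context punctured_test_function
begin

text \<open>Integration by parts: \<open>dbar2\<close> of the product F E integrates to zero. The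
  puncture at p is harmless, since E and its partials are bounded for fixed \<delta>, so that the
  product inherits the integrability of the partials of F and the compact support of F.\<close>

lemma integral_smoothed_cauchy:
  fixes q :: "real \<times> real"
  assumes \<delta>: "\<delta> > 0"
  defines "E \<equiv> \<lambda>w. cnj (to_complex (w - q)) * of_real (1 / ((norm (w - q))\<^sup>2 + \<delta>\<^sup>2))"
  shows "(\<integral>w. dbar2 w * E w \<partial>lborel)
    = - (\<integral>w. F w * of_real (2 * \<delta>\<^sup>2 / ((norm (w - q))\<^sup>2 + \<delta>\<^sup>2)\<^sup>2) \<partial>lborel)"
proof -
  define X where "X = (\<lambda>w::real\<times>real. complex_of_real (fst w - fst q))"
  define Y where "Y = (\<lambda>w::real\<times>real. complex_of_real (snd w - snd q))"
  define D where "D = (\<lambda>w. inverse (X w * X w + Y w * Y w + of_real (\<delta>\<^sup>2)))"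
  define P where "P = (\<lambda>w. complex_of_real (2 * \<delta>\<^sup>2 / ((norm (w - q))\<^sup>2 + \<delta>\<^sup>2)\<^sup>2))"
  define kx where "kx = (\<lambda>w. D w - (X w - \<i> * Y w) * (2 * X w * (D w)\<^sup>2))"
  define ky where "ky = (\<lambda>w. - \<i> * D w - (X w - \<i> * Y w) * (2 * Y w * (D w)\<^sup>2))"
  have D: "D w = of_real (1 / ((norm (w - q))\<^sup>2 + \<delta>\<^sup>2))" for w
    unfolding D_def X_def Y_def by (rule smoothed_cauchy_partials(2)[OF \<delta>])
  have XY: "X w - \<i> * Y w = cnj (to_complex (w - q))" for w
    unfolding X_def Y_def by (rule smoothed_cauchy_partials(4)[OF \<delta>])
  have E: "E = (\<lambda>w. (X w - \<i> * Y w) * D w)"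
    unfolding E_def D XY ..
  have hE: "has_partials E (kx w) (ky w) w" for w
    unfolding E kx_def ky_def D_def X_def Y_def by (rule smoothed_cauchy_partials(1)[OF \<delta>])
  have kP: "kx w + \<i> * ky w = P w" for w
    unfolding kx_def ky_def P_def D_def X_def Y_def by (rule smoothed_cauchy_partials(3)[OF \<delta>])
  have [measurable]: "X \<in> borel_measurable borel" "Y \<in> borel_measurable borel"
    unfolding X_def Y_def by (auto intro!: borel_measurable_continuous_onI continuous_intros)
  have [measurable]: "D \<in> borel_measurable borel" unfolding D_def by measurable
  have [measurable]: "kx \<in> borel_measurable borel" "ky \<in> borel_measurable borel" "E \<in> borel_measurable borel"
    unfolding kx_def ky_def E by measurable
  define N where "N = (\<lambda>w. (norm (w - q))\<^sup>2 + \<delta>\<^sup>2)"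
  have N: "0 < N w" "\<delta>\<^sup>2 \<le> N w" "(norm (w - q))\<^sup>2 \<le> N w" for w
    using \<delta> by (auto simp: N_def add_nonneg_pos)
  have nD: "norm (D w) = 1 / N w" for w
  proof -
    have "D w = of_real (1 / N w)" unfolding D N_def ..
    then show ?thesis using N(1)[of w] by (simp del: of_real_divide)
  qed
  have nXY: "norm (X w) \<le> norm (w - q)" "norm (Y w) \<le> norm (w - q)" "norm (X w - \<i> * Y w) = norm (w - q)" for w
  proof -
    show "norm (X w) \<le> norm (w - q)" "norm (Y w) \<le> norm (w - q)"
      unfolding X_def Y_def norm_of_real fst_diff[symmetric] snd_diff[symmetric]
      by (metis norm_fst_le norm_snd_le prod.collapse real_norm_def)+
    show "norm (X w - \<i> * Y w) = norm (w - q)"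
      unfolding XY complex_mod_cnj norm_to_complex ..
  qed
  have prod_bd: "norm ((X w - \<i> * Y w) * (2 * Z * (D w)\<^sup>2)) \<le> 2 / \<delta>\<^sup>2" if Z: "norm Z \<le> norm (w - q)" for w Z
  proof -
    have "norm ((X w - \<i> * Y w) * (2 * Z * (D w)\<^sup>2)) = 2 * (norm (w - q) * norm Z) / (N w)\<^sup>2"
      by (simp add: norm_mult norm_power nD nXY power_divide)
    also have "\<dots> \<le> 2 * N w / (N w)\<^sup>2"
      using mult_left_mono[OF Z norm_ge_zero[of "w - q"]] N(3)[of w]
      by (intro divide_right_mono) (auto simp: power2_eq_square)
    also have "\<dots> = 2 / N w" using N(1)[of w] by (simp add: power2_eq_square)
    also have "\<dots> \<le> 2 / \<delta>\<^sup>2" using N[of w] \<delta> by (intro divide_left_mono) auto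
    finally show ?thesis .
  qed
  have D_bd: "norm (D w) \<le> 1 / \<delta>\<^sup>2" for w
    unfolding nD using N[of w] \<delta> by (intro divide_left_mono) auto
  have k_bd: "norm (kx w) \<le> 3 / \<delta>\<^sup>2" "norm (ky w) \<le> 3 / \<delta>\<^sup>2" for w
  proof -
    have "norm (kx w) \<le> norm (D w) + norm ((X w - \<i> * Y w) * (2 * X w * (D w)\<^sup>2))"
      unfolding kx_def by (rule norm_triangle_ineq4)
    also have "\<dots> \<le> 1 / \<delta>\<^sup>2 + 2 / \<delta>\<^sup>2" by (intro add_mono D_bd prod_bd nXY)
    finally show "norm (kx w) \<le> 3 / \<delta>\<^sup>2" by simp
    have "norm (ky w) \<le> norm (- \<i> * D w) + norm ((X w - \<i> * Y w) * (2 * Y w * (D w)\<^sup>2))"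
      unfolding ky_def by (rule norm_triangle_ineq4)
    also have "\<dots> \<le> 1 / \<delta>\<^sup>2 + 2 / \<delta>\<^sup>2" using D_bd[of w] by (intro add_mono prod_bd nXY) (simp add: norm_mult)
    finally show "norm (ky w) \<le> 3 / \<delta>\<^sup>2" by simp
  qed
  have E_bd: "norm (E w) \<le> 1 / \<delta>" for w
  proof -
    have "2 * norm (w - q) * \<delta> \<le> N w" unfolding N_def by (rule sum_squares_bound)
    then have "norm (w - q) * \<delta> \<le> N w" using N(1)[of w] by linarith
    then show ?thesis
      using N(1)[of w] \<delta> unfolding E norm_mult nXY nD by (simp add: field_simps)
  qed
  have int1: "integrable lborel (\<lambda>w. G w * E w)" if "integrable lborel G" for G :: "real\<times>real \<Rightarrow> complex"
  proof (rule Bochner_Integration.integrable_bound)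
    show "integrable lborel (\<lambda>w. of_real (1 / \<delta>) * G w)" using that by simp
    show "AE w in lborel. norm (G w * E w) \<le> norm (of_real (1 / \<delta>) * G w)"
    proof (intro AE_I2)
      fix w show "norm (G w * E w) \<le> norm (of_real (1 / \<delta>) * G w)"
        unfolding norm_mult norm_of_real
        using mult_left_mono[OF E_bd[of w] norm_ge_zero[of "G w"]] \<delta> by (simp add: mult.commute)
    qed
  qed (use borel_measurable_integrable[OF that] in measurable)
  have int2: "integrable lborel (\<lambda>w. F w * k w)"
    if [measurable]: "k \<in> borel_measurable borel" and k: "\<And>w. norm (k w) \<le> 3 / \<delta>\<^sup>2" for k
  proof (rule Bochner_Integration.integrable_bound)
    have "integrable lborel (indicator K :: _ \<Rightarrow> real)"
      using K emeasure_compact_finite[OF K] by (simp add: integrable_indicator_iff borel_compact less_top)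
    then show "integrable lborel (\<lambda>w. B * (3 / \<delta>\<^sup>2) * indicator K w)" by simp
    show "AE w in lborel. norm (F w * k w) \<le> norm (B * (3 / \<delta>\<^sup>2) * indicator K w)"
    proof (intro AE_I2)
      fix w
      have "norm (F w * k w) \<le> B * (3 / \<delta>\<^sup>2)"
        unfolding norm_mult using bound(1)[of w] k[of w] B_nonneg by (intro mult_mono) auto
      then show "norm (F w * k w) \<le> norm (B * (3 / \<delta>\<^sup>2) * indicator K w)"
        using support[of w] order_trans[OF _ abs_ge_self, of _ "B * (3 / \<delta>\<^sup>2)"] by (cases "w \<in> K") auto
    qed
  qed measurable
  define Hx where "Hx = (\<lambda>w. Fx w * E w + F w * kx w)"
  define Hy where "Hy = (\<lambda>w. Fy w * E w + F w * ky w)"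
  obtain R where R: "\<And>w. R < norm w \<Longrightarrow> w \<notin> K" using outside_ball by blast
  have intH: "integrable lborel Hx" "integrable lborel Hy"
    unfolding Hx_def Hy_def by (intro Bochner_Integration.integrable_add int1 int2 integrable_partials k_bd; measurable)+
  have "(\<integral>w. Hx w \<partial>lborel) = 0"
  proof (rule integral_partial_x_eq_0[of "snd p" "\<lambda>w. F w * E w" Hx R])
    fix x y assume "y \<noteq> snd p"
    then have "(x, y) \<noteq> p" by auto
    then show "((\<lambda>x. F (x, y) * E (x, y)) has_vector_derivative Hx (x, y)) (at x)"
      unfolding Hx_def by (rule has_partials_x[OF has_partials_mult[OF partials hE]])
  qed (use R support intH in \<open>auto simp: Hx_def\<close>)
  moreover have "(\<integral>w. Hy w \<partial>lborel) = 0"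
  proof (rule integral_partial_y_eq_0[of "fst p" "\<lambda>w. F w * E w" Hy R])
    fix x y assume "x \<noteq> fst p"
    then have "(x, y) \<noteq> p" by auto
    then show "((\<lambda>y. F (x, y) * E (x, y)) has_vector_derivative Hy (x, y)) (at y)"
      unfolding Hy_def by (rule has_partials_y[OF has_partials_mult[OF partials hE]])
  qed (use R support intH in \<open>auto simp: Hy_def\<close>)
  ultimately have "0 = (\<integral>w. Hx w + \<i> * Hy w \<partial>lborel)"
    using intH by simp
  also have "(\<lambda>w. Hx w + \<i> * Hy w) = (\<lambda>w. dbar2 w * E w + F w * P w)"
    by (simp add: Hx_def Hy_def dbar2_def algebra_simps flip: kP)
  also have "(\<integral>w. dbar2 w * E w + F w * P w \<partial>lborel) = (\<integral>w. dbar2 w * E w \<partial>lborel) + (\<integral>w. F w * P w \<partial>lborel)"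
  proof (rule Bochner_Integration.integral_add)
    have "(\<lambda>w. F w * P w) = (\<lambda>w. F w * kx w + \<i> * (F w * ky w))"
      by (simp add: algebra_simps flip: kP)
    moreover have "integrable lborel (\<lambda>w. F w * kx w + \<i> * (F w * ky w))"
      by (intro Bochner_Integration.integrable_add integrable_mult_right int2 k_bd; measurable)
    ultimately show "integrable lborel (\<lambda>w. F w * P w)" by simp
  qed (intro int1 integrable_partials)
  finally show ?thesis unfolding P_def by (simp add: eq_neg_iff_add_eq_0)
qed

text \<open>The two singularities, at p and at q, multiply to 1 / (a b). Since |q - p| \<le> a + b,
  the partial fraction inequality 1 / (a b) \<le> (1 / a + 1 / b) / |q - p| replaces the product by
  a sum of separately integrable terms.\<close>

lemma dbar2_quotient_bound:
  assumes "q \<noteq> p"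
  shows "norm (dbar2 w / to_complex (w - q))
    \<le> 2 * B / norm (q - p) * (indicator K w / norm (w - p) + indicator K w / norm (w - q))"
proof (cases "w \<in> K \<and> w \<noteq> p \<and> w \<noteq> q")
  case True
  define a b d where "a = norm (w - p)" and "b = norm (w - q)" and "d = norm (q - p)"
  have abd: "0 < a" "0 < b" "0 < d" "d \<le> a + b"
    using True assms norm_triangle_ineq4[of "w - p" "w - q"] by (auto simp: a_def b_def d_def)
  have "norm (dbar2 w / to_complex (w - q)) \<le> 2 * B * (1 / a) / b"
    using bound_indicator(3)[of w] True unfolding norm_divide norm_to_complex a_def b_def
    by (intro divide_right_mono) auto
  also have "\<dots> = 2 * B * (1 / (a * b))" by simp
  also have "\<dots> \<le> 2 * B * ((1 / a + 1 / b) / d)"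
  proof (intro mult_left_mono)
    have "1 / (a * b) = (d / (a * b)) / d" using abd by simp
    also have "\<dots> \<le> ((a + b) / (a * b)) / d" using abd by (intro divide_right_mono) auto
    also have "(a + b) / (a * b) = 1 / a + 1 / b" using abd by (simp add: field_simps)
    finally show "1 / (a * b) \<le> (1 / a + 1 / b) / d" .
  qed (use B_nonneg in auto)
  finally show ?thesis using True by (simp add: a_def b_def d_def)
next
  \<comment> \<open>The left side vanishes off \<open>K\<close> by support, at p because the bound
    on the partials reads B / 0 = 0, and at q by division by zero.\<close>
  case False
  have "norm (dbar2 w / to_complex (w - q)) = 0"
    using False bound_indicator(3)[of w] by (auto simp: dbar2_def support)
  moreover have "0 \<le> 2 * B / norm (q - p) * (indicator K w / norm (w - p) + indicator K w / norm (w - q))"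
    using B_nonneg by (intro mult_nonneg_nonneg add_nonneg_nonneg divide_nonneg_nonneg) auto
  ultimately show ?thesis by linarith
qed

lemma integrable_dbar2_bound:
  "integrable lborel (\<lambda>w. 2 * B / norm (q - p) * (indicator K w / norm (w - p) + indicator K w / norm (w - q)))"
  by (intro integrable_mult_right Bochner_Integration.integrable_add integrable_inverse_dist K)

lemma integrable_dbar2_quotient:
  assumes "q \<noteq> p" shows "integrable lborel (\<lambda>w. dbar2 w / to_complex (w - q))"
proof (rule Bochner_Integration.integrable_bound[OF integrable_dbar2_bound[of q]])
  show "AE w in lborel. norm (dbar2 w / to_complex (w - q)) \<le> norm
      (2 * B / norm (q - p) * (indicator K w / norm (w - p) + indicator K w / norm (w - q)))"
  proof (intro AE_I2)
    fix w show "norm (dbar2 w / to_complex (w - q)) \<le> norm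
      (2 * B / norm (q - p) * (indicator K w / norm (w - p) + indicator K w / norm (w - q)))"
      using order_trans[OF dbar2_quotient_bound[OF assms, of w] abs_ge_self] by (simp only: real_norm_def)
  qed
qed measurable

text \<open>The limit \<delta> -> 0 of the smoothed identity. On the left the smoothed kernel never
  exceeds 1 / |w - q| in modulus, so the preceding bound dominates; on the right an approximate
  identity is evaluated at a point of continuity of F.\<close>

lemma cauchy_pompeiu:
  assumes q: "q \<noteq> p"
  shows "(\<integral>w. dbar2 w / to_complex (w - q) \<partial>lborel) = - 2 * of_real pi * F q"
proof -
  define \<delta> where "\<delta> = (\<lambda>n. 1 / (real n + 1))"
  have \<delta>: "\<delta> n > 0" for n by (simp add: \<delta>_def)
  have \<delta>0: "\<delta> \<longlonglongrightarrow> 0" unfolding \<delta>_def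
    using LIMSEQ_inverse_real_of_nat by (simp add: inverse_eq_divide add.commute)
  define E where "E = (\<lambda>n w. cnj (to_complex (w - q)) * of_real (1 / ((norm (w - q))\<^sup>2 + (\<delta> n)\<^sup>2)))"
  have lim1: "(\<lambda>n. \<integral>w. dbar2 w * E n w \<partial>lborel) \<longlonglongrightarrow> (\<integral>w. dbar2 w / to_complex (w - q) \<partial>lborel)"
  proof (rule integral_dominated_convergence[OF _ _ integrable_dbar2_bound[of q]])
    show "AE w in lborel. (\<lambda>n. dbar2 w * E n w) \<longlonglongrightarrow> dbar2 w / to_complex (w - q)"
    proof (intro AE_I2)
      fix w
      show "(\<lambda>n. dbar2 w * E n w) \<longlonglongrightarrow> dbar2 w / to_complex (w - q)"
      proof (cases "w = q")
        case False
        then have "(\<lambda>n. dbar2 w * E n w) \<longlonglongrightarrow> dbar2 w * (cnj (to_complex (w - q)) * of_real (1 / ((norm (w - q))\<^sup>2 + 0\<^sup>2)))"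
          unfolding E_def by (intro tendsto_intros \<delta>0) auto
        also have "dbar2 w * (cnj (to_complex (w - q)) * of_real (1 / ((norm (w - q))\<^sup>2 + 0\<^sup>2))) = dbar2 w / to_complex (w - q)"
        proof -
          have "c * (cnj \<zeta> * of_real (1 / ((norm \<zeta>)\<^sup>2 + 0\<^sup>2))) = c / \<zeta>" if "\<zeta> \<noteq> 0" for c \<zeta>
          proof -
            have "complex_of_real (1 / ((norm \<zeta>)\<^sup>2 + 0\<^sup>2)) = 1 / (\<zeta> * cnj \<zeta>)"
              using complex_norm_square[of \<zeta>] by simp
            then show ?thesis using that by simp
          qed
          moreover have "to_complex (w - q) \<noteq> 0" using False by simp
          ultimately show ?thesis by (metis norm_to_complex)
        qed
        finally show ?thesis .
      qed (simp add: E_def)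
    qed
    show "AE w in lborel. norm (dbar2 w * E n w)
        \<le> 2 * B / norm (q - p) * (indicator K w / norm (w - p) + indicator K w / norm (w - q))" for n
    proof (intro AE_I2)
      fix w
      have "norm (E n w) \<le> norm (1 / to_complex (w - q))"
      proof (cases "w = q")
        case False
        then have pos: "0 < norm (w - q)" by simp
        then have "1 / ((norm (w - q))\<^sup>2 + (\<delta> n)\<^sup>2) \<le> 1 / (norm (w - q))\<^sup>2"
          by (intro divide_left_mono mult_pos_pos) (auto intro: add_pos_nonneg)
        from mult_left_mono[OF this norm_ge_zero[of "w - q"]]
        have "norm (w - q) * (1 / ((norm (w - q))\<^sup>2 + (\<delta> n)\<^sup>2)) \<le> 1 / norm (w - q)"
          using pos by (simp add: power2_eq_square)
        then show ?thesis unfolding E_def norm_mult norm_divide complex_mod_cnj norm_to_complex norm_of_real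
          by (simp add: abs_of_nonneg)
      qed (simp add: E_def)
      then have "norm (dbar2 w * E n w) \<le> norm (dbar2 w / to_complex (w - q))"
        unfolding norm_mult norm_divide using mult_left_mono[OF _ norm_ge_zero[of "dbar2 w"]] by fastforce
      then show "norm (dbar2 w * E n w)
        \<le> 2 * B / norm (q - p) * (indicator K w / norm (w - p) + indicator K w / norm (w - q))"
        using dbar2_quotient_bound[OF q, of w] by (rule order_trans)
    qed
    show "(\<lambda>w. dbar2 w * E n w) \<in> borel_measurable lborel" for n
    proof -
      have [measurable]: "(\<lambda>w. cnj (to_complex (w - q))) \<in> borel_measurable borel"
        by (intro borel_measurable_continuous_onI continuous_intros)
      show ?thesis unfolding E_def measurable_lborel1 by measurable
    qed
    show "(\<lambda>w. dbar2 w / to_complex (w - q)) \<in> borel_measurable lborel"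
      unfolding measurable_lborel1 by measurable
  qed
  \<comment> \<open>Substituting w = q + \<delta> u makes the kernel independent of n, so that only
    the argument of the bounded function F still varies.\<close>
  have eq: "(\<integral>w. dbar2 w * E n w \<partial>lborel) = - (\<integral>u. F (q + \<delta> n *\<^sub>R u) * of_real (2 / (1 + (norm u)\<^sup>2)\<^sup>2) \<partial>lborel)" for n
  proof -
    let ?P = "\<lambda>w. F w * of_real (2 * (\<delta> n)\<^sup>2 / ((norm (w - q))\<^sup>2 + (\<delta> n)\<^sup>2)\<^sup>2)"
    have "(\<integral>w. dbar2 w * E n w \<partial>lborel) = - (\<integral>w. ?P w \<partial>lborel)"
      unfolding E_def by (rule integral_smoothed_cauchy[OF \<delta>])
    also have "(\<integral>w. ?P w \<partial>lborel) = (\<integral>u. of_real ((\<delta> n)\<^sup>2) * ?P (q + \<delta> n *\<^sub>R u) \<partial>lborel)"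
      by (rule integral_lborel_plane_affine) (use \<delta>[of n] in auto)
    also have "\<dots> = (\<integral>u. F (q + \<delta> n *\<^sub>R u) * of_real (2 / (1 + (norm u)\<^sup>2)\<^sup>2) \<partial>lborel)"
    proof (rule Bochner_Integration.integral_cong)
      fix u :: "real \<times> real"
      define d where "d = \<delta> n"
      have d: "d > 0" using \<delta>[of n] by (simp add: d_def)
      have "(norm (d *\<^sub>R u))\<^sup>2 + d\<^sup>2 = d\<^sup>2 * (1 + (norm u)\<^sup>2)" by (simp add: power_mult_distrib algebra_simps)
      moreover have "1 + (norm u)\<^sup>2 > 0" by (simp add: add_pos_nonneg)
      moreover have "d\<^sup>2 * (2 * d\<^sup>2 / (d\<^sup>2 * m)\<^sup>2) = 2 / m\<^sup>2" if "m > 0" for m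
        using d that by (simp add: field_simps power2_eq_square)
      ultimately have "d\<^sup>2 * (2 * d\<^sup>2 / ((norm (d *\<^sub>R u))\<^sup>2 + d\<^sup>2)\<^sup>2) = 2 / (1 + (norm u)\<^sup>2)\<^sup>2"
        by metis
      then have "complex_of_real (d\<^sup>2) * of_real (2 * d\<^sup>2 / ((norm (d *\<^sub>R u))\<^sup>2 + d\<^sup>2)\<^sup>2) = of_real (2 / (1 + (norm u)\<^sup>2)\<^sup>2)"
        by (simp only: of_real_mult[symmetric])
      then show "of_real ((\<delta> n)\<^sup>2) * ?P (q + \<delta> n *\<^sub>R u) = F (q + \<delta> n *\<^sub>R u) * of_real (2 / (1 + (norm u)\<^sup>2)\<^sup>2)"
        unfolding d_def[symmetric] by (simp only: add_diff_cancel_left' mult.left_commute)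
    qed simp
    finally show ?thesis .
  qed
  have "(\<lambda>n. \<integral>u. F (q + \<delta> n *\<^sub>R u) * of_real (2 / (1 + (norm u)\<^sup>2)\<^sup>2) \<partial>lborel)
      \<longlonglongrightarrow> (\<integral>u. F q * of_real (2 / (1 + (norm u)\<^sup>2)\<^sup>2) \<partial>(lborel :: (real\<times>real) measure))"
  proof (rule integral_dominated_convergence)
    show "integrable lborel (\<lambda>u::real\<times>real. 2 * B * (1 / (1 + (norm u)\<^sup>2)\<^sup>2))"
      by (intro integrable_mult_right integral_poisson_kernel)
    show "AE u in lborel. (\<lambda>n. F (q + \<delta> n *\<^sub>R u) * of_real (2 / (1 + (norm u)\<^sup>2)\<^sup>2)) \<longlonglongrightarrow> F q * of_real (2 / (1 + (norm u)\<^sup>2)\<^sup>2)"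
    proof (intro AE_I2 tendsto_mult tendsto_const)
      fix u :: "real\<times>real"
      have "(\<lambda>n. q + \<delta> n *\<^sub>R u) \<longlonglongrightarrow> q + 0 *\<^sub>R u" by (intro tendsto_intros \<delta>0)
      moreover have "isCont F q" using has_partials_isCont[OF partials[OF q]] .
      ultimately show "(\<lambda>n. F (q + \<delta> n *\<^sub>R u)) \<longlonglongrightarrow> F q"
        using isCont_tendsto_compose[of q F "\<lambda>n. q + \<delta> n *\<^sub>R u" sequentially] by simp
    qed
    show "AE u in lborel. norm (F (q + \<delta> n *\<^sub>R u) * of_real (2 / (1 + (norm u)\<^sup>2)\<^sup>2)) \<le> 2 * B * (1 / (1 + (norm u)\<^sup>2)\<^sup>2)" for n
    proof (intro AE_I2)
      fix u :: "real\<times>real"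
      have "norm (F (q + \<delta> n *\<^sub>R u)) * (2 / (1 + (norm u)\<^sup>2)\<^sup>2) \<le> B * (2 / (1 + (norm u)\<^sup>2)\<^sup>2)"
        by (intro mult_right_mono bound) simp
      then show "norm (F (q + \<delta> n *\<^sub>R u) * of_real (2 / (1 + (norm u)\<^sup>2)\<^sup>2)) \<le> 2 * B * (1 / (1 + (norm u)\<^sup>2)\<^sup>2)"
        unfolding norm_mult norm_of_real by (simp add: mult.commute)
    qed
  qed simp_all
  moreover have "(\<integral>u. F q * of_real (2 / (1 + (norm u)\<^sup>2)\<^sup>2) \<partial>(lborel :: (real\<times>real) measure)) = 2 * of_real pi * F q"
  proof -
    have "(\<integral>u. F q * of_real (2 / (1 + (norm u)\<^sup>2)\<^sup>2) \<partial>(lborel :: (real\<times>real) measure))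
       = F q * of_real (\<integral>u. 2 * (1 / (1 + (norm u)\<^sup>2)\<^sup>2) \<partial>(lborel :: (real\<times>real) measure))"
      by (simp only: integral_mult_right_zero integral_complex_of_real times_divide_eq_right mult_1_right)
    also have "(\<integral>u. 2 * (1 / (1 + (norm u)\<^sup>2)\<^sup>2) \<partial>(lborel :: (real\<times>real) measure)) = 2 * pi"
      by (simp only: integral_mult_right_zero integral_poisson_kernel)
    finally show ?thesis by simp
  qed
  ultimately have "(\<lambda>n. \<integral>w. dbar2 w * E n w \<partial>lborel) \<longlonglongrightarrow> - (2 * of_real pi * F q)"
    unfolding eq by (auto intro: tendsto_minus)
  with lim1 show ?thesis using LIMSEQ_unique by fastforce
qed


text \<open>Let \<open>W\<close> be any Borel function that agrees with the winding number off the
  curve; its values on the curve are immaterial because the curve is a null set. That p lies off the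
  curve keeps the Cauchy-Pompeiu bounds uniform along it.\<close>

lemma green_winding:
  fixes g g' :: "real \<Rightarrow> complex" and W :: "real \<times> real \<Rightarrow> complex"
  assumes deriv: "\<And>t. (g has_vector_derivative g' t) (at t)" and cont': "continuous_on UNIV g'"
    and closed: "g 1 = g 0" and p: "to_complex p \<notin> path_image g"
    and W: "W \<in> borel_measurable borel" "\<And>w. to_complex w \<notin> path_image g \<Longrightarrow> winding_number g (to_complex w) = W w"
  shows "((\<lambda>t. F (Re (g t), Im (g t)) * g' t) has_integral
           \<i> * (\<integral>w. W w * dbar2 w \<partial>lborel)) {0..1}"
proof -
  define pr where "pr = (\<lambda>t. (Re (g t), Im (g t)))"
  have g_pr: "to_complex (pr t) = g t" for t by (simp add: pr_def complex_eq_iff)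
  have cont: "continuous_on UNIV g"
    using deriv by (meson continuous_at_imp_continuous_on has_vector_derivative_continuous)
  have [measurable]: "g \<in> borel_measurable borel" "g' \<in> borel_measurable borel"
    using cont cont' by (auto intro: borel_measurable_continuous_onI)
  have contpr: "continuous_on S pr" for S
    unfolding pr_def by (intro continuous_intros continuous_on_subset[OF cont]) auto
  have g_ne_p: "pr t \<noteq> p" if "t \<in> {0..1}" for t
    using p that g_pr[of t] by (auto simp: path_image_def)
  have sub: "pr ` {0..1} \<subseteq> - {p}" using g_ne_p by blast
  have contF: "continuous_on {0..1} (\<lambda>t. F (pr t) * g' t)"
  proof -
    have "continuous_on (- {p}) F"
      using has_partials_isCont[OF partials] by (intro continuous_at_imp_continuous_on) auto
    then show ?thesis
      by (intro continuous_intros continuous_on_compose2[OF _ contpr] continuous_on_subset[OF cont'])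
        (use sub in auto)
  qed
  \<comment> \<open>The bound for the inner integral contains 1 / |q - p|; compactness of the curve
    makes it uniform in the parameter.\<close>
  obtain d where d: "d > 0" "\<And>t. t \<in> {0..1} \<Longrightarrow> d \<le> norm (pr t - p)"
  proof -
    have "\<exists>x\<in>{0..1}. \<forall>y\<in>{0..1}. norm (pr x - p) \<le> norm (pr y - p)"
      by (intro continuous_attains_inf continuous_intros contpr) auto
    then obtain t0 where "t0 \<in> {0..1}" "\<And>t. t \<in> {0..1} \<Longrightarrow> norm (pr t0 - p) \<le> norm (pr t - p)" by blast
    with that[of "norm (pr t0 - p)"] g_ne_p show ?thesis by auto
  qed
  obtain V where V: "\<And>t. t \<in> {0..1} \<Longrightarrow> norm (g' t) \<le> V"
  proof -
    have "bounded (g' ` {0..1})"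
      by (intro compact_imp_bounded compact_continuous_image continuous_on_subset[OF cont']) auto
    then show ?thesis using that unfolding bounded_iff by blast
  qed
  have V0: "0 \<le> V" using order_trans[OF norm_ge_zero V[of 0]] by simp
  define J where "J = measure lborel K + (\<integral>w. indicator ({-1..1} \<times> {-1..1}) w / norm w \<partial>(lborel :: (real\<times>real) measure))"
  have inner_bd: "(\<integral>w. norm (dbar2 w / to_complex (w - q)) \<partial>lborel) \<le> 2 * B / norm (q - p) * (J + J)" if "q \<noteq> p" for q
  proof -
    have "(\<integral>w. norm (dbar2 w / to_complex (w - q)) \<partial>lborel)
       \<le> (\<integral>w. 2 * B / norm (q - p) * (indicator K w / norm (w - p) + indicator K w / norm (w - q)) \<partial>lborel)"
      by (intro integral_mono integrable_norm integrable_dbar2_quotient integrable_dbar2_bound dbar2_quotient_bound that)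
    also have "\<dots> = 2 * B / norm (q - p) *
        ((\<integral>w. indicator K w / norm (w - p) \<partial>lborel) + (\<integral>w. indicator K w / norm (w - q) \<partial>lborel))"
      by (simp only: integral_mult_right_zero Bochner_Integration.integral_add[OF integrable_inverse_dist(1)[OF K] integrable_inverse_dist(1)[OF K]])
    also have "\<dots> \<le> 2 * B / norm (q - p) * (J + J)"
      unfolding J_def using B_nonneg
      by (intro mult_left_mono add_mono integrable_inverse_dist K) auto
    finally show ?thesis .
  qed
  have J0: "0 \<le> J" unfolding J_def by (intro add_nonneg_nonneg integral_nonneg_AE) auto
  \<comment> \<open>Integrated over w first, \<Phi> gives -2 pi F on the curve times the velocity;
    integrated over t first, it gives the winding number integral. The difference is taken as w
    minus the curve point, which accounts for the minus sign in \<open>wind\<close>.\<close>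
  define \<Phi> where "\<Phi> = (\<lambda>(t, w). indicator {0..1} t * g' t * (dbar2 w / to_complex (w - pr t)))"
  have [measurable]: "pr \<in> borel_measurable borel"
    using contpr by (rule borel_measurable_continuous_onI)
  have \<Phi>_meas [measurable]: "\<Phi> \<in> borel_measurable (lborel \<Otimes>\<^sub>M lborel)"
    unfolding \<Phi>_def by measurable
  have inner: "(\<integral>w. \<Phi> (t, w) \<partial>lborel) = - 2 * of_real pi * (indicator {0..1} t *\<^sub>R (F (pr t) * g' t))" for t
  proof (cases "t \<in> {0..1}")
    case True
    have "(\<integral>w. \<Phi> (t, w) \<partial>lborel) = indicator {0..1} t * g' t * (\<integral>w. dbar2 w / to_complex (w - pr t) \<partial>lborel)"
      unfolding \<Phi>_def prod.case by (rule integral_mult_right_zero)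
    then show ?thesis unfolding cauchy_pompeiu[OF g_ne_p[OF True]] using True by simp
  qed (simp add: \<Phi>_def)
  have int\<Phi>: "integrable (lborel \<Otimes>\<^sub>M lborel) \<Phi>"
  proof (rule lborel_pair.Fubini_integrable[OF \<Phi>_meas])
    show "AE t in lborel. integrable lborel (\<lambda>w. \<Phi> (t, w))"
    proof (intro AE_I2)
      fix t
      show "integrable lborel (\<lambda>w. \<Phi> (t, w))"
      proof (cases "t \<in> {0..1}")
        case True
        then show ?thesis unfolding \<Phi>_def prod.case
          by (intro integrable_mult_right integrable_dbar2_quotient g_ne_p)
      qed (simp add: \<Phi>_def)
    qed
    show "integrable lborel (\<lambda>t. \<integral>w. norm (\<Phi> (t, w)) \<partial>lborel)"
    proof (rule Bochner_Integration.integrable_bound)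
      show "integrable lborel (\<lambda>t::real. V * (2 * B / d * (J + J)) * indicator {0..1} t)" by simp
      show "(\<lambda>t. \<integral>w. norm (\<Phi> (t, w)) \<partial>lborel) \<in> borel_measurable lborel"
        by measurable
      show "AE t in lborel. norm (\<integral>w. norm (\<Phi> (t, w)) \<partial>lborel) \<le> norm (V * (2 * B / d * (J + J)) * indicator {0..1} t)"
      proof (intro AE_I2)
        fix t
        show "norm (\<integral>w. norm (\<Phi> (t, w)) \<partial>lborel) \<le> norm (V * (2 * B / d * (J + J)) * indicator {0..1} t)"
        proof (cases "t \<in> {0..1}")
          case True
          have "(\<integral>w. norm (\<Phi> (t, w)) \<partial>lborel) = norm (g' t) * (\<integral>w. norm (dbar2 w / to_complex (w - pr t)) \<partial>lborel)"
          proof -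
            have "norm (\<Phi> (t, w)) = norm (g' t) * norm (dbar2 w / to_complex (w - pr t))" for w
              unfolding \<Phi>_def prod.case norm_mult using True by simp
            then show ?thesis by (simp only: integral_mult_right_zero)
          qed
          also have "\<dots> \<le> V * (2 * B / d * (J + J))"
          proof (rule mult_mono)
            show "(\<integral>w. norm (dbar2 w / to_complex (w - pr t)) \<partial>lborel) \<le> 2 * B / d * (J + J)"
            proof (rule order_trans[OF inner_bd[OF g_ne_p[OF True]]])
              show "2 * B / norm (pr t - p) * (J + J) \<le> 2 * B / d * (J + J)"
                using d(2)[OF True] d(1) B_nonneg J0
                by (intro mult_right_mono divide_left_mono mult_pos_pos) auto
            qed
          qed (use V True V0 in \<open>auto intro!: integral_nonneg_AE\<close>)
          finally have "(\<integral>w. norm (\<Phi> (t, w)) \<partial>lborel) \<le> V * (2 * B / d * (J + J))" .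
          from order_trans[OF this abs_ge_self]
          have "(\<integral>w. norm (\<Phi> (t, w)) \<partial>lborel) \<le> norm (V * (2 * B / d * (J + J)) * indicator {0..1} t)"
            unfolding real_norm_def indicator_simps(1)[OF True] mult_1_right .
          moreover have "norm (\<integral>w. norm (\<Phi> (t, w)) \<partial>lborel) = (\<integral>w. norm (\<Phi> (t, w)) \<partial>lborel)"
            unfolding real_norm_def by (intro abs_of_nonneg integral_nonneg_AE) auto
          ultimately show ?thesis by linarith
        qed (simp add: \<Phi>_def)
      qed
    qed
  qed
  \<comment> \<open>The curve is the differentiable image of an interval in a space of higher
    dimension, hence Lebesgue null.\<close>
  have negl: "AE w in (lborel :: (real\<times>real) measure). to_complex w \<notin> path_image g"
  proof -
    have "pr differentiable_on {0..1}"
    proof (rule differentiable_at_imp_differentiable_on)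
      fix t
      have "(pr has_derivative (\<lambda>h. (Re (h *\<^sub>R g' t), Im (h *\<^sub>R g' t)))) (at t)"
        unfolding pr_def using deriv[of t] unfolding has_vector_derivative_def
        by (intro has_derivative_Pair has_derivative_Re has_derivative_Im)
      then show "pr differentiable at t" by (auto simp: differentiable_def)
    qed
    then have "negligible (pr ` {0..1})"
      by (rule negligible_differentiable_image_lowdim[rotated]) simp
    moreover have "compact (pr ` {0..1})"
      by (intro compact_continuous_image contpr) auto
    ultimately have "pr ` {0..1} \<in> null_sets lborel"
      by (simp add: negligible_iff_null_sets borel_compact null_sets_completion_iff)
    then have "AE w in lborel. w \<notin> pr ` {0..1}" by (rule AE_not_in)
    then show ?thesis
    proof eventually_elim
      case (elim w)
      show ?case
      proof
        assume "to_complex w \<in> path_image g"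
        then obtain t where "t \<in> {0..1}" "to_complex w = to_complex (pr t)"
          by (auto simp: path_image_def g_pr)
        then show False using elim by auto
      qed
    qed
  qed
  have wind: "(\<integral>t. \<Phi> (t, w) \<partial>lborel) = - (2 * of_real pi * \<i>) * (W w * dbar2 w)" if w: "to_complex w \<notin> path_image g" for w
  proof -
    have g_ne: "g t \<noteq> to_complex w" if "t \<in> {0..1}" for t
      using w imageI[OF that, of g] unfolding path_image_def by metis
    have "((\<lambda>t. g' t / (g t - to_complex w)) has_integral
        (\<integral>t. indicator {0..1} t *\<^sub>R (g' t / (g t - to_complex w)) \<partial>lborel)) {0..1}"
      by (intro has_integral_lborel_continuous continuous_intros continuous_on_subset[OF cont] continuous_on_subset[OF cont'])
        (use g_ne in auto)
    moreover note has_integral_winding_number[OF deriv cont' w]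
    ultimately have eq: "(\<integral>t. indicator {0..1} t *\<^sub>R (g' t / (g t - to_complex w)) \<partial>lborel) = 2 * of_real pi * \<i> * W w"
      using has_integral_unique W(2)[OF w] by metis
    have "(\<integral>t. \<Phi> (t, w) \<partial>lborel) = (\<integral>t. - dbar2 w * (indicator {0..1} t *\<^sub>R (g' t / (g t - to_complex w))) \<partial>lborel)"
    proof (rule Bochner_Integration.integral_cong)
      fix t
      have "to_complex (w - pr t) = - (g t - to_complex w)" by (simp add: g_pr)
      then show "\<Phi> (t, w) = - dbar2 w * (indicator {0..1} t *\<^sub>R (g' t / (g t - to_complex w)))"
        by (simp only: \<Phi>_def prod.case divide_minus_right) (simp add: indicator_def)
    qed simp
    also have "\<dots> = - dbar2 w * (2 * of_real pi * \<i> * W w)"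
      by (simp only: integral_mult_right_zero eq)
    finally show ?thesis by (simp add: algebra_simps)
  qed
  have "- 2 * of_real pi * (\<integral>t. indicator {0..1} t *\<^sub>R (F (pr t) * g' t) \<partial>lborel)
      = (\<integral>t. \<integral>w. \<Phi> (t, w) \<partial>lborel \<partial>lborel)"
    by (simp only: inner integral_mult_right_zero)
  also have "\<dots> = (\<integral>w. \<integral>t. \<Phi> (t, w) \<partial>lborel \<partial>lborel)"
    using lborel_pair.Fubini_integral[of "\<lambda>t w. \<Phi> (t, w)"] int\<Phi> by simp
  also have "\<dots> = (\<integral>w. - (2 * of_real pi * \<i>) * (W w * dbar2 w) \<partial>lborel)"
  proof (rule integral_cong_AE)
    show "AE w in lborel. (\<integral>t. \<Phi> (t, w) \<partial>lborel) = - (2 * of_real pi * \<i>) * (W w * dbar2 w)"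
      using negl by eventually_elim (rule wind)
    show "(\<lambda>w. - (2 * of_real pi * \<i>) * (W w * dbar2 w)) \<in> borel_measurable lborel"
      using W(1) by simp
    show "(\<lambda>w. \<integral>t. \<Phi> (t, w) \<partial>lborel) \<in> borel_measurable lborel"
      using \<Phi>_meas by measurable
  qed
  also have "\<dots> = - (2 * of_real pi * \<i>) * (\<integral>w. W w * dbar2 w \<partial>lborel)"
    by (simp only: integral_mult_right_zero)
  finally have eq: "(\<integral>t. indicator {0..1} t *\<^sub>R (F (pr t) * g' t) \<partial>lborel) = \<i> * (\<integral>w. W w * dbar2 w \<partial>lborel)"
    by (simp add: algebra_simps)
  have "((\<lambda>t. F (pr t) * g' t) has_integral \<i> * (\<integral>w. W w * dbar2 w \<partial>lborel)) {0..1}"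
    using has_integral_lborel_continuous[OF contF] unfolding eq .
  then show ?thesis by (simp add: pr_def)
qed

end

subsection \<open>Functions with a mild singularity\<close>

text \<open>Locally bounded, with gradient O(1 / |w - p|): the largest growth compatible with
  \<open>punctured_test_function\<close>, and stable under products. Nothing is required of the
  value or of continuity at p. The bounds are asked on compact subsets of U, which may contain
  p.\<close>

definition mild_at :: "real \<times> real \<Rightarrow> (real \<times> real) set \<Rightarrow> (real \<times> real \<Rightarrow> complex) \<Rightarrow> bool" where
  "mild_at p U A \<longleftrightarrow> (\<exists>Ax Ay. (\<forall>w\<in>U - {p}. has_partials A (Ax w) (Ay w) w) \<and>
     continuous_on (U - {p}) Ax \<and> continuous_on (U - {p}) Ay \<and>
     (\<forall>K. compact K \<and> K \<subseteq> U \<longrightarrow> (\<exists>B. \<forall>w\<in>K - {p}. norm (A w) \<le> B \<and>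
        norm (Ax w) \<le> B / norm (w - p) \<and> norm (Ay w) \<le> B / norm (w - p))))"

lemma mild_atI:
  assumes "\<And>w. w \<in> U - {p} \<Longrightarrow> has_partials A (Ax w) (Ay w) w"
    and "continuous_on (U - {p}) Ax" "continuous_on (U - {p}) Ay"
    and "\<And>K. compact K \<Longrightarrow> K \<subseteq> U \<Longrightarrow> \<exists>B. \<forall>w\<in>K - {p}. norm (A w) \<le> B \<and>
        norm (Ax w) \<le> B / norm (w - p) \<and> norm (Ay w) \<le> B / norm (w - p)"
  shows "mild_at p U A"
  unfolding mild_at_def using assms by blast

lemma mild_atE:
  assumes "mild_at p U A"
  obtains Ax Ay where "\<And>w. w \<in> U - {p} \<Longrightarrow> has_partials A (Ax w) (Ay w) w"
    and "continuous_on (U - {p}) Ax" "continuous_on (U - {p}) Ay"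
    and "\<And>K. compact K \<Longrightarrow> K \<subseteq> U \<Longrightarrow> \<exists>B\<ge>0. \<forall>w\<in>K - {p}. norm (A w) \<le> B \<and>
        norm (Ax w) \<le> B / norm (w - p) \<and> norm (Ay w) \<le> B / norm (w - p)"
proof -
  obtain Ax Ay where A: "\<forall>w\<in>U - {p}. has_partials A (Ax w) (Ay w) w"
     "continuous_on (U - {p}) Ax" "continuous_on (U - {p}) Ay"
     "\<forall>K. compact K \<and> K \<subseteq> U \<longrightarrow> (\<exists>B. \<forall>w\<in>K - {p}. norm (A w) \<le> B \<and>
        norm (Ax w) \<le> B / norm (w - p) \<and> norm (Ay w) \<le> B / norm (w - p))"
    using assms unfolding mild_at_def by blast
  show ?thesis
  proof (rule that[of Ax Ay])
    fix K assume "compact K" "K \<subseteq> U"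
    then obtain B where B: "\<forall>w\<in>K - {p}. norm (A w) \<le> B \<and>
        norm (Ax w) \<le> B / norm (w - p) \<and> norm (Ay w) \<le> B / norm (w - p)" using A(4) by blast
    have "B / norm (w - p) \<le> max B 0 / norm (w - p)" for w
      by (intro divide_right_mono) auto
    then show "\<exists>B\<ge>0. \<forall>w\<in>K - {p}. norm (A w) \<le> B \<and>
        norm (Ax w) \<le> B / norm (w - p) \<and> norm (Ay w) \<le> B / norm (w - p)"
      using B by (intro exI[of _ "max B 0"]) (meson max.cobounded1 max.cobounded2 order_trans)
  qed (use A in auto)
qed

lemma mild_at_isCont: "mild_at p U A \<Longrightarrow> w \<in> U - {p} \<Longrightarrow> isCont A w"
  by (elim mild_atE) (rule has_partials_isCont)

lemma mild_at_contOn: "mild_at p U A \<Longrightarrow> continuous_on (U - {p}) A"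
  by (meson continuous_at_imp_continuous_on mild_at_isCont)

lemma mild_at_add:
  assumes "mild_at p U A" "mild_at p U B" shows "mild_at p U (\<lambda>w. A w + B w)"
proof -
  from assms(1) obtain Ax Ay where A: "\<And>w. w \<in> U - {p} \<Longrightarrow> has_partials A (Ax w) (Ay w) w"
     "continuous_on (U - {p}) Ax" "continuous_on (U - {p}) Ay"
     "\<And>K. compact K \<Longrightarrow> K \<subseteq> U \<Longrightarrow> \<exists>B\<ge>0. \<forall>w\<in>K - {p}. norm (A w) \<le> B \<and>
        norm (Ax w) \<le> B / norm (w - p) \<and> norm (Ay w) \<le> B / norm (w - p)" by (rule mild_atE) blast
  from assms(2) obtain Bx By where B: "\<And>w. w \<in> U - {p} \<Longrightarrow> has_partials B (Bx w) (By w) w"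
     "continuous_on (U - {p}) Bx" "continuous_on (U - {p}) By"
     "\<And>K. compact K \<Longrightarrow> K \<subseteq> U \<Longrightarrow> \<exists>b\<ge>0. \<forall>w\<in>K - {p}. norm (B w) \<le> b \<and>
        norm (Bx w) \<le> b / norm (w - p) \<and> norm (By w) \<le> b / norm (w - p)" by (rule mild_atE) blast
  show ?thesis
  proof (rule mild_atI[of _ _ _ "\<lambda>w. Ax w + Bx w" "\<lambda>w. Ay w + By w"])
    fix K assume K: "compact K" "K \<subseteq> U"
    obtain a where a: "\<forall>w\<in>K - {p}. norm (A w) \<le> a \<and>
        norm (Ax w) \<le> a / norm (w - p) \<and> norm (Ay w) \<le> a / norm (w - p)" using A(4)[OF K] by blast
    obtain b where b: "\<forall>w\<in>K - {p}. norm (B w) \<le> b \<and>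
        norm (Bx w) \<le> b / norm (w - p) \<and> norm (By w) \<le> b / norm (w - p)" using B(4)[OF K] by blast
    show "\<exists>c. \<forall>w\<in>K - {p}. norm (A w + B w) \<le> c \<and>
        norm (Ax w + Bx w) \<le> c / norm (w - p) \<and> norm (Ay w + By w) \<le> c / norm (w - p)"
    proof (intro exI[of _ "a + b"] ballI conjI)
      fix w assume w: "w \<in> K - {p}"
      show "norm (A w + B w) \<le> a + b" using a b w by (intro norm_triangle_mono) auto
      show "norm (Ax w + Bx w) \<le> (a + b) / norm (w - p)"
        unfolding add_divide_distrib using a b w by (intro norm_triangle_mono) auto
      show "norm (Ay w + By w) \<le> (a + b) / norm (w - p)"
        unfolding add_divide_distrib using a b w by (intro norm_triangle_mono) auto
    qed
  qed (intro has_partials_add A B continuous_intros; assumption)+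
qed

lemma mild_at_mult:
  assumes "mild_at p U A" "mild_at p U B" shows "mild_at p U (\<lambda>w. A w * B w)"
proof -
  from assms(1) obtain Ax Ay where A: "\<And>w. w \<in> U - {p} \<Longrightarrow> has_partials A (Ax w) (Ay w) w"
     "continuous_on (U - {p}) Ax" "continuous_on (U - {p}) Ay"
     "\<And>K. compact K \<Longrightarrow> K \<subseteq> U \<Longrightarrow> \<exists>B\<ge>0. \<forall>w\<in>K - {p}. norm (A w) \<le> B \<and>
        norm (Ax w) \<le> B / norm (w - p) \<and> norm (Ay w) \<le> B / norm (w - p)" by (rule mild_atE) blast
  from assms(2) obtain Bx By where B: "\<And>w. w \<in> U - {p} \<Longrightarrow> has_partials B (Bx w) (By w) w"
     "continuous_on (U - {p}) Bx" "continuous_on (U - {p}) By"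
     "\<And>K. compact K \<Longrightarrow> K \<subseteq> U \<Longrightarrow> \<exists>b\<ge>0. \<forall>w\<in>K - {p}. norm (B w) \<le> b \<and>
        norm (Bx w) \<le> b / norm (w - p) \<and> norm (By w) \<le> b / norm (w - p)" by (rule mild_atE) blast
  show ?thesis
  proof (rule mild_atI[of _ _ _ "\<lambda>w. Ax w * B w + A w * Bx w" "\<lambda>w. Ay w * B w + A w * By w"])
    fix K assume K: "compact K" "K \<subseteq> U"
    obtain a where a: "a \<ge> 0" "\<forall>w\<in>K - {p}. norm (A w) \<le> a \<and>
        norm (Ax w) \<le> a / norm (w - p) \<and> norm (Ay w) \<le> a / norm (w - p)" using A(4)[OF K] by blast
    obtain b where b: "b \<ge> 0" "\<forall>w\<in>K - {p}. norm (B w) \<le> b \<and>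
        norm (Bx w) \<le> b / norm (w - p) \<and> norm (By w) \<le> b / norm (w - p)" using B(4)[OF K] by blast
    show "\<exists>c. \<forall>w\<in>K - {p}. norm (A w * B w) \<le> c \<and>
        norm (Ax w * B w + A w * Bx w) \<le> c / norm (w - p) \<and> norm (Ay w * B w + A w * By w) \<le> c / norm (w - p)"
    \<comment> \<open>Each of the two terms of the product rule is at most a b / |w - p|.\<close>
    proof (intro exI[of _ "2 * (a * b)"] ballI conjI)
      fix w assume w: "w \<in> K - {p}"
      have prod: "norm (u * B w + A w * v) \<le> 2 * (a * b) / norm (w - p)"
        if "norm u \<le> a / norm (w - p)" "norm v \<le> b / norm (w - p)" for u v
      proof -
        have "norm (u * B w) \<le> a / norm (w - p) * b"
          unfolding norm_mult using that a b w by (intro mult_mono) auto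
        moreover have "norm (A w * v) \<le> a * (b / norm (w - p))"
          unfolding norm_mult using that a b w by (intro mult_mono) auto
        ultimately have "norm (u * B w + A w * v) \<le> a / norm (w - p) * b + a * (b / norm (w - p))"
          by (rule norm_triangle_mono)
        then show ?thesis by simp
      qed
      show "norm (Ax w * B w + A w * Bx w) \<le> 2 * (a * b) / norm (w - p)"
        "norm (Ay w * B w + A w * By w) \<le> 2 * (a * b) / norm (w - p)"
        using a b w by (auto intro!: prod)
      have "norm (A w * B w) \<le> a * b"
        using a b w by (auto simp: norm_mult intro!: mult_mono)
      moreover have "0 \<le> a * b" using a b by simp
      ultimately show "norm (A w * B w) \<le> 2 * (a * b)" by linarith
    qed
  next
    show "continuous_on (U - {p}) (\<lambda>w. Ax w * B w + A w * Bx w)"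
      "continuous_on (U - {p}) (\<lambda>w. Ay w * B w + A w * By w)"
      by (intro continuous_intros A B mild_at_contOn assms)+
  qed (intro has_partials_mult A B; assumption)
qed

text \<open>Mildness says nothing about the value at p, so continuity and nonvanishing on all of U
  are assumed in addition: they bound the inverse on a compact set even where it contains p.\<close>

lemma mild_at_inverse:
  assumes "mild_at p U A" and cont: "continuous_on U A" and nz: "\<And>w. w \<in> U \<Longrightarrow> A w \<noteq> 0"
  shows "mild_at p U (\<lambda>w. inverse (A w))"
proof -
  from assms(1) obtain Ax Ay where A: "\<And>w. w \<in> U - {p} \<Longrightarrow> has_partials A (Ax w) (Ay w) w"
     "continuous_on (U - {p}) Ax" "continuous_on (U - {p}) Ay"
     "\<And>K. compact K \<Longrightarrow> K \<subseteq> U \<Longrightarrow> \<exists>B\<ge>0. \<forall>w\<in>K - {p}. norm (A w) \<le> B \<and>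
        norm (Ax w) \<le> B / norm (w - p) \<and> norm (Ay w) \<le> B / norm (w - p)" by (rule mild_atE) blast
  show ?thesis
  proof (rule mild_atI[of _ _ _ "\<lambda>w. - (Ax w * (inverse (A w))\<^sup>2)" "\<lambda>w. - (Ay w * (inverse (A w))\<^sup>2)"])
    fix K assume K: "compact K" "K \<subseteq> U"
    obtain a where a: "a \<ge> 0" "\<forall>w\<in>K - {p}. norm (A w) \<le> a \<and>
        norm (Ax w) \<le> a / norm (w - p) \<and> norm (Ay w) \<le> a / norm (w - p)" using A(4)[OF K] by blast
    have "bounded ((\<lambda>w. inverse (A w)) ` K)"
      using K nz by (intro compact_imp_bounded compact_continuous_image continuous_on_inverse
          continuous_on_subset[OF cont]) auto
    then obtain b0 where b0: "\<And>w. w \<in> K \<Longrightarrow> norm (inverse (A w)) \<le> b0" unfolding bounded_iff by blast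
    define b where "b = max b0 0"
    have b: "b \<ge> 0" "\<And>w. w \<in> K \<Longrightarrow> norm (inverse (A w)) \<le> b" using b0 by (auto simp: b_def max.coboundedI1)
    show "\<exists>c. \<forall>w\<in>K - {p}. norm (inverse (A w)) \<le> c \<and>
        norm (- (Ax w * (inverse (A w))\<^sup>2)) \<le> c / norm (w - p) \<and> norm (- (Ay w * (inverse (A w))\<^sup>2)) \<le> c / norm (w - p)"
    proof (intro exI[of _ "b + a * b\<^sup>2"] ballI conjI)
      fix w assume w: "w \<in> K - {p}"
      have sq: "norm ((inverse (A w))\<^sup>2) \<le> b\<^sup>2"
        unfolding norm_power using b w by (intro power_mono) auto
      have prod: "norm (- (u * (inverse (A w))\<^sup>2)) \<le> (b + a * b\<^sup>2) / norm (w - p)"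
        if "norm u \<le> a / norm (w - p)" for u
      proof -
        have "norm (- (u * (inverse (A w))\<^sup>2)) \<le> a / norm (w - p) * b\<^sup>2"
          unfolding norm_minus_cancel norm_mult using that sq a by (intro mult_mono) auto
        also have "\<dots> \<le> (b + a * b\<^sup>2) / norm (w - p)"
          using b(1) by (simp add: divide_right_mono)
        finally show ?thesis .
      qed
      show "norm (- (Ax w * (inverse (A w))\<^sup>2)) \<le> (b + a * b\<^sup>2) / norm (w - p)"
        "norm (- (Ay w * (inverse (A w))\<^sup>2)) \<le> (b + a * b\<^sup>2) / norm (w - p)"
        using a w by (auto intro!: prod simp del: norm_minus_cancel)
      show "norm (inverse (A w)) \<le> b + a * b\<^sup>2"
        using b(2)[of w] w a(1) by (intro order_trans[OF b(2)]) auto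
    qed
  next
    show "continuous_on (U - {p}) (\<lambda>w. - (Ax w * (inverse (A w))\<^sup>2))"
      "continuous_on (U - {p}) (\<lambda>w. - (Ay w * (inverse (A w))\<^sup>2))"
      using nz by (intro continuous_intros A mild_at_contOn assms(1); auto)+
  qed (use nz in \<open>auto intro!: has_partials_inverse A\<close>)
qed

text \<open>On a compact set both the partials and the distance to p are bounded, and a bounded
  quantity is O(1 / |w - p|) there.\<close>

lemma mild_at_C1:
  assumes A: "\<And>w. w \<in> U \<Longrightarrow> has_partials A (Ax w) (Ay w) w"
    and cont: "continuous_on U Ax" "continuous_on U Ay"
  shows "mild_at p U A"
proof (rule mild_atI[of _ _ _ Ax Ay])
  fix K assume K: "compact K" "K \<subseteq> U"
  have bdd: "bounded (f ` K)" if "continuous_on U f" for f :: "real\<times>real \<Rightarrow> complex"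
    using K that by (intro compact_imp_bounded compact_continuous_image continuous_on_subset[OF that])
  have "continuous_on U A"
    using has_partials_isCont[OF A] by (intro continuous_at_imp_continuous_on) auto
  then obtain a where a: "\<And>w. w \<in> K \<Longrightarrow> norm (A w) \<le> a"
    using bdd[of A] unfolding bounded_iff by blast
  obtain b where b: "\<And>w. w \<in> K \<Longrightarrow> norm (Ax w) \<le> b"
    using bdd[OF cont(1)] unfolding bounded_iff by blast
  obtain c where c: "\<And>w. w \<in> K \<Longrightarrow> norm (Ay w) \<le> c"
    using bdd[OF cont(2)] unfolding bounded_iff by blast
  have "bounded ((\<lambda>w. w - p) ` K)"
    using K by (intro compact_imp_bounded compact_continuous_image continuous_intros)
  then obtain m where m: "\<And>w. w \<in> K \<Longrightarrow> norm (w - p) \<le> m" unfolding bounded_iff by blast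
  have *: "x \<le> (\<bar>a\<bar> + (\<bar>b\<bar> + \<bar>c\<bar>) * \<bar>m\<bar>) / norm (w - p)"
    if w: "w \<in> K - {p}" and x: "x \<le> \<bar>b\<bar> + \<bar>c\<bar>" for x w
  proof -
    have "x * norm (w - p) \<le> (\<bar>b\<bar> + \<bar>c\<bar>) * \<bar>m\<bar>"
      using m[of w] w x by (intro mult_mono) auto
    then have "x * norm (w - p) \<le> \<bar>a\<bar> + (\<bar>b\<bar> + \<bar>c\<bar>) * \<bar>m\<bar>" by linarith
    then show ?thesis using w by (simp add: pos_le_divide_eq)
  qed
  have **: "x \<le> \<bar>a\<bar> + (\<bar>b\<bar> + \<bar>c\<bar>) * \<bar>m\<bar>" if "x \<le> a" for x
  proof -
    have "0 \<le> (\<bar>b\<bar> + \<bar>c\<bar>) * \<bar>m\<bar>" by simp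
    then show ?thesis using that by linarith
  qed
  show "\<exists>B. \<forall>w\<in>K - {p}. norm (A w) \<le> B \<and>
        norm (Ax w) \<le> B / norm (w - p) \<and> norm (Ay w) \<le> B / norm (w - p)"
  proof (intro exI[of _ "\<bar>a\<bar> + (\<bar>b\<bar> + \<bar>c\<bar>) * \<bar>m\<bar>"] ballI conjI)
    fix w assume w: "w \<in> K - {p}"
    show "norm (A w) \<le> \<bar>a\<bar> + (\<bar>b\<bar> + \<bar>c\<bar>) * \<bar>m\<bar>" using a w ** by auto
    have "norm (Ax w) \<le> \<bar>b\<bar> + \<bar>c\<bar>" using b[of w] w by auto
    then show "norm (Ax w) \<le> (\<bar>a\<bar> + (\<bar>b\<bar> + \<bar>c\<bar>) * \<bar>m\<bar>) / norm (w - p)" using * w by blast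
    have "norm (Ay w) \<le> \<bar>b\<bar> + \<bar>c\<bar>" using c[of w] w by auto
    then show "norm (Ay w) \<le> (\<bar>a\<bar> + (\<bar>b\<bar> + \<bar>c\<bar>) * \<bar>m\<bar>) / norm (w - p)" using * w by blast
  qed
qed (use assms in \<open>auto intro: continuous_on_subset\<close>)

lemma mild_at_const: "mild_at p U (\<lambda>_. c)"
  by (rule mild_at_C1[OF has_partials_const]) auto

lemma mild_at_fst: "mild_at p U (\<lambda>w. of_real (fst w))"
  by (rule mild_at_C1[OF has_partials_fst]) auto

lemma mild_at_snd: "mild_at p U (\<lambda>w. of_real (snd w))"
  by (rule mild_at_C1[OF has_partials_snd]) auto

lemma mild_at_minus: "mild_at p U A \<Longrightarrow> mild_at p U (\<lambda>w. - A w)"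
  using mild_at_mult[OF mild_at_const[of p U "-1"]] by simp

lemma mild_at_diff: "mild_at p U A \<Longrightarrow> mild_at p U B \<Longrightarrow> mild_at p U (\<lambda>w. A w - B w)"
  using mild_at_add[of p U A "\<lambda>w. - B w"] mild_at_minus[of p U B] by simp

lemma mild_at_power: "mild_at p U A \<Longrightarrow> mild_at p U (\<lambda>w. A w ^ n)"
  by (induction n) (auto intro: mild_at_const mild_at_mult)

lemma has_partials_norm:
  assumes "w \<noteq> q"
  shows "has_partials (\<lambda>w. of_real (norm (w - q)))
    (of_real ((fst w - fst q) / norm (w - q))) (of_real ((snd w - snd q) / norm (w - q))) w"
proof -
  have pos: "0 < (fst w - fst q)\<^sup>2 + (snd w - snd q)\<^sup>2"
    using assms by (cases w; cases q) (auto simp: sum_power2_gt_zero_iff)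
  have n: "norm (v - q) = sqrt ((fst v - fst q)\<^sup>2 + (snd v - snd q)\<^sup>2)" for v
    by (simp add: norm_prod_def)
  define m where "m = sqrt ((fst w - fst q)\<^sup>2 + (snd w - snd q)\<^sup>2)"
  have m: "m > 0" using pos by (simp add: m_def)
  have "((\<lambda>v. sqrt ((fst v - fst q)\<^sup>2 + (snd v - snd q)\<^sup>2)) has_derivative
      (\<lambda>h. (2 * (fst w - fst q) * fst h + 2 * (snd w - snd q) * snd h) * (inverse m / 2))) (at w)"
    unfolding m_def using pos
    by (auto intro!: derivative_eq_intros simp: field_simps)
  then have "((\<lambda>v. norm (v - q)) has_derivative
      (\<lambda>h. fst h * ((fst w - fst q) / norm (w - q)) + snd h * ((snd w - snd q) / norm (w - q)))) (at w)"
    unfolding n m_def[symmetric]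
    by (rule has_derivative_eq_rhs) (use m in \<open>auto simp: fun_eq_iff field_simps\<close>)
  from has_derivative_of_real[OF this] show ?thesis
    unfolding has_partials_def of_real_add of_real_mult .
qed

lemma abs_coordinate_quotient_le: "\<bar>(fst w - fst q) / norm (w - q)\<bar> \<le> 1" "\<bar>(snd w - snd q) / norm (w - q)\<bar> \<le> 1"
  for w q :: "real \<times> real"
proof -
  have "\<bar>fst (w - q)\<bar> \<le> norm (w - q)" "\<bar>snd (w - q)\<bar> \<le> norm (w - q)"
    by (metis norm_fst_le norm_snd_le prod.collapse real_norm_def)+
  then show "\<bar>(fst w - fst q) / norm (w - q)\<bar> \<le> 1" "\<bar>(snd w - snd q) / norm (w - q)\<bar> \<le> 1"
    by (cases "w = q"; simp add: abs_divide divide_le_eq_1)+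
qed

lemma mild_at_norm_other: "q \<notin> U \<Longrightarrow> mild_at p U (\<lambda>w. of_real (norm (w - q)))"
  by (rule mild_at_C1[OF has_partials_norm]) (auto intro!: continuous_intros)

lemma mild_at_norm: "mild_at p U (\<lambda>w. of_real (norm (w - p)))"
proof (rule mild_atI[OF has_partials_norm])
  fix K assume K: "compact K" "K \<subseteq> U"
  have "bounded ((\<lambda>w. w - p) ` K)"
    using K by (intro compact_imp_bounded compact_continuous_image continuous_intros)
  then obtain m where m: "\<And>w. w \<in> K \<Longrightarrow> norm (w - p) \<le> m" unfolding bounded_iff by blast
  have "1 \<le> m / norm (w - p)" if "w \<in> K - {p}" for w
    using m[of w] that by (simp add: pos_le_divide_eq)
  note * = this
  show "\<exists>B. \<forall>w\<in>K - {p}. norm (complex_of_real (norm (w - p))) \<le> B \<and>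
      norm (complex_of_real ((fst w - fst p) / norm (w - p))) \<le> B / norm (w - p) \<and>
      norm (complex_of_real ((snd w - snd p) / norm (w - p))) \<le> B / norm (w - p)"
  proof (intro exI[of _ m] ballI conjI)
    fix w assume w: "w \<in> K - {p}"
    show "norm (complex_of_real (norm (w - p))) \<le> m" using m w by simp
    show "norm (complex_of_real ((fst w - fst p) / norm (w - p))) \<le> m / norm (w - p)"
      "norm (complex_of_real ((snd w - snd p) / norm (w - p))) \<le> m / norm (w - p)"
      unfolding norm_of_real
      by (rule order_trans[OF abs_coordinate_quotient_le(1) *[OF w]])
        (rule order_trans[OF abs_coordinate_quotient_le(2) *[OF w]])
  qed
qed (auto intro!: continuous_intros)

text \<open>The model case of the notion: a function homogeneous of degree 0 about p, of modulus 1
  and without a limit at p, whose gradient has degree -1.\<close>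

lemma mild_at_direction: "mild_at p U (\<lambda>w. cnj (to_complex (w - p)) * inverse (of_real (norm (w - p))))"
proof -
  define r where "r = (\<lambda>w. complex_of_real (norm (w - p)))"
  define rx where "rx = (\<lambda>w. complex_of_real ((fst w - fst p) / norm (w - p)))"
  define ry where "ry = (\<lambda>w. complex_of_real ((snd w - snd p) / norm (w - p)))"
  define z where "z = (\<lambda>w. cnj (to_complex (w - p)))"
  have z: "has_partials z 1 (-\<i>) w" for w
  proof -
    have "z = (\<lambda>w. (of_real (fst w) - of_real (fst p)) - \<i> * (of_real (snd w) - of_real (snd p)))"
      by (auto simp: z_def complex_eq_iff)
    then show ?thesis
      using has_partials_diff[OF has_partials_diff[OF has_partials_fst has_partials_const]
          has_partials_mult[OF has_partials_const has_partials_diff[OF has_partials_snd has_partials_const]]]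
      by fastforce
  qed
  have r: "has_partials r (rx w) (ry w) w" if "w \<noteq> p" for w
    unfolding r_def rx_def ry_def by (rule has_partials_norm[OF that])
  have zc: "continuous_on S z" for S unfolding z_def by (intro continuous_intros)
  have "mild_at p U (\<lambda>w. z w * inverse (r w))"
  proof (rule mild_atI[of _ _ _ "\<lambda>w. 1 * inverse (r w) + z w * (- (rx w * (inverse (r w))\<^sup>2))"
          "\<lambda>w. -\<i> * inverse (r w) + z w * (- (ry w * (inverse (r w))\<^sup>2))"])
    fix K
    show "\<exists>B. \<forall>w\<in>K - {p}. norm (z w * inverse (r w)) \<le> B \<and>
        norm (1 * inverse (r w) + z w * (- (rx w * (inverse (r w))\<^sup>2))) \<le> B / norm (w - p) \<and>
        norm (-\<i> * inverse (r w) + z w * (- (ry w * (inverse (r w))\<^sup>2))) \<le> B / norm (w - p)"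
    proof (intro exI[of _ 2] ballI conjI)
      fix w assume w: "w \<in> K - {p}"
      define n where "n = norm (w - p)"
      have n: "n > 0" "norm (z w) = n" "norm (r w) = n" using w by (auto simp: n_def z_def r_def simp del: to_complex_simps)
      have *: "norm (u * inverse (r w) + z w * (- (v * (inverse (r w))\<^sup>2))) \<le> 2 / n"
        if "norm u = 1" "norm v \<le> 1" for u v
      proof -
        have "norm (u * inverse (r w)) = 1 / n"
          unfolding norm_mult norm_inverse n(3) that(1) by (simp add: inverse_eq_divide)
        moreover have "norm (z w * (- (v * (inverse (r w))\<^sup>2))) \<le> 1 / n"
        proof -
          have "norm (z w * (- (v * (inverse (r w))\<^sup>2))) = norm v / n"
            unfolding norm_mult norm_minus_cancel norm_power norm_inverse n(2,3)
            using n(1) by (simp add: power2_eq_square field_simps)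
          then show ?thesis using that(2) n(1) by (simp add: divide_right_mono)
        qed
        ultimately have "norm (u * inverse (r w) + z w * (- (v * (inverse (r w))\<^sup>2))) \<le> 1 / n + 1 / n"
          by (intro norm_triangle_mono) auto
        then show ?thesis by simp
      qed
      show "norm (z w * inverse (r w)) \<le> 2" using n by (simp add: norm_mult norm_inverse)
      have "norm (rx w) \<le> 1" "norm (ry w) \<le> 1"
        unfolding rx_def ry_def norm_of_real using abs_coordinate_quotient_le by blast+
      then show "norm (1 * inverse (r w) + z w * (- (rx w * (inverse (r w))\<^sup>2))) \<le> 2 / norm (w - p)"
        "norm (-\<i> * inverse (r w) + z w * (- (ry w * (inverse (r w))\<^sup>2))) \<le> 2 / norm (w - p)"
        unfolding n_def[symmetric] by (intro *; simp)+
    qed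
  next
    fix w assume "w \<in> U - {p}"
    then show "has_partials (\<lambda>w. z w * inverse (r w)) (1 * inverse (r w) + z w * (- (rx w * (inverse (r w))\<^sup>2)))
        (-\<i> * inverse (r w) + z w * (- (ry w * (inverse (r w))\<^sup>2))) w"
      by (intro has_partials_mult z has_partials_inverse r) (auto simp: r_def)
  next
    have "continuous_on (U - {p}) rx" "continuous_on (U - {p}) ry" "continuous_on (U - {p}) r"
      "\<And>w. w \<in> U - {p} \<Longrightarrow> r w \<noteq> 0"
      unfolding rx_def ry_def r_def by (intro continuous_intros; simp)+ auto
    then show "continuous_on (U - {p}) (\<lambda>w. 1 * inverse (r w) + z w * (- (rx w * (inverse (r w))\<^sup>2)))"
      "continuous_on (U - {p}) (\<lambda>w. -\<i> * inverse (r w) + z w * (- (ry w * (inverse (r w))\<^sup>2)))"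
      by (intro continuous_intros zc; auto)+
  qed
  then show ?thesis by (simp add: z_def r_def)
qed

section \<open>Cutoff functions of class C1 and extension by zero\<close>

lemma has_real_derivative_max_0_power2:
  "((\<lambda>x. (max 0 x)\<^sup>2) has_real_derivative 2 * max 0 x) (at (x::real))"
proof -
  consider "x > 0" | "x < 0" | "x = 0" by linarith
  then show ?thesis
  proof cases
    case 1
    have "((\<lambda>x. x\<^sup>2) has_real_derivative 2 * max 0 x) (at x)"
      using 1 by (auto intro!: derivative_eq_intros)
    then show ?thesis
      by (rule has_field_derivative_transform_within_open[of _ _ _ "{0<..}"]) (use 1 in auto)
  next
    case 2
    have "((\<lambda>x. 0) has_real_derivative 2 * max 0 x) (at x)"
      using 2 by auto
    then show ?thesis
      by (rule has_field_derivative_transform_within_open[of _ _ _ "{..<0}"]) (use 2 in auto)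
  next
    case 3
    have "((\<lambda>h. (max 0 h)\<^sup>2 / h) \<longlongrightarrow> 0) (at (0::real))"
    proof (rule Lim_null_comparison[of _ "\<lambda>h. \<bar>h\<bar>"])
      show "\<forall>\<^sub>F h in at (0::real). norm ((max 0 h)\<^sup>2 / h) \<le> \<bar>h\<bar>"
        by (intro always_eventually) (auto simp: max_def power2_eq_square)
      show "((\<lambda>h. \<bar>h\<bar>) \<longlongrightarrow> 0) (at (0::real))"
        using tendsto_rabs[OF tendsto_ident_at[of "0::real" UNIV]] by simp
    qed
    then show ?thesis using 3 by (simp add: DERIV_def)
  qed
qed

text \<open>Squared positive parts are C1, with derivative 0 at the joint. Nesting two of them makes
  the function flat at both ends of [0, 1], where it equals 1 - (1 - s^2)^2.\<close>

definition smooth_step :: "real \<Rightarrow> real" where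
  "smooth_step s = 1 - (max 0 (1 - (max 0 s)\<^sup>2))\<^sup>2"

lemma smooth_step_0: "s \<le> 0 \<Longrightarrow> smooth_step s = 0"
  by (simp add: smooth_step_def)

lemma smooth_step_1: "1 \<le> s \<Longrightarrow> smooth_step s = 1"
  using one_le_power[of s 2] by (simp add: smooth_step_def max_absorb2 max_absorb1)

lemma smooth_step_deriv:
  "(smooth_step has_real_derivative 4 * max 0 (1 - (max 0 s)\<^sup>2) * max 0 s) (at s)"
proof -
  have "((\<lambda>s. 1 - (max 0 s)\<^sup>2) has_real_derivative 0 - 2 * max 0 s) (at s)"
    by (intro DERIV_diff DERIV_const has_real_derivative_max_0_power2)
  from DERIV_chain2[OF has_real_derivative_max_0_power2 this]
  have "((\<lambda>s. 1 - (max 0 (1 - (max 0 s)\<^sup>2))\<^sup>2) has_real_derivative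
      0 - 2 * max 0 (1 - (max 0 s)\<^sup>2) * (0 - 2 * max 0 s)) (at s)"
    by (intro DERIV_diff DERIV_const)
  then show ?thesis by (simp add: smooth_step_def[abs_def] mult.assoc)
qed

lemma C1_ball_bump:
  fixes c :: "real \<times> real"
  assumes "\<rho> > 0"
  obtains \<beta> where "\<And>p V. mild_at p V \<beta>" "\<And>w. w \<in> ball c (\<rho> / 2) \<Longrightarrow> \<beta> w = 1"
    "\<And>w. w \<notin> cball c \<rho> \<Longrightarrow> \<beta> w = 0"
proof -
  \<comment> \<open>With this factor \<sigma> = 2 - 2 (dist / \<rho>)^2 is at least 3/2 on the ball
    of half the radius and at most 0 outside radius \<rho>, so the step function is saturated in
    both places. The squared distance keeps \<sigma> smooth at the centre.\<close>
  define k where "k = 2 / \<rho>\<^sup>2"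
  define \<sigma> where "\<sigma> = (\<lambda>w::real\<times>real. 2 - k * ((fst w - fst c)\<^sup>2 + (snd w - snd c)\<^sup>2))"
  define D where "D = (\<lambda>w. 4 * max 0 (1 - (max 0 (\<sigma> w))\<^sup>2) * max 0 (\<sigma> w))"
  have \<sigma>: "\<sigma> w = 2 - k * (dist c w)\<^sup>2" for w
    unfolding \<sigma>_def by (simp add: dist_prod_def dist_real_def power2_commute)
  have contD: "continuous_on UNIV D"
    unfolding D_def \<sigma>_def by (intro continuous_intros)
  have p: "has_partials (\<lambda>w. of_real (smooth_step (\<sigma> w)))
      (of_real (D w * (- k * (2 * (fst w - fst c))))) (of_real (D w * (- k * (2 * (snd w - snd c))))) w" for w
  proof -
    have "(\<sigma> has_derivative (\<lambda>h. fst h * (- k * (2 * (fst w - fst c))) + snd h * (- k * (2 * (snd w - snd c))))) (at w)"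
      unfolding \<sigma>_def by (auto intro!: derivative_eq_intros simp: algebra_simps)
    from has_derivative_of_real[OF has_derivative_compose[OF this smooth_step_deriv[unfolded has_field_derivative_def]]]
    show ?thesis
      unfolding has_partials_def
      by (rule has_derivative_eq_rhs) (simp add: fun_eq_iff D_def algebra_simps)
  qed
  show ?thesis
  proof (rule that[of "\<lambda>w. of_real (smooth_step (\<sigma> w))"])
    fix q V
    show "mild_at q V (\<lambda>w. of_real (smooth_step (\<sigma> w)))"
      by (rule mild_at_C1[OF p]) (intro continuous_intros continuous_on_subset[OF contD]; simp)+
  next
    fix w assume "w \<in> ball c (\<rho> / 2)"
    then have "(dist c w)\<^sup>2 \<le> (\<rho> / 2)\<^sup>2" by (intro power_mono) auto
    moreover have "(\<rho> / 2)\<^sup>2 = \<rho>\<^sup>2 / 4" by (simp add: power_divide)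
    ultimately have "2 * (dist c w)\<^sup>2 \<le> \<rho>\<^sup>2"
      using zero_le_power2[of "dist c w"] by linarith
    then have "1 \<le> \<sigma> w" unfolding \<sigma> k_def using assms by (simp add: field_simps power2_eq_square)
    then show "complex_of_real (smooth_step (\<sigma> w)) = 1" by (simp add: smooth_step_1)
  next
    fix w assume "w \<notin> cball c \<rho>"
    then have "\<rho>\<^sup>2 \<le> (dist c w)\<^sup>2" using assms by (intro power_mono) auto
    then have "\<sigma> w \<le> 0" unfolding \<sigma> k_def using assms by (simp add: field_simps power2_eq_square)
    then show "complex_of_real (smooth_step (\<sigma> w)) = 0" by (simp add: smooth_step_0)
  qed
qed

text \<open>A finite cover of \<open>K\<close> by half-size balls reduces this to the bump for one
  ball. Mildness at every p and on every V lets the result be multiplied with a function that is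
  mild at any prescribed point.\<close>

lemma C1_compact_bump:
  fixes K U :: "(real \<times> real) set"
  assumes "compact K" "open U" "K \<subseteq> U"
  obtains \<phi> S where "\<And>p V. mild_at p V \<phi>" "\<And>w. w \<in> K \<Longrightarrow> \<phi> w = 1"
    "compact S" "S \<subseteq> U" "\<And>w. w \<notin> S \<Longrightarrow> \<phi> w = 0"
proof -
  have "\<forall>c\<in>K. \<exists>\<rho>>0. cball c \<rho> \<subseteq> U"
    using assms by (meson open_contains_cball subsetD)
  then obtain \<rho> where \<rho>: "\<And>c. c \<in> K \<Longrightarrow> \<rho> c > 0 \<and> cball c (\<rho> c) \<subseteq> U" by metis
  obtain C where C: "C \<subseteq> K" "finite C" "K \<subseteq> (\<Union>c\<in>C. ball c (\<rho> c / 2))"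
  proof (rule compactE_image[OF assms(1), of K "\<lambda>c. ball c (\<rho> c / 2)"])
    show "K \<subseteq> (\<Union>c\<in>K. ball c (\<rho> c / 2))"
      using \<rho> by force
  qed auto
  have "\<exists>\<phi>. (\<forall>p V. mild_at p V \<phi>) \<and> (\<forall>w \<in> (\<Union>c\<in>C. ball c (\<rho> c / 2)). \<phi> w = 1) \<and>
     (\<forall>w. w \<notin> (\<Union>c\<in>C. cball c (\<rho> c)) \<longrightarrow> \<phi> w = 0)"
    using C(2,1)
  proof (induction C rule: finite_induct)
    case empty
    show ?case by (rule exI[of _ "\<lambda>_. 0"]) (auto intro: mild_at_const)
  next
    case (insert c C)
    have "C \<subseteq> K" using insert.prems by simp
    from insert.IH[OF this] obtain \<phi> where \<phi>: "\<And>p V. mild_at p V \<phi>" "\<And>w. w \<in> (\<Union>c\<in>C. ball c (\<rho> c / 2)) \<Longrightarrow> \<phi> w = 1"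
      "\<And>w. w \<notin> (\<Union>c\<in>C. cball c (\<rho> c)) \<Longrightarrow> \<phi> w = 0" by blast
    have "\<rho> c > 0" using \<rho> insert.prems by auto
    then obtain \<beta> where \<beta>: "\<And>p V. mild_at p V \<beta>" "\<And>w. w \<in> ball c (\<rho> c / 2) \<Longrightarrow> \<beta> w = 1"
      "\<And>w. w \<notin> cball c (\<rho> c) \<Longrightarrow> \<beta> w = 0" using C1_ball_bump by blast
    show ?case
    \<comment> \<open>This combination equals 1 wherever one of the two factors \<phi>, \<beta> is
      1, and 0 wherever both are 0.\<close>
    proof (intro exI[of _ "\<lambda>w. 1 - (1 - \<phi> w) * (1 - \<beta> w)"] conjI allI ballI impI)
      show "mild_at p V (\<lambda>w. 1 - (1 - \<phi> w) * (1 - \<beta> w))" for p V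
        by (intro mild_at_diff mild_at_mult mild_at_const \<phi> \<beta>)
    next
      fix w assume "w \<in> (\<Union>c\<in>insert c C. ball c (\<rho> c / 2))"
      then show "1 - (1 - \<phi> w) * (1 - \<beta> w) = 1" using \<phi>(2)[of w] \<beta>(2)[of w] by auto
    next
      fix w assume "w \<notin> (\<Union>c\<in>insert c C. cball c (\<rho> c))"
      then show "1 - (1 - \<phi> w) * (1 - \<beta> w) = 0" using \<phi>(3)[of w] \<beta>(3)[of w] by auto
    qed
  qed
  then obtain \<phi> where \<phi>: "\<And>p V. mild_at p V \<phi>" "\<And>w. w \<in> (\<Union>c\<in>C. ball c (\<rho> c / 2)) \<Longrightarrow> \<phi> w = 1"
      "\<And>w. w \<notin> (\<Union>c\<in>C. cball c (\<rho> c)) \<Longrightarrow> \<phi> w = 0" by blast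
  show ?thesis
  proof (rule that[of \<phi> "\<Union>c\<in>C. cball c (\<rho> c)"])
    show "compact (\<Union>c\<in>C. cball c (\<rho> c))" using C by (intro compact_UN) auto
    show "(\<Union>c\<in>C. cball c (\<rho> c)) \<subseteq> U" using \<rho> C by blast
    show "\<phi> w = 1" if "w \<in> K" for w using \<phi>(2) C(3) that by blast
  qed (use \<phi> in auto)
qed

lemma mild_at_extend:
  fixes K U :: "(real \<times> real) set"
  assumes A: "mild_at p U A" and U: "open U" and K: "compact K" "K \<subseteq> U"
  obtains F Fx Fy S B where "punctured_test_function F Fx Fy p S B" "\<And>w. w \<in> K \<Longrightarrow> F w = A w"
proof -
  obtain \<phi> S where \<phi>: "\<And>p V. mild_at p V \<phi>" "\<And>w. w \<in> K \<Longrightarrow> \<phi> w = 1"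
    and S: "compact S" "S \<subseteq> U" "\<And>w. w \<notin> S \<Longrightarrow> \<phi> w = 0"
    using C1_compact_bump[OF K(1) U K(2)] by blast
  have "mild_at p U (\<lambda>w. \<phi> w * A w)" by (intro mild_at_mult \<phi> A)
  then obtain Gx Gy where G: "\<And>w. w \<in> U - {p} \<Longrightarrow> has_partials (\<lambda>w. \<phi> w * A w) (Gx w) (Gy w) w"
    "continuous_on (U - {p}) Gx" "continuous_on (U - {p}) Gy"
    "\<And>K. compact K \<Longrightarrow> K \<subseteq> U \<Longrightarrow> \<exists>B\<ge>0. \<forall>w\<in>K - {p}. norm (\<phi> w * A w) \<le> B \<and>
        norm (Gx w) \<le> B / norm (w - p) \<and> norm (Gy w) \<le> B / norm (w - p)" by (rule mild_atE) blast
  obtain B where B: "B \<ge> 0" "\<And>w. w \<in> S - {p} \<Longrightarrow> norm (\<phi> w * A w) \<le> B \<and>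
        norm (Gx w) \<le> B / norm (w - p) \<and> norm (Gy w) \<le> B / norm (w - p)" using G(4)[OF S(1,2)] by blast
  define F where "F = (\<lambda>w. \<phi> w * A w)"
  \<comment> \<open>The partials are set to 0 at p as well as off U: the bound required at p reads B
    / 0 = 0.\<close>
  define Fx where "Fx = (\<lambda>w. if w \<in> U - {p} then Gx w else 0)"
  define Fy where "Fy = (\<lambda>w. if w \<in> U - {p} then Gy w else 0)"
  \<comment> \<open>The bound \<open>B\<close> holds only off p; the second summand covers the
    unconstrained value F p.\<close>
  define B' where "B' = B + norm (F p)"
  have openS: "open (- S)" using S(1) compact_imp_closed by blast
  have F0: "F w = 0" if "w \<notin> S" for w using S(3)[OF that] by (simp add: F_def)
  have zero: "has_partials F 0 0 w" if "w \<notin> S" for w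
    using that F0 by (intro has_partials_transform[OF has_partials_const[of 0] openS]) auto
  \<comment> \<open>F vanishes identically on the open complement of S, so uniqueness of the
    derivative forces the partials to vanish there.\<close>
  have G0: "Gx w = 0 \<and> Gy w = 0" if "w \<in> U - {p}" "w \<notin> S" for w
    using has_partials_unique[OF G(1)[OF that(1), folded F_def] zero[OF that(2)]] by simp
  have F0': "Fx w = 0 \<and> Fy w = 0" if "w \<notin> S" for w using G0 that by (auto simp: Fx_def Fy_def)
  have partials: "has_partials F (Fx w) (Fy w) w" if "w \<noteq> p" for w
  proof (cases "w \<in> S")
    case True
    then show ?thesis using G(1)[of w] that S(2) by (auto simp: Fx_def Fy_def F_def)
  next
    case False
    then show ?thesis using zero[OF False] F0'[OF False] by simp
  qed
  have cov: "- {p} = (U - {p}) \<union> (- S - {p})" using S(2) by auto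
  have cont: "continuous_on (- {p}) H" if "continuous_on (U - {p}) H" "\<And>w. w \<notin> S \<Longrightarrow> H w = 0"
    for H :: "real\<times>real \<Rightarrow> complex"
    unfolding cov
  proof (rule continuous_on_open_Un)
    show "continuous_on (- S - {p}) H"
      using continuous_on_const[of "- S - {p}" 0] by (rule continuous_on_eq) (use that(2) in auto)
  qed (use that U openS in \<open>auto intro: open_Diff\<close>)
  show ?thesis
  proof (rule that[of F Fx Fy S B'])
    show "punctured_test_function F Fx Fy p S B'"
    proof
      show "continuous_on (- {p}) Fx"
        by (rule cont[OF continuous_on_eq[OF G(2)]]) (use F0' in \<open>auto simp: Fx_def\<close>)
      show "continuous_on (- {p}) Fy"
        by (rule cont[OF continuous_on_eq[OF G(3)]]) (use F0' in \<open>auto simp: Fy_def\<close>)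
      fix w
      have le: "B \<le> B'" by (simp add: B'_def)
      show "norm (F w) \<le> B'"
      proof (cases "w \<in> S - {p}")
        case True
        then show ?thesis using B(2)[of w] le by (simp add: F_def)
      next
        case False
        then have "w = p \<or> F w = 0" using F0[of w] by blast
        then show ?thesis using B(1) by (auto simp: B'_def)
      qed
      have bd: "norm (Fx w) \<le> B / norm (w - p) \<and> norm (Fy w) \<le> B / norm (w - p)"
      proof (cases "w \<in> S - {p}")
        case True
        then show ?thesis using B(2)[of w] S(2) by (auto simp: Fx_def Fy_def)
      next
        case False
        then have "Fx w = 0 \<and> Fy w = 0" using F0'[of w] by (cases "w = p") (simp_all add: Fx_def Fy_def)
        then show ?thesis using B(1) by simp
      qed
      have "B / norm (w - p) \<le> B' / norm (w - p)" using le by (intro divide_right_mono) auto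
      with bd show "norm (Fx w) \<le> B' / norm (w - p)" "norm (Fy w) \<le> B' / norm (w - p)" by linarith+
    qed (use partials F0 F0' S in auto)
  qed (use \<phi> in \<open>auto simp: F_def\<close>)
qed

subsection \<open>The logarithmic gradient near the primary\<close>

text \<open>\<open>inside\<close> is defined by boundedness of connected components of the
  complement. The identification is a homeomorphism, which matches the components, and preserves
  norms, which matches their boundedness.\<close>

lemma inside_to_complex_image: "inside (to_complex ` S) = to_complex ` inside S"
proof -
  define of_complex where "of_complex = (\<lambda>z. (Re z, Im z))"
  have inv: "of_complex (to_complex w) = w" "to_complex (of_complex z) = z" for w z
    by (auto simp: of_complex_def complex_eq_iff)
  have inj: "inj to_complex" by (rule injI) simp
  have surj: "surj to_complex" by (rule surjI[of _ of_complex]) (rule inv(2))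
  have cont: "continuous_on X to_complex" "continuous_on Y of_complex" for X Y
    unfolding of_complex_def by (intro continuous_intros)+
  have image_image_inv: "of_complex ` to_complex ` A = A" for A
    by (simp add: image_image inv)
  have comp: "- (to_complex ` S) = to_complex ` (- S)"
    using inj surj by (simp add: bij_image_Compl_eq bij_def)
  have 1: "connected_component (to_complex ` A) (to_complex x) (to_complex y)" if cc: "connected_component A x y" for A x y
  proof -
    obtain T where T: "connected T" "T \<subseteq> A" "x \<in> T" "y \<in> T"
      using cc unfolding connected_component_def by blast
    show ?thesis
      unfolding connected_component_def
    proof (intro exI[of _ "to_complex ` T"] conjI)
      show "connected (to_complex ` T)" by (rule connected_continuous_image[OF cont(1) T(1)])
    qed (use T in auto)
  qed
  have 2: "connected_component A x y" if cc: "connected_component (to_complex ` A) (to_complex x) (to_complex y)" for A x y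
  proof -
    obtain T where T: "connected T" "T \<subseteq> to_complex ` A" "to_complex x \<in> T" "to_complex y \<in> T"
      using cc unfolding connected_component_def by blast
    show ?thesis
      unfolding connected_component_def
    proof (intro exI[of _ "of_complex ` T"] conjI)
      show "connected (of_complex ` T)" by (rule connected_continuous_image[OF cont(2) T(1)])
      show "of_complex ` T \<subseteq> A" using image_mono[OF T(2), of of_complex] by (simp only: image_image_inv)
      show "x \<in> of_complex ` T" "y \<in> of_complex ` T"
        using imageI[OF T(3), of of_complex] imageI[OF T(4), of of_complex] by (simp_all only: inv)
    qed
  qed
  have comps: "connected_component_set (- (to_complex ` S)) (to_complex x) = to_complex ` connected_component_set (- S) x" for x
  proof (rule set_eqI)
    fix z
    obtain y where z: "z = to_complex y" using inv(2)[of z] by (rule that[OF sym])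
    show "z \<in> connected_component_set (- (to_complex ` S)) (to_complex x) \<longleftrightarrow> z \<in> to_complex ` connected_component_set (- S) x"
      unfolding comp z inj_image_mem_iff[OF inj] mem_Collect_eq by (rule iffI[OF 2 1])
  qed
  have bdd: "bounded (to_complex ` A) \<longleftrightarrow> bounded A" for A
    by (simp add: bounded_iff)
  show ?thesis
  proof (rule set_eqI)
    fix z
    obtain x where z: "z = to_complex x" using inv(2)[of z] by (rule that[OF sym])
    show "z \<in> inside (to_complex ` S) \<longleftrightarrow> z \<in> to_complex ` inside S"
      unfolding z inj_image_mem_iff[OF inj] inside_def mem_Collect_eq comps bdd ..
  qed
qed

lemma of_real_partials:
  assumes "has_partials (\<lambda>w. complex_of_real (f w)) ax ay (a, b)"
  shows "((\<lambda>x. f (x, b)) has_real_derivative Re ax) (at a)" "((\<lambda>y. f (a, y)) has_real_derivative Re ay) (at b)"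
  using has_partials_x[OF assms] has_partials_y[OF assms]
  by (auto simp: has_vector_derivative_complex_iff)

text \<open>The factor 2 is the one in h = 2 \<omega> - C; it cancels the 1/2 of the square root, so
  that \<nabla> ln f = \<nabla>\<omega> / h.\<close>

lemma DERIV_ln_sqrt:
  fixes h :: "real \<Rightarrow> real"
  assumes "(h has_real_derivative 2 * d) (at t)" "0 < h t"
  shows "((\<lambda>x. ln (sqrt (h x))) has_real_derivative d / h t) (at t)"
proof -
  note sqrt = DERIV_chain2[where f = sqrt and g = h, OF DERIV_real_sqrt[OF assms(2)] assms(1)]
  have "0 < sqrt (h t)" using assms(2) by simp
  from DERIV_chain2[where f = ln and g = "\<lambda>x. sqrt (h x)", OF DERIV_ln[OF this] sqrt]
  have "((\<lambda>x. ln (sqrt (h x))) has_real_derivative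
      inverse (sqrt (h t)) * (inverse (sqrt (h t)) / 2 * (2 * d))) (at t)" .
  moreover have "inverse r * (inverse r / 2 * (2 * d)) = d / (r * r)" for r :: real
    by (cases "r = 0") (simp_all add: field_simps)
  moreover have "sqrt (h t) * sqrt (h t) = h t" using assms(2) by simp
  ultimately show ?thesis by (simp only:)
qed

section \<open>The potential at a fixed energy level and its logarithmic gradient\<close>

locale crtbp_level =
  fixes \<mu> C :: real
  assumes mu: "0 < \<mu>" "\<mu> < 1"
begin

abbreviation (input) "p \<equiv> primary1 \<mu>"
abbreviation (input) "q \<equiv> primary2 \<mu>"

lemma omega_norm: "omega \<mu> w = (norm w)\<^sup>2 / 2 + (1 - \<mu>) / norm (w - p) + \<mu> / norm (w - q)"
  by (cases w) (simp add: omega_def primary1_def primary2_def norm_prod_def algebra_simps)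

definition om_x :: "real \<times> real \<Rightarrow> real" where
  "om_x w = fst w - (1 - \<mu>) * (fst w - fst p) / norm (w - p) ^ 3 - \<mu> * (fst w - fst q) / norm (w - q) ^ 3"

definition om_y :: "real \<times> real \<Rightarrow> real" where
  "om_y w = snd w - (1 - \<mu>) * (snd w - snd p) / norm (w - p) ^ 3 - \<mu> * (snd w - snd q) / norm (w - q) ^ 3"

lemma omega_partials:
  assumes "w \<noteq> p" "w \<noteq> q"
  shows "has_partials (\<lambda>w. complex_of_real (omega \<mu> w)) (of_real (om_x w)) (of_real (om_y w)) w"
proof -
  define X where "X = (\<lambda>w::real\<times>real. complex_of_real (fst w))"
  define Y where "Y = (\<lambda>w::real\<times>real. complex_of_real (snd w))"
  define r where "r = (\<lambda>w. complex_of_real (norm (w - p)))"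
  define s where "s = (\<lambda>w. complex_of_real (norm (w - q)))"
  have nz: "norm (w - p) \<noteq> 0" "norm (w - q) \<noteq> 0" "r w \<noteq> 0" "s w \<noteq> 0" using assms by (auto simp: r_def s_def)
  have eq: "(\<lambda>w. complex_of_real (omega \<mu> w)) = (\<lambda>w. (1/2) * (X w * X w + Y w * Y w) + (of_real (1 - \<mu>) * inverse (r w) + of_real \<mu> * inverse (s w)))"
    by (auto simp: omega_norm X_def Y_def r_def s_def norm_prod_def power2_eq_square field_simps)
  have X: "has_partials X 1 0 w" and Y: "has_partials Y 0 1 w"
    unfolding X_def Y_def by (rule has_partials_fst has_partials_snd)+
  note r = has_partials_norm[OF assms(1), folded r_def]
  note s = has_partials_norm[OF assms(2), folded s_def]
  have "has_partials (\<lambda>w. complex_of_real (omega \<mu> w))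
     ((0 * (X w * X w + Y w * Y w) + (1/2) * ((1 * X w + X w * 1) + (0 * Y w + Y w * 0)))
       + ((0 * inverse (r w) + of_real (1 - \<mu>) * (- (of_real ((fst w - fst p) / norm (w - p)) * (inverse (r w))\<^sup>2)))
         + (0 * inverse (s w) + of_real \<mu> * (- (of_real ((fst w - fst q) / norm (w - q)) * (inverse (s w))\<^sup>2)))))
     ((0 * (X w * X w + Y w * Y w) + (1/2) * ((0 * X w + X w * 0) + (1 * Y w + Y w * 1)))
       + ((0 * inverse (r w) + of_real (1 - \<mu>) * (- (of_real ((snd w - snd p) / norm (w - p)) * (inverse (r w))\<^sup>2)))
         + (0 * inverse (s w) + of_real \<mu> * (- (of_real ((snd w - snd q) / norm (w - q)) * (inverse (s w))\<^sup>2))))) w"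
    unfolding eq
    by (intro has_partials_add has_partials_mult has_partials_const has_partials_inverse X Y r s nz)
  moreover have "((0 * (X w * X w + Y w * Y w) + (1/2) * ((1 * X w + X w * 1) + (0 * Y w + Y w * 0)))
       + ((0 * inverse (r w) + of_real (1 - \<mu>) * (- (of_real ((fst w - fst p) / norm (w - p)) * (inverse (r w))\<^sup>2)))
         + (0 * inverse (s w) + of_real \<mu> * (- (of_real ((fst w - fst q) / norm (w - q)) * (inverse (s w))\<^sup>2))))) = of_real (om_x w)"
    using nz by (simp add: om_x_def X_def r_def s_def inverse_eq_divide power2_eq_square power3_eq_cube mult.assoc)
  moreover have "((0 * (X w * X w + Y w * Y w) + (1/2) * ((0 * X w + X w * 0) + (1 * Y w + Y w * 1)))
       + ((0 * inverse (r w) + of_real (1 - \<mu>) * (- (of_real ((snd w - snd p) / norm (w - p)) * (inverse (r w))\<^sup>2)))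
         + (0 * inverse (s w) + of_real \<mu> * (- (of_real ((snd w - snd q) / norm (w - q)) * (inverse (s w))\<^sup>2))))) = of_real (om_y w)"
    using nz by (simp add: om_y_def Y_def r_def s_def inverse_eq_divide power2_eq_square power3_eq_cube mult.assoc)
  ultimately show ?thesis by simp
qed

lemma partial_omega:
  assumes "w \<noteq> p" "w \<noteq> q"
  shows "partial1 (omega \<mu>) w = om_x w" "partial2 (omega \<mu>) w = om_y w"
proof -
  obtain a b where w: "w = (a, b)" by (cases w)
  note D = of_real_partials[OF omega_partials[OF assms, unfolded w], folded w]
  show "partial1 (omega \<mu>) w = om_x w" "partial2 (omega \<mu>) w = om_y w"
    using DERIV_imp_deriv[OF D(1)] DERIV_imp_deriv[OF D(2)] by (simp_all add: partial1_def partial2_def w)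
qed

definition lnf :: "real \<times> real \<Rightarrow> real" where
  "lnf w = ln (sqrt (2 * omega \<mu> w - C))"

text \<open>In complex notation this is \<open>2 \<partial>\<^sub>z ln f\<close>, the conjugate of the gradient of \<open>ln f\<close>.\<close>

definition grad_lnf :: "real \<times> real \<Rightarrow> complex" where
  "grad_lnf w = (of_real (om_x w) - \<i> * of_real (om_y w)) / of_real (2 * omega \<mu> w - C)"

lemma partial_lnf:
  assumes "w \<noteq> p" "w \<noteq> q" "0 < 2 * omega \<mu> w - C"
  shows "partial1 lnf w = Re (grad_lnf w)" "partial2 lnf w = - Im (grad_lnf w)"
proof -
  obtain a b where w: "w = (a, b)" by (cases w)
  note D = of_real_partials[OF omega_partials[OF assms(1,2), unfolded w], folded w]
  have "((\<lambda>x. lnf (x, b)) has_real_derivative om_x w / (2 * omega \<mu> w - C)) (at a)"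
    unfolding lnf_def w
  proof (rule DERIV_ln_sqrt)
    show "((\<lambda>x. 2 * omega \<mu> (x, b) - C) has_real_derivative 2 * om_x (a, b)) (at a)"
      using DERIV_diff[OF DERIV_cmult[OF D(1), of 2] DERIV_const[of C]] by (simp add: w)
  qed (use assms(3) w in simp)
  from DERIV_imp_deriv[OF this] show "partial1 lnf w = Re (grad_lnf w)"
    unfolding w partial1_def prod.case by (simp add: grad_lnf_def)
  have "((\<lambda>y. lnf (a, y)) has_real_derivative om_y w / (2 * omega \<mu> w - C)) (at b)"
    unfolding lnf_def w
  proof (rule DERIV_ln_sqrt)
    show "((\<lambda>y. 2 * omega \<mu> (a, y) - C) has_real_derivative 2 * om_y (a, b)) (at b)"
      using DERIV_diff[OF DERIV_cmult[OF D(2), of 2] DERIV_const[of C]] by (simp add: w)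
  qed (use assms(3) w in simp)
  from DERIV_imp_deriv[OF this] show "partial2 lnf w = - Im (grad_lnf w)"
    unfolding w partial2_def prod.case by (simp add: grad_lnf_def)
qed

text \<open>With u = ln f and \<open>grad_lnf\<close> = u_x - \<i> u_y, the Laplacian is Re Px - Im
  Py. The first derivatives agree with \<open>grad_lnf\<close> only where f is defined and positive;
  the open set V carries this identity over to nearby points on both lines through w, so that it can
  be differentiated.\<close>

lemma laplacian_lnf:
  assumes V: "open V" "w \<in> V" and reg: "\<And>v. v \<in> V \<Longrightarrow> v \<noteq> p \<and> v \<noteq> q \<and> 0 < 2 * omega \<mu> v - C"
    and P: "has_partials grad_lnf Px Py w"
  shows "laplacian lnf w = Re (Px + \<i> * Py)"
proof -
  obtain a b where w: "w = (a, b)" by (cases w)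
  have "((\<lambda>x. Re (grad_lnf (x, b))) has_real_derivative Re Px) (at a)"
    using has_partials_x[OF P[unfolded w]] by (simp add: has_vector_derivative_complex_iff)
  then have 1: "((\<lambda>x. partial1 lnf (x, b)) has_real_derivative Re Px) (at a)"
  proof (rule has_field_derivative_transform_within_open)
    show "open {x. (x, b) \<in> V}"
    proof -
      have "open ((\<lambda>x. (x, b)) -` V)" by (intro open_vimage V continuous_intros)
      then show ?thesis by (simp add: vimage_def)
    qed
  qed (use V w partial_lnf(1) reg in auto)
  have "((\<lambda>y. - Im (grad_lnf (a, y))) has_real_derivative - Im Py) (at b)"
    using has_partials_y[OF P[unfolded w]] by (auto simp: has_vector_derivative_complex_iff intro: DERIV_minus)
  then have 2: "((\<lambda>y. partial2 lnf (a, y)) has_real_derivative - Im Py) (at b)"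
  proof (rule has_field_derivative_transform_within_open)
    show "open {y. (a, y) \<in> V}"
    proof -
      have "open ((\<lambda>y. (a, y)) -` V)" by (intro open_vimage V continuous_intros)
      then show ?thesis by (simp add: vimage_def)
    qed
  qed (use V w partial_lnf(2) reg in auto)
  show ?thesis
    using DERIV_imp_deriv[OF 1] DERIV_imp_deriv[OF 2]
    unfolding laplacian_def w partial1_def[of "partial1 lnf"] partial2_def[of "partial2 lnf"] prod.case by simp
qed

text \<open>Clearing the denominator \<open>\<bar>w - p\<bar>\<close> from \<open>2 \<omega> - C\<close> gives a function that stays positive at
  the primary \<open>p\<close>.\<close>

definition cleared :: "real \<times> real \<Rightarrow> real" where
  "cleared w = 2 * (1 - \<mu>) + norm (w - p) * ((norm w)\<^sup>2 + 2 * \<mu> / norm (w - q) - C)"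

lemma cleared_eq: "w \<noteq> p \<Longrightarrow> cleared w = norm (w - p) * (2 * omega \<mu> w - C)"
  by (simp add: cleared_def omega_norm field_simps)

text \<open>Away from p this is the set where 2 \<omega> - C is positive; p belongs to it since
  \<open>cleared\<close> equals 2 (1 - \<mu>) there. The other primary is excluded by hand because
  \<open>cleared\<close> contains a division by zero at that point.\<close>

definition regular_region :: "(real \<times> real) set" where
  "regular_region = {w. w \<noteq> q \<and> 0 < cleared w}"

lemma cont_cleared: "continuous_on (- {q}) cleared"
  unfolding cleared_def by (intro continuous_intros) auto

lemma open_regular_region: "open regular_region"
proof -
  have "open ((- {q}) \<inter> cleared -` {0<..})"
    by (rule continuous_open_preimage[OF cont_cleared]) auto
  moreover have "(- {q}) \<inter> cleared -` {0<..} = regular_region" by (auto simp: regular_region_def)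
  ultimately show ?thesis by simp
qed

lemma regular_regionI:
  assumes "w \<noteq> q" "w = p \<or> 0 < 2 * omega \<mu> w - C" shows "w \<in> regular_region"
proof (cases "w = p")
  case True
  then show ?thesis using assms mu by (simp add: regular_region_def cleared_def)
next
  case False
  then have "0 < norm (w - p)" by simp
  then show ?thesis using assms False by (simp add: regular_region_def cleared_eq)
qed

text \<open>This is \<open>\<psi> + 1/(2 (z - p))\<close>, with \<open>\<psi>\<close> for \<open>grad_lnf\<close>, over the common denominator
  \<open>cleared\<close>: the poles cancel in the numerator.\<close>

definition grad_lnf_bounded_part :: "real \<times> real \<Rightarrow> complex" where
  "grad_lnf_bounded_part w =
     (of_real (norm (w - p)) * ((of_real (fst w) - \<i> * of_real (snd w))
        - of_real \<mu> * ((of_real (fst w) - \<i> * of_real (snd w)) - cnj (to_complex q)) * (inverse (of_real (norm (w - q)))) ^ 3)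
      + (of_real (fst w) ^ 2 + of_real (snd w) ^ 2 + 2 * of_real \<mu> * inverse (of_real (norm (w - q))) - of_real C)
        * (cnj (to_complex (w - p)) * inverse (of_real (norm (w - p)))) * (1/2))
     * inverse (2 * of_real (1 - \<mu>) + of_real (norm (w - p)) *
         (of_real (fst w) ^ 2 + of_real (snd w) ^ 2 + 2 * of_real \<mu> * inverse (of_real (norm (w - q))) - of_real C))"

text \<open>The formula is assembled from coordinates, norms, the direction factor and two inverses,
  so the closure rules apply. The inverses are legitimate on the region because the distance to q
  and \<open>cleared\<close> are continuous and nonzero there.\<close>

lemma mild_at_grad_lnf_bounded_part: "mild_at p regular_region grad_lnf_bounded_part"
proof -
  have q: "q \<notin> regular_region" by (simp add: regular_region_def)
  have s: "mild_at p regular_region (\<lambda>w. inverse (complex_of_real (norm (w - q))))"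
  proof (rule mild_at_inverse[OF mild_at_norm_other[OF q]])
    show "continuous_on regular_region (\<lambda>w. complex_of_real (norm (w - q)))"
      by (intro continuous_intros)
    show "complex_of_real (norm (w - q)) \<noteq> 0" if "w \<in> regular_region" for w
      using q that by auto
  qed
  define D where "D = (\<lambda>w. 2 * of_real (1 - \<mu>) + of_real (norm (w - p)) *
         (of_real (fst w) ^ 2 + of_real (snd w) ^ 2 + 2 * of_real \<mu> * inverse (complex_of_real (norm (w - q))) - of_real C))"
  have eq: "D w = complex_of_real (cleared w)" for w
    by (simp add: D_def cleared_def norm_prod_def inverse_eq_divide)
  have D: "mild_at p regular_region (\<lambda>w. inverse (D w))"
  proof (rule mild_at_inverse)
    show "mild_at p regular_region D"
      unfolding D_def
      by (intro mild_at_add mild_at_mult mild_at_diff mild_at_power mild_at_const mild_at_fst mild_at_snd mild_at_norm s)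
    show "continuous_on regular_region D"
      unfolding eq[abs_def] using q
      by (intro continuous_on_of_real continuous_on_subset[OF cont_cleared]) auto
    show "D w \<noteq> 0" if "w \<in> regular_region" for w
      using that by (simp add: eq regular_region_def)
  qed
  show ?thesis
    unfolding grad_lnf_bounded_part_def
    by (intro mild_at_add mild_at_mult mild_at_diff mild_at_power mild_at_const mild_at_fst mild_at_snd mild_at_norm
        mild_at_direction s D[unfolded D_def])
qed

text \<open>Write r = |w - p|, \<zeta> for w - p as a complex number, and H = 2 \<omega> - C. The
  identity r H = 2 (1 - \<mu>) + r R turns the attraction term -(1 - \<mu>) cnj \<zeta> / (r^3 H)
  into -1 / (2 \<zeta>) + R / (2 \<zeta> H): a pole with a universal coefficient, plus a bounded
  remainder.\<close>

lemma grad_lnf_decomposition: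
  assumes "w \<noteq> p" "w \<noteq> q" "2 * omega \<mu> w - C \<noteq> 0"
  shows "grad_lnf_bounded_part w = grad_lnf w + 1 / (2 * to_complex (w - p))"
proof -
  define r s \<zeta> z R where "r = complex_of_real (norm (w - p))" and "s = complex_of_real (norm (w - q))"
    and "\<zeta> = to_complex (w - p)" and "z = cnj (to_complex w)"
    and "R = complex_of_real ((norm w)\<^sup>2 + 2 * \<mu> / norm (w - q) - C)"
  define G where "G = z - of_real \<mu> * cnj (to_complex (w - q)) * inverse s ^ 3"
  have nz: "r \<noteq> 0" "s \<noteq> 0" "\<zeta> \<noteq> 0" using assms by (auto simp: r_def s_def \<zeta>_def simp del: to_complex_simps(3))
  have rr: "r * r = \<zeta> * cnj \<zeta>"
    unfolding r_def \<zeta>_def using complex_norm_square[of "to_complex (w - p)"]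
    by (simp add: power2_eq_square del: to_complex_simps)
  have h: "r * of_real (2 * omega \<mu> w - C) = of_real (2 * (1 - \<mu>)) + r * R"
    using cleared_eq[OF assms(1)] unfolding r_def R_def cleared_def
    by (simp only: of_real_mult[symmetric] of_real_add[symmetric])
  define H where "H = complex_of_real (2 * omega \<mu> w - C)"
  have H: "H \<noteq> 0" using assms(3) unfolding H_def by (simp del: of_real_diff)
  have om: "of_real (om_x w) - \<i> * of_real (om_y w) = G - of_real (1 - \<mu>) * cnj \<zeta> / r ^ 3"
  proof -
    have 1: "inverse s ^ 3 = of_real (1 / norm (w - q) ^ 3)"
      by (simp add: s_def power_one_over inverse_eq_divide)
    have 2: "of_real (1 - \<mu>) * cnj \<zeta> / r ^ 3 = of_real ((1 - \<mu>) / norm (w - p) ^ 3) * cnj \<zeta>"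
      by (simp add: r_def)
    show ?thesis
      unfolding G_def z_def 1 2 unfolding \<zeta>_def om_x_def om_y_def
      by (simp add: complex_eq_iff diff_divide_distrib add_divide_distrib algebra_simps)
  qed
  have z: "of_real (fst w) - \<i> * of_real (snd w) = z" "z - cnj (to_complex q) = cnj (to_complex (w - q))"
    by (simp_all add: z_def complex_eq_iff)
  have R: "of_real (fst w) ^ 2 + of_real (snd w) ^ 2 + 2 * of_real \<mu> * inverse s - of_real C = R"
    by (simp add: R_def s_def norm_prod_def inverse_eq_divide)
  have "grad_lnf_bounded_part w = (r * G + R * (cnj \<zeta> * inverse r) * (1/2)) * inverse (2 * of_real (1 - \<mu>) + r * R)"
    unfolding grad_lnf_bounded_part_def r_def[symmetric] s_def[symmetric] \<zeta>_def[symmetric] z R G_def ..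
  also have "2 * of_real (1 - \<mu>) + r * R = r * H" using h by (simp add: H_def)
  also have "(r * G + R * (cnj \<zeta> * inverse r) * (1/2)) * inverse (r * H)
      = (G - of_real (1 - \<mu>) * cnj \<zeta> / r ^ 3) / H + 1 / (2 * \<zeta>)"
  proof -
    \<comment> \<open>Eliminating the mass in favour of H and R is what separates the pole; r^2 =
      \<zeta> cnj \<zeta> then removes the conjugate.\<close>
    have a: "of_real (1 - \<mu>) = r * (H - R) / 2" using h by (simp add: H_def algebra_simps)
    have c: "cnj \<zeta> = r * r / \<zeta>" using rr nz by (simp add: field_simps)
    show ?thesis unfolding a c using nz H by (simp add: field_simps power3_eq_cube)
  qed
  finally show ?thesis unfolding grad_lnf_def om H_def \<zeta>_def .
qed

text \<open>Two sets are involved because values and derivatives are used in different places: the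
  values of F are read on the compact set K, which will contain the curve, while the Laplacian is
  compared only on the open set V, where agreement of functions passes to partials.\<close>

lemma grad_lnf_test_function:
  assumes K: "compact K" "K \<subseteq> regular_region" and V: "open V" "V \<subseteq> K"
    and reg: "\<And>v. v \<in> V - {p} \<Longrightarrow> v \<noteq> q \<and> 0 < 2 * omega \<mu> v - C"
  obtains F Fx Fy S B where "punctured_test_function F Fx Fy p S B"
    "\<And>w. w \<in> K \<Longrightarrow> F w = grad_lnf_bounded_part w"
    "\<And>w. w \<in> V - {p} \<Longrightarrow> laplacian lnf w = Re (Fx w + \<i> * Fy w)"
proof -
  obtain F Fx Fy S B where F: "punctured_test_function F Fx Fy p S B"
    "\<And>w. w \<in> K \<Longrightarrow> F w = grad_lnf_bounded_part w"
    using mild_at_extend[OF mild_at_grad_lnf_bounded_part open_regular_region K] by blast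
  have "laplacian lnf w = Re (Fx w + \<i> * Fy w)" if w: "w \<in> V - {p}" for w
  proof -
    \<comment> \<open>Z is twice the complex number w - p, written through coordinates so that the
      rules for partials apply. The partials 2 and 2 \<i> satisfy the Cauchy-Riemann equation, hence
      1 / Z contributes nothing to \<open>dbar2\<close>.\<close>
    define Z where "Z = (\<lambda>v. 2 * ((of_real (fst v) - of_real (fst p)) + \<i> * (of_real (snd v) - of_real (snd p))))"
    have Z: "Z v = 2 * to_complex (v - p)" for v
      by (simp add: Z_def complex_eq_iff)
    have "has_partials Z (0 * (((of_real (fst w) - of_real (fst p)) + \<i> * (of_real (snd w) - of_real (snd p)))) + 2 * ((1 - 0) + (0 * (of_real (snd w) - of_real (snd p)) + \<i> * (0 - 0))))
        (0 * (((of_real (fst w) - of_real (fst p)) + \<i> * (of_real (snd w) - of_real (snd p)))) + 2 * ((0 - 0) + (0 * (of_real (snd w) - of_real (snd p)) + \<i> * (1 - 0)))) w"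
      unfolding Z_def
      by (intro has_partials_add has_partials_diff has_partials_mult has_partials_const has_partials_fst has_partials_snd)
    then have "has_partials Z 2 (2 * \<i>) w" by simp
    then have Zi: "has_partials (\<lambda>v. inverse (Z v)) (- (2 * (inverse (Z w))\<^sup>2)) (- (2 * \<i> * (inverse (Z w))\<^sup>2)) w"
      by (rule has_partials_inverse) (use w in \<open>simp add: Z\<close>)
    have "has_partials F (Fx w) (Fy w) w"
      using punctured_test_function.partials[OF F(1)] w by auto
    from has_partials_diff[OF this Zi]
    have "has_partials grad_lnf (Fx w - - (2 * (inverse (Z w))\<^sup>2)) (Fy w - - (2 * \<i> * (inverse (Z w))\<^sup>2)) w"
    proof (rule has_partials_transform)
      show "open (V - {p})" using V(1) by (intro open_Diff) auto
      show "F v - inverse (Z v) = grad_lnf v" if "v \<in> V - {p}" for v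
        using grad_lnf_decomposition[of v] F(2)[of v] reg[of v] that V(2)
        by (auto simp: Z inverse_eq_divide simp del: to_complex_simps)
    qed (use w in auto)
    then have "laplacian lnf w = Re ((Fx w - - (2 * (inverse (Z w))\<^sup>2)) + \<i> * (Fy w - - (2 * \<i> * (inverse (Z w))\<^sup>2)))"
      using V(1) w reg by (intro laplacian_lnf[of "V - {p}"] open_Diff) auto
    also have "(Fx w - - (2 * (inverse (Z w))\<^sup>2)) + \<i> * (Fy w - - (2 * \<i> * (inverse (Z w))\<^sup>2)) = Fx w + \<i> * Fy w"
      by (simp add: algebra_simps)
    finally show ?thesis .
  qed
  with F that show ?thesis by blast
qed

end

section \<open>The period formula from two evaluations of one contour integral\<close>

theorem theorem2p4:
  fixes \<mu> C T :: real
    and y1 y2 :: "real \<Rightarrow> real"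
    and \<alpha> :: "real \<Rightarrow> real \<times> real"
    and \<Omega> :: "(real \<times> real) set"
    and f :: "real \<times> real \<Rightarrow> real"
  assumes mu: "0 < \<mu>" "\<mu> \<le> 1 / 2"
    and alpha: "\<alpha> = (\<lambda>t. (y1 t, y2 t))"
    and solution: "crtbp_solution \<mu> y1 y2"
    and jacobi: "has_jacobi_integral \<mu> y1 y2 C"
    and periodic: "0 < T" "\<forall>t. \<alpha> (t + T) = \<alpha> t"
    and regular: "\<forall>t. (deriv y1 t, deriv y2 t) \<noteq> (0, 0)"
    and simple: "inj_on \<alpha> {0..<T}"
    and Omega: "\<Omega> = inside (range \<alpha>)"
    and Omega_primary: "primary1 \<mu> \<in> \<Omega>"
    and Omega_hill: "\<Omega> \<subseteq> hill_region \<mu> C \<union> {primary1 \<mu>}"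
    and f: "f = (\<lambda>p. sqrt (2 * omega \<mu> p - C))"
    and ln_f_defined: "\<forall>p \<in> \<Omega> - {primary1 \<mu>}. f p \<noteq> 0"
  shows "set_integrable lborel (\<Omega> - {primary1 \<mu>}) (laplacian (\<lambda>p. ln (f p)))
    \<and> (goes_clockwise_around y1 y2 T \<Omega> \<longrightarrow>
          2 * T = pi + (LINT p:\<Omega> - {primary1 \<mu>}|lborel. laplacian (\<lambda>p. ln (f p)) p))
    \<and> (goes_counterclockwise_around y1 y2 T \<Omega> \<longrightarrow>
          2 * T = - pi - (LINT p:\<Omega> - {primary1 \<mu>}|lborel. laplacian (\<lambda>p. ln (f p)) p))"
proof -
  interpret crtbp_level \<mu> C by unfold_locales (use mu in auto)
  let ?p = "primary1 \<mu>" and ?q = "primary2 \<mu>"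
  have lnf: "(\<lambda>p. ln (f p)) = lnf" by (simp add: f lnf_def fun_eq_iff)
  define h where "h = (\<lambda>w. 2 * omega \<mu> w - C)"
  have avoid: "\<alpha> t \<noteq> ?p" "\<alpha> t \<noteq> ?q" for t
    using solution by (auto simp: crtbp_solution_def alpha)
  have D: "(y1 has_real_derivative deriv y1 t) (at t)" "(y2 has_real_derivative deriv y2 t) (at t)"
    "(deriv y1 has_real_derivative om_x (\<alpha> t) + 2 * deriv y2 t) (at t)"
    "(deriv y2 has_real_derivative om_y (\<alpha> t) - 2 * deriv y1 t) (at t)" for t
  proof -
    have "partial1 (omega \<mu>) (y1 t, y2 t) = om_x (\<alpha> t)" "partial2 (omega \<mu>) (y1 t, y2 t) = om_y (\<alpha> t)"
      using partial_omega[OF avoid(1,2)[of t]] by (simp_all add: alpha)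
    then show "(y1 has_real_derivative deriv y1 t) (at t)" "(y2 has_real_derivative deriv y2 t) (at t)"
      "(deriv y1 has_real_derivative om_x (\<alpha> t) + 2 * deriv y2 t) (at t)"
      "(deriv y2 has_real_derivative om_y (\<alpha> t) - 2 * deriv y1 t) (at t)"
      using solution[unfolded crtbp_solution_def, rule_format, of t] by simp_all
  qed
  have energy: "h (\<alpha> t) = (deriv y1 t)\<^sup>2 + (deriv y2 t)\<^sup>2" for t
    using jacobi[unfolded has_jacobi_integral_def, rule_format, of t] by (simp add: h_def alpha)
  \<comment> \<open>On the curve f is the speed, so regularity keeps the orbit away from the zero
    velocity set and ln f is smooth along it.\<close>
  have h_curve: "0 < h (\<alpha> t)" for t
    using regular[rule_format, of t] unfolding energy by (auto simp: sum_power2_gt_zero_iff)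
  define z where "z = (\<lambda>t. Complex (y1 t) (y2 t))"
  define v where "v = (\<lambda>t. Complex (deriv y1 t) (deriv y2 t))"
  define a where "a = (\<lambda>t. Complex (om_x (\<alpha> t) + 2 * deriv y2 t) (om_y (\<alpha> t) - 2 * deriv y1 t))"
  have z: "(z has_vector_derivative v t) (at t)" and v: "(v has_vector_derivative a t) (at t)" for t
    unfolding z_def v_def a_def using D by (auto simp: has_vector_derivative_complex_iff)
  have to_z: "to_complex (\<alpha> t) = z t" for t by (simp add: to_complex_def alpha z_def)
  have contv: "continuous_on UNIV v" and contz: "continuous_on UNIV z"
    using z v by (meson continuous_at_imp_continuous_on has_vector_derivative_continuous)+
  have cont\<alpha>: "continuous_on S \<alpha>" for S
  proof -
    have "\<alpha> = (\<lambda>t. (Re (z t), Im (z t)))" by (simp add: alpha z_def)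
    then show ?thesis using continuous_on_subset[OF contz]
      by (simp add: continuous_on_Pair continuous_on_Re continuous_on_Im)
  qed
  have conta: "continuous_on UNIV a"
  proof -
    have "a = (\<lambda>t. (of_real (om_x (\<alpha> t)) + \<i> * of_real (om_y (\<alpha> t))) - 2 * \<i> * v t)"
      by (simp add: a_def v_def complex_eq_iff fun_eq_iff)
    moreover have "continuous_on UNIV (\<lambda>t. om_x (\<alpha> t))" "continuous_on UNIV (\<lambda>t. om_y (\<alpha> t))"
      unfolding om_x_def om_y_def using avoid by (intro continuous_intros cont\<alpha>; simp)+
    ultimately show ?thesis using contv by (auto intro!: continuous_intros)
  qed
  \<comment> \<open>Time is rescaled to period 1; each derivative picks up a factor T, which is how
    T enters the final identity.\<close>
  define g where "g = (\<lambda>s. z (T * s))"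
  define g' where "g' = (\<lambda>s. of_real T * v (T * s))"
  define g'' where "g'' = (\<lambda>s. of_real T * (of_real T * a (T * s)))"
  have scale: "((\<lambda>s. k (T * s)) has_vector_derivative of_real T * k' (T * t)) (at t)"
    if k: "\<And>t. (k has_vector_derivative k' t) (at t)" for k k' :: "real \<Rightarrow> complex" and t
  proof -
    have "((k \<circ> (\<lambda>s. T * s)) has_vector_derivative T *\<^sub>R k' (T * t)) (at t)"
      by (rule vector_diff_chain_at[OF _ k]) (auto intro!: derivative_eq_intros)
    then show ?thesis by (simp add: o_def scaleR_conv_of_real)
  qed
  have dg: "(g has_vector_derivative g' t) (at t)" for t
    unfolding g_def g'_def by (rule scale[OF z])
  have dg': "(g' has_vector_derivative g'' t) (at t)" for t
    unfolding g'_def g''_def by (rule has_vector_derivative_mult_right[OF scale[OF v]])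
  have contg': "continuous_on UNIV g'" unfolding g'_def
    by (intro continuous_intros continuous_on_compose2[OF contv]) auto
  have contg'': "continuous_on UNIV g''" unfolding g''_def
    by (intro continuous_intros continuous_on_compose2[OF conta]) auto
  have v_nz: "v t \<noteq> 0" for t using regular by (auto simp: v_def complex_eq_iff)
  interpret loop: regular_loop g g'
  proof
    show "g' t \<noteq> 0" for t using v_nz periodic by (simp add: g'_def)
    show "g (t + 1) = g t" for t
      using periodic(2)[rule_format, of "T * t"] by (simp add: g_def ring_distribs flip: to_z)
    show "inj_on g {0..<1}"
    proof (rule inj_onI)
      fix s t assume st: "s \<in> {0..<1::real}" "t \<in> {0..<1}" "g s = g t"
      then have "\<alpha> (T * s) = \<alpha> (T * t)" by (simp add: g_def flip: to_z)
      moreover have "T * s \<in> {0..<T}" "T * t \<in> {0..<T}" using st periodic(1) by auto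
      ultimately have "T * s = T * t" using simple by (meson inj_onD)
      then show "s = t" using periodic(1) by simp
    qed
  qed (rule dg contg')+
  have path_eq: "period_path y1 y2 T = g" by (simp add: period_path_def g_def z_def)
  have image: "path_image g = to_complex ` range \<alpha>"
  proof -
    have "range g = range z"
    proof
      show "range z \<subseteq> range g"
      proof
        fix u assume "u \<in> range z"
        then obtain t where "u = z t" by blast
        then have "u = g (t / T)" using periodic(1) by (simp add: g_def)
        then show "u \<in> range g" by blast
      qed
    qed (auto simp: g_def)
    then show ?thesis by (simp add: loop.path_image_eq_range image_image to_z)
  qed
  have range_\<alpha>: "range \<alpha> = \<alpha> ` {0..T}"
  proof -
    have "to_complex ` range \<alpha> = to_complex ` (\<alpha> ` {0..T})"
    proof -
      have "g ` {0..1} = z ` {0..T}"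
      proof -
        have "(\<lambda>s. T * s) ` {0..1} = {0..T}" using periodic(1) by (simp add: image_mult_atLeastAtMost)
        then show ?thesis by (metis (no_types, lifting) g_def image_cong image_image)
      qed
      then show ?thesis using image by (simp add: path_image_def image_image to_z)
    qed
    moreover have "inj to_complex" by (rule injI) simp
    ultimately show ?thesis by (simp add: inj_image_eq_iff)
  qed
  have compact_range: "compact (range \<alpha>)"
    unfolding range_\<alpha> by (intro compact_continuous_image cont\<alpha>) auto
  have open\<Omega>: "open \<Omega>" unfolding Omega
    by (intro open_inside compact_imp_closed compact_range)
  have inside_eq: "to_complex ` \<Omega> = inside (path_image g)"
    unfolding image Omega inside_to_complex_image ..
  define K where "K = \<Omega> \<union> range \<alpha>"
  have K: "compact K"
  proof -
    have "closed K"
    proof -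
      have "K = - outside (range \<alpha>)" unfolding K_def Omega using union_with_inside by blast
      then show ?thesis using open_outside[OF compact_imp_closed[OF compact_range]] by (simp add: closed_Compl)
    qed
    moreover have "bounded K" unfolding K_def Omega
      using compact_range by (intro bounded_Un[THEN iffD2] conjI bounded_inside compact_imp_bounded)
    ultimately show ?thesis by (simp add: compact_eq_bounded_closed)
  qed
  \<comment> \<open>Membership in the Hill region gives h \<ge> 0 and excludes the second primary;
    strictness comes from ln f being defined.\<close>
  have h_inside: "w \<noteq> ?q \<and> 0 < h w" if w: "w \<in> \<Omega> - {?p}" for w
  proof -
    have "w \<in> hill_region \<mu> C" using w Omega_hill by blast
    then have "w \<noteq> ?q" "0 \<le> h w" by (auto simp: hill_region_def h_def)
    moreover have "sqrt (h w) \<noteq> 0" using ln_f_defined w by (simp add: f h_def)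
    ultimately show ?thesis by (simp add: less_le)
  qed
  have pq: "?p \<noteq> ?q" by (simp add: primary1_def primary2_def)
  have K_regular: "K \<subseteq> regular_region"
  proof
    fix w assume "w \<in> K"
    then consider "w = ?p" | "w \<in> \<Omega> - {?p}" | "w \<in> range \<alpha>" unfolding K_def by blast
    then show "w \<in> regular_region"
    proof cases
      case 1
      then show ?thesis using pq by (intro regular_regionI) auto
    next
      case 2
      then show ?thesis using h_inside[OF 2] by (intro regular_regionI) (auto simp: h_def)
    next
      case 3
      then show ?thesis using avoid h_curve by (intro regular_regionI) (auto simp: h_def)
    qed
  qed
  obtain F Fx Fy S B where "punctured_test_function F Fx Fy ?p S B"
    and F: "\<And>w. w \<in> K \<Longrightarrow> F w = grad_lnf_bounded_part w"
    and lap: "\<And>w. w \<in> \<Omega> - {?p} \<Longrightarrow> laplacian lnf w = Re (Fx w + \<i> * Fy w)"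
    by (rule grad_lnf_test_function[OF K K_regular open\<Omega>])
      (use h_inside in \<open>auto simp: K_def h_def\<close>)
  then interpret F: punctured_test_function F Fx Fy ?p S B by simp
  \<comment> \<open>By the convention at the puncture the integrand is 0 at p, so integration over
    \<Omega> and over \<Omega> without p agree pointwise.\<close>
  have dbar2_p: "F.dbar2 ?p = 0"
    using F.bound(2)[of ?p] F.bound(3)[of ?p] by (simp add: F.dbar2_def)
  have lap_eq: "indicator (\<Omega> - {?p}) w *\<^sub>R laplacian lnf w = Re (indicator \<Omega> w *\<^sub>R F.dbar2 w)" for w
    using lap[of w] dbar2_p by (cases "w = ?p") (auto simp: indicator_def F.dbar2_def)
  have [measurable]: "\<Omega> \<in> sets borel" using open\<Omega> by simp
  have int_dbar: "integrable lborel (\<lambda>w. indicator \<Omega> w *\<^sub>R F.dbar2 w)"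
    by (rule Bochner_Integration.integrable_bound[OF F.integrable_partials(3)]) (auto simp: indicator_def)
  have integrable: "set_integrable lborel (\<Omega> - {?p}) (laplacian lnf)"
    unfolding set_integrable_def lap_eq by (rule integrable_Re[OF int_dbar])
  define I where "I = (LINT p:\<Omega> - {?p}|lborel. laplacian lnf p)"
  have I: "I = Re (\<integral>w. indicator \<Omega> w *\<^sub>R F.dbar2 w \<partial>lborel)"
    unfolding I_def set_lebesgue_integral_def lap_eq by (rule integral_Re[OF int_dbar])
  have p_off: "to_complex ?p \<notin> path_image g"
  proof
    assume "to_complex ?p \<in> path_image g"
    then obtain t where "to_complex ?p = to_complex (\<alpha> t)" unfolding image by blast
    then show False using avoid(1)[of t] by simp
  qed
  have g0: "0 \<notin> path_image g'"
    unfolding path_image_def using loop.nz by (metis imageE)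
  \<comment> \<open>Both orientations are treated at once, \<sigma> being the constant winding
    number on \<Omega>. The integral of \<open>grad_lnf\<close> along the curve is evaluated by
    Green's theorem (\<open>P1\<close>) and through the rotation of the velocity
    (\<open>P2\<close>), and the imaginary parts are compared.\<close>
  have key: "2 * T = - \<sigma> * pi - \<sigma> * I"
    if \<sigma>: "\<And>w. w \<in> \<Omega> \<Longrightarrow> winding_number g (to_complex w) = of_real \<sigma>" for \<sigma> :: real
  proof -
    define W where "W = (\<lambda>w. of_real \<sigma> * (indicator \<Omega> w :: complex))"
    have W: "winding_number g (to_complex w) = W w" if w: "to_complex w \<notin> path_image g" for w
    proof (cases "w \<in> \<Omega>")
      case False
      then have "to_complex w \<notin> inside (path_image g)"
        unfolding inside_eq[symmetric] by auto
      then have "to_complex w \<in> outside (path_image g)"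
        using w by (metis ComplI UnE inside_Un_outside)
      then have "winding_number g (to_complex w) = 0"
        using loop.path_loop by (intro winding_number_zero_in_outside) (auto simp: pathfinish_def pathstart_def)
      then show ?thesis using False by (simp add: W_def)
    qed (simp add: W_def \<sigma>)
    define X where "X = (\<integral>w. indicator \<Omega> w *\<^sub>R F.dbar2 w \<partial>lborel)"
    have "(\<integral>w. W w * F.dbar2 w \<partial>lborel) = of_real \<sigma> * X"
    proof -
      have eq: "W w * F.dbar2 w = of_real \<sigma> * (indicator \<Omega> w *\<^sub>R F.dbar2 w)" for w
        by (simp add: W_def indicator_def)
      show ?thesis unfolding X_def eq by (rule integral_mult_right_zero)
    qed
    then have green: "((\<lambda>t. F (Re (g t), Im (g t)) * g' t) has_integral \<i> * (of_real \<sigma> * X)) {0..1}"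
      using F.green_winding[OF dg contg' loop.path_loop(3) p_off _ W] by (simp add: W_def)
    define P where "P = (\<lambda>t. grad_lnf (\<alpha> (T * t)) * g' t)"
    have F_curve: "F (Re (g t), Im (g t)) * g' t = P t + (1/2) * (g' t / (g t - to_complex ?p))" for t
    proof -
      have "(Re (g t), Im (g t)) = \<alpha> (T * t)" by (simp add: g_def z_def alpha)
      then have "F (Re (g t), Im (g t)) = grad_lnf_bounded_part (\<alpha> (T * t))"
        using F[of "\<alpha> (T * t)"] by (simp add: K_def)
      also have "\<dots> = grad_lnf (\<alpha> (T * t)) + 1 / (2 * (g t - to_complex ?p))"
        using grad_lnf_decomposition[of "\<alpha> (T * t)"] avoid h_curve[of "T * t"]
        by (simp add: h_def g_def to_z)
      finally show ?thesis by (simp add: P_def ring_distribs)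
    qed
    \<comment> \<open>The primary lies in \<Omega>, so the curve winds \<sigma> times around the
      pole as well.\<close>
    have pole: "((\<lambda>t. g' t / (g t - to_complex ?p)) has_integral 2 * of_real pi * \<i> * of_real \<sigma>) {0..1}"
      using has_integral_winding_number[OF dg contg' p_off] \<sigma>[OF Omega_primary] by simp
    have "((\<lambda>t. (P t + (1/2) * (g' t / (g t - to_complex ?p))) - (1/2) * (g' t / (g t - to_complex ?p)))
        has_integral (\<i> * (of_real \<sigma> * X) - (1/2) * (2 * of_real pi * \<i> * of_real \<sigma>))) {0..1}"
      using green unfolding F_curve
      by (intro has_integral_diff has_integral_mult_right pole)
    then have P1: "(P has_integral (\<i> * (of_real \<sigma> * X) - of_real pi * \<i> * of_real \<sigma>)) {0..1}"
      by (simp add: mult.assoc)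
    \<comment> \<open>The Umlaufsatz supplies a point of \<Omega> whose winding number is the
      rotation number; on \<Omega> that winding number is \<sigma>.\<close>
    obtain w0 where "w0 \<in> inside (path_image g)" "winding_number g w0 = winding_number g' 0"
      by (rule loop.umlaufsatz)
    then have "winding_number g' 0 = of_real \<sigma>"
      using \<sigma> by (metis inside_eq imageE)
    then have rot: "((\<lambda>t. g'' t / g' t) has_integral 2 * of_real pi * \<i> * of_real \<sigma>) {0..1}"
      using has_integral_winding_number[OF dg' contg'' g0] by simp
    \<comment> \<open>By the energy relation h = u cnj u, with u the velocity, conjugating
      \<open>grad_lnf\<close> times u gives the gradient N of \<omega> divided by u. The Coriolis
      term contributes the constant -2 \<i>, and one factor T survives from the rescaling.\<close>
    have log_deriv: "g'' t / g' t = cnj (P t) - 2 * of_real T * \<i>" for t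
    proof -
      define N where "N = Complex (om_x (\<alpha> (T * t))) (om_y (\<alpha> (T * t)))"
      define u where "u = v (T * t)"
      have u: "u \<noteq> 0" by (simp add: u_def v_nz)
      have a: "a (T * t) = N - 2 * \<i> * u"
        by (simp add: a_def N_def u_def v_def complex_eq_iff)
      have "complex_of_real (h (\<alpha> (T * t))) = u * cnj u"
        unfolding energy by (simp add: u_def v_def complex_eq_iff power2_eq_square)
      moreover have "grad_lnf (\<alpha> (T * t)) = cnj N / of_real (h (\<alpha> (T * t)))"
        by (simp add: grad_lnf_def h_def N_def Complex_eq)
      ultimately have grad: "grad_lnf (\<alpha> (T * t)) = cnj N / (u * cnj u)" by simp
      have cP: "cnj (P t) = of_real T * N / u"
        unfolding P_def grad g'_def u_def[symmetric] using u by simp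
      have gg: "g'' t / g' t = of_real T * (N - 2 * \<i> * u) / u"
        using u periodic(1) by (simp add: g''_def g'_def a u_def[symmetric])
      show ?thesis unfolding cP gg using u by (simp add: field_simps)
    qed
    have "((\<lambda>t. (cnj (P t) - 2 * of_real T * \<i>) + 2 * of_real T * \<i>) has_integral
        (2 * of_real pi * \<i> * of_real \<sigma> + 2 * of_real T * \<i>)) {0..1}"
      using rot unfolding log_deriv
      by (intro has_integral_add) (use has_integral_const_real[of "2 * of_real T * \<i>" 0 1] in auto)
    then have "((\<lambda>t. cnj (P t)) has_integral (2 * of_real pi * \<i> * of_real \<sigma> + 2 * of_real T * \<i>)) {0..1}"
      by simp
    from has_integral_linear[OF this bounded_linear_cnj]
    have P2: "(P has_integral cnj (2 * of_real pi * \<i> * of_real \<sigma> + 2 * of_real T * \<i>)) {0..1}"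
      by (simp add: o_def)
    have "\<i> * (of_real \<sigma> * X) - of_real pi * \<i> * of_real \<sigma> = cnj (2 * of_real pi * \<i> * of_real \<sigma> + 2 * of_real T * \<i>)"
      by (rule has_integral_unique[OF P1 P2])
    \<comment> \<open>The pole contributes - pi \<sigma> on the left, the rotation of the velocity
      -2 pi \<sigma> on the right, whose sign comes from the conjugation; their difference is the
      single pi of the theorem.\<close>
    from arg_cong[OF this, of Im] have "\<sigma> * Re X - pi * \<sigma> = - (2 * pi * \<sigma> + 2 * T)" by simp
    then show ?thesis unfolding I X_def[symmetric] by (simp add: algebra_simps)
  qed
  have cw: "2 * T = pi + I" if cw: "goes_clockwise_around y1 y2 T \<Omega>"
  proof -
    have "winding_number g (to_complex w) = of_real (-1)" if "w \<in> \<Omega>" for w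
      using bspec[OF cw[unfolded goes_clockwise_around_def] that] by (simp add: path_eq to_complex_def case_prod_unfold)
    from key[OF this] show ?thesis by simp
  qed
  have ccw: "2 * T = - pi - I" if ccw: "goes_counterclockwise_around y1 y2 T \<Omega>"
  proof -
    have "winding_number g (to_complex w) = of_real 1" if "w \<in> \<Omega>" for w
      using bspec[OF ccw[unfolded goes_counterclockwise_around_def] that] by (simp add: path_eq to_complex_def case_prod_unfold)
    from key[OF this] show ?thesis by simp
  qed
  show ?thesis
    unfolding lnf using integrable cw ccw by (simp add: I_def)
qed

end
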